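(* Let $(M,\omega,\eta)$ be a cosymplectic manifold of dimension $2n+1$. Then any point $x\in M$ has a local coordinate system $(z,x_1,\dots,x_n,y_1,\dots,y_n)$ in which $\eta$ agrees with $dz$ and $\omega$ agrees with $\sum_{i=1}^n dx_i\wedge dy_i$.
   Context: A cosymplectic structure on a manifold $M$ is a pair $(\omega,\eta)$ of a closed $2$-form $\omega$ and a closed $1$-form $\eta$ such that at each $x\in M$, $\eta_x\neq0$ and the linear map $T_xM\to T_x^*M$, $Y\mapsto\imath_Y\omega_x+\eta_x(Y)\eta_x$, is bijective; $(M,\omega,\eta)$ is then called a cosymplectic manifold. *)

theory Defs
  imports "HOL-Analysis.Analysis"
begin

section \<open>Smooth maps between normed spaces\<close>

text \<open>
  Intended for open sets in finite-dimensional spaces, where \<open>C\<^sup>k\<close> is equivalent to the existence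
  and continuity of all iterated directional derivatives of order at most \<open>k\<close>.
\<close>

fun Ck_on :: "nat \<Rightarrow> 'b::real_normed_vector set \<Rightarrow> ('b \<Rightarrow> 'c::real_normed_vector) \<Rightarrow> bool" where
  "Ck_on 0 S f \<longleftrightarrow> continuous_on S f"
| "Ck_on (Suc k) S f \<longleftrightarrow>
     (\<forall>u\<in>S. f differentiable (at u)) \<and> (\<forall>h. Ck_on k S (\<lambda>u. frechet_derivative f (at u) h))"

definition smooth_on :: "'b::real_normed_vector set \<Rightarrow> ('b \<Rightarrow> 'c::real_normed_vector) \<Rightarrow> bool" where
  "smooth_on S f \<longleftrightarrow> (\<forall>k. Ck_on k S f)"


section \<open>Smooth manifolds\<close>

text \<open>
  A chart is a pair \<open>(U, \<phi>)\<close>; the values of \<open>\<phi>\<close> outside \<open>U\<close> are irrelevant.  The dimension of the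
  manifold is the cardinality of the index type \<open>'m\<close>.
\<close>

type_synonym ('a, 'm) chart = "'a set \<times> ('a \<Rightarrow> real ^ 'm)"

abbreviation cdom :: "('a, 'm::finite) chart \<Rightarrow> 'a set" where
  "cdom c \<equiv> fst c"

abbreviation cmap :: "('a, 'm::finite) chart \<Rightarrow> 'a \<Rightarrow> real ^ 'm" where
  "cmap c \<equiv> snd c"

definition cinv :: "('a, 'm::finite) chart \<Rightarrow> real ^ 'm \<Rightarrow> 'a" where
  "cinv c = inv_into (cdom c) (cmap c)"

definition is_chart :: "'a topology \<Rightarrow> ('a, 'm::finite) chart \<Rightarrow> bool" where
  "is_chart X c \<longleftrightarrow>
     openin X (cdom c) \<and> open (cmap c ` cdom c) \<and>
     homeomorphic_map (subtopology X (cdom c)) (top_of_set (cmap c ` cdom c)) (cmap c)"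

definition transition :: "('a, 'm::finite) chart \<Rightarrow> ('a, 'm) chart \<Rightarrow> real ^ 'm \<Rightarrow> real ^ 'm" where
  "transition c d = cmap d \<circ> cinv c"

definition smooth_compatible :: "('a, 'm::finite) chart \<Rightarrow> ('a, 'm) chart \<Rightarrow> bool" where
  "smooth_compatible c d \<longleftrightarrow>
     smooth_on (cmap c ` (cdom c \<inter> cdom d)) (transition c d) \<and>
     smooth_on (cmap d ` (cdom c \<inter> cdom d)) (transition d c)"

text \<open>\<open>A\<close> is the maximal smooth atlas, i.e. the set of all charts of the smooth structure.\<close>

definition smooth_manifold :: "'a topology \<Rightarrow> ('a, 'm::finite) chart set \<Rightarrow> bool" where
  "smooth_manifold X A \<longleftrightarrow>
     Hausdorff_space X \<and> second_countable X \<and>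
     (\<forall>c\<in>A. is_chart X c) \<and>
     (\<Union>c\<in>A. cdom c) = topspace X \<and>
     (\<forall>c\<in>A. \<forall>d\<in>A. smooth_compatible c d) \<and>
     (\<forall>c. is_chart X c \<and> (\<forall>d\<in>A. smooth_compatible c d) \<longrightarrow> c \<in> A)"

text \<open>
  An unordered index type \<open>'m\<close> labels the components of a chart, so a list of functions on \<open>U\<close> is a
  local coordinate system if it enumerates the components of some chart with domain \<open>U\<close>.
\<close>

definition local_coordinates ::
    "('a, 'm::finite) chart set \<Rightarrow> 'a set \<Rightarrow> ('a \<Rightarrow> real) list \<Rightarrow> bool" where
  "local_coordinates A U fs \<longleftrightarrow>
     (\<exists>\<phi> e. (U, \<phi>) \<in> A \<and> bij_betw e {..<length fs} (UNIV :: 'm set) \<and>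
        (\<forall>p\<in>U. \<forall>k<length fs. (fs ! k) p = \<phi> p $ e k))"


section \<open>Tangent and cotangent spaces\<close>

text \<open>
  A tangent vector at \<open>p\<close> is a family of component vectors, one for each chart around \<open>p\<close>, that
  transforms by the Jacobians of the transition maps.  It is \<open>0\<close> on all other arguments, so that
  equality of tangent vectors is equality of functions.
\<close>

type_synonym ('a, 'm) tangent = "('a, 'm) chart \<Rightarrow> real ^ 'm"

definition tangent_space ::
    "('a, 'm::finite) chart set \<Rightarrow> 'a \<Rightarrow> ('a, 'm) tangent set" where
  "tangent_space A p =
     {v. (\<forall>c\<in>A. \<forall>d\<in>A. p \<in> cdom c \<and> p \<in> cdom d \<longrightarrow>
            v d = frechet_derivative (transition c d) (at (cmap c p)) (v c)) \<and>
         (\<forall>c. c \<notin> A \<or> p \<notin> cdom c \<longrightarrow> v c = 0)}"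

text \<open>The tangent vector at \<open>p\<close> whose component vector in the chart \<open>c\<close> is \<open>h\<close>.\<close>

definition tvec ::
    "('a, 'm::finite) chart set \<Rightarrow> ('a, 'm) chart \<Rightarrow> 'a \<Rightarrow> real ^ 'm \<Rightarrow> ('a, 'm) tangent" where
  "tvec A c p h = (\<lambda>d. if d \<in> A \<and> p \<in> cdom d
     then frechet_derivative (transition c d) (at (cmap c p)) h else 0)"

definition tangent_linear ::
    "('a, 'm::finite) chart set \<Rightarrow> 'a \<Rightarrow> (('a, 'm) tangent \<Rightarrow> real) \<Rightarrow> bool" where
  "tangent_linear A p \<alpha> \<longleftrightarrow>
     (\<forall>v\<in>tangent_space A p. \<forall>w\<in>tangent_space A p. \<alpha> (\<lambda>c. v c + w c) = \<alpha> v + \<alpha> w) \<and>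
     (\<forall>r. \<forall>v\<in>tangent_space A p. \<alpha> (\<lambda>c. r *\<^sub>R v c) = r * \<alpha> v)"

definition cotangent_space ::
    "('a, 'm::finite) chart set \<Rightarrow> 'a \<Rightarrow> (('a, 'm) tangent \<Rightarrow> real) set" where
  "cotangent_space A p = {\<alpha> \<in> extensional (tangent_space A p). tangent_linear A p \<alpha>}"


section \<open>Differential forms of degree one and two\<close>

text \<open>
  Forms assign a number to a point \<open>p\<close> and tangent vectors at \<open>p\<close>; their values on other arguments
  are irrelevant.
\<close>

type_synonym ('a, 'm) form1 = "'a \<Rightarrow> ('a, 'm) tangent \<Rightarrow> real"
type_synonym ('a, 'm) form2 = "'a \<Rightarrow> ('a, 'm) tangent \<Rightarrow> ('a, 'm) tangent \<Rightarrow> real"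

text \<open>The expressions of forms in a chart \<open>c\<close>, as forms on the open set \<open>cmap c ` cdom c\<close>.\<close>

definition local_form1 ::
    "('a, 'm::finite) chart set \<Rightarrow> ('a, 'm) chart \<Rightarrow> ('a, 'm) form1 \<Rightarrow> real ^ 'm \<Rightarrow> real ^ 'm \<Rightarrow> real" where
  "local_form1 A c \<alpha> u h = \<alpha> (cinv c u) (tvec A c (cinv c u) h)"

definition local_form2 ::
    "('a, 'm::finite) chart set \<Rightarrow> ('a, 'm) chart \<Rightarrow> ('a, 'm) form2 \<Rightarrow>
      real ^ 'm \<Rightarrow> real ^ 'm \<Rightarrow> real ^ 'm \<Rightarrow> real" where
  "local_form2 A c \<beta> u h k = \<beta> (cinv c u) (tvec A c (cinv c u) h) (tvec A c (cinv c u) k)"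

definition one_form ::
    "'a topology \<Rightarrow> ('a, 'm::finite) chart set \<Rightarrow> ('a, 'm) form1 \<Rightarrow> bool" where
  "one_form X A \<alpha> \<longleftrightarrow>
     (\<forall>p\<in>topspace X. tangent_linear A p (\<alpha> p)) \<and>
     (\<forall>c\<in>A. \<forall>h. smooth_on (cmap c ` cdom c) (\<lambda>u. local_form1 A c \<alpha> u h))"

definition two_form ::
    "'a topology \<Rightarrow> ('a, 'm::finite) chart set \<Rightarrow> ('a, 'm) form2 \<Rightarrow> bool" where
  "two_form X A \<beta> \<longleftrightarrow>
     (\<forall>p\<in>topspace X. \<forall>v\<in>tangent_space A p.
        tangent_linear A p (\<lambda>w. \<beta> p v w) \<and> tangent_linear A p (\<lambda>w. \<beta> p w v) \<and> \<beta> p v v = 0) \<and>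
     (\<forall>c\<in>A. \<forall>h k. smooth_on (cmap c ` cdom c) (\<lambda>u. local_form2 A c \<beta> u h k))"

text \<open>
  The exterior derivative computed in a chart, by the invariant formula applied to constant vector
  fields (whose Lie brackets vanish).
\<close>

definition ext_deriv1 ::
    "('a, 'm::finite) chart set \<Rightarrow> ('a, 'm) chart \<Rightarrow> ('a, 'm) form1 \<Rightarrow>
      real ^ 'm \<Rightarrow> real ^ 'm \<Rightarrow> real ^ 'm \<Rightarrow> real" where
  "ext_deriv1 A c \<alpha> u h k =
     frechet_derivative (\<lambda>u. local_form1 A c \<alpha> u k) (at u) h -
     frechet_derivative (\<lambda>u. local_form1 A c \<alpha> u h) (at u) k"

definition ext_deriv2 ::
    "('a, 'm::finite) chart set \<Rightarrow> ('a, 'm) chart \<Rightarrow> ('a, 'm) form2 \<Rightarrow>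
      real ^ 'm \<Rightarrow> real ^ 'm \<Rightarrow> real ^ 'm \<Rightarrow> real ^ 'm \<Rightarrow> real" where
  "ext_deriv2 A c \<beta> u h k l =
     frechet_derivative (\<lambda>u. local_form2 A c \<beta> u k l) (at u) h -
     frechet_derivative (\<lambda>u. local_form2 A c \<beta> u h l) (at u) k +
     frechet_derivative (\<lambda>u. local_form2 A c \<beta> u h k) (at u) l"

definition closed_one_form ::
    "'a topology \<Rightarrow> ('a, 'm::finite) chart set \<Rightarrow> ('a, 'm) form1 \<Rightarrow> bool" where
  "closed_one_form X A \<alpha> \<longleftrightarrow>
     one_form X A \<alpha> \<and> (\<forall>c\<in>A. \<forall>u\<in>cmap c ` cdom c. \<forall>h k. ext_deriv1 A c \<alpha> u h k = 0)"

definition closed_two_form ::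
    "'a topology \<Rightarrow> ('a, 'm::finite) chart set \<Rightarrow> ('a, 'm) form2 \<Rightarrow> bool" where
  "closed_two_form X A \<beta> \<longleftrightarrow>
     two_form X A \<beta> \<and> (\<forall>c\<in>A. \<forall>u\<in>cmap c ` cdom c. \<forall>h k l. ext_deriv2 A c \<beta> u h k l = 0)"

text \<open>
  The differential at \<open>p\<close> of a function that is smooth near \<open>p\<close>; by the transformation law of
  tangent vectors it does not depend on the chart chosen around \<open>p\<close>.
\<close>

definition differential :: "('a, 'm::finite) chart set \<Rightarrow> ('a \<Rightarrow> real) \<Rightarrow> ('a, 'm) form1" where
  "differential A f p v =
     (let c = (SOME c. c \<in> A \<and> p \<in> cdom c)
      in frechet_derivative (f \<circ> cinv c) (at (cmap c p)) (v c))"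

definition wedge :: "('a, 'm::finite) form1 \<Rightarrow> ('a, 'm) form1 \<Rightarrow> ('a, 'm) form2" where
  "wedge \<alpha> \<beta> p v w = \<alpha> p v * \<beta> p w - \<alpha> p w * \<beta> p v"


section \<open>Cosymplectic manifolds\<close>

definition cosymplectic_manifold ::
    "'a topology \<Rightarrow> ('a, 'm::finite) chart set \<Rightarrow> ('a, 'm) form2 \<Rightarrow> ('a, 'm) form1 \<Rightarrow> bool" where
  "cosymplectic_manifold X A \<omega> \<eta> \<longleftrightarrow>
     smooth_manifold X A \<and> closed_two_form X A \<omega> \<and> closed_one_form X A \<eta> \<and>
     (\<forall>p\<in>topspace X.
        (\<exists>v\<in>tangent_space A p. \<eta> p v \<noteq> 0) \<and>
        bij_betw (\<lambda>v. restrict (\<lambda>w. \<omega> p v w + \<eta> p v * \<eta> p w) (tangent_space A p))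
          (tangent_space A p) (cotangent_space A p))"

end

theory Submission
  imports Defs
begin

text \<open>
  In a chart around the given point the forms become a closed one-form \<open>E\<close> and a closed two-form \<open>W\<close>
  on a ball in \<open>\<real>\<^sup>2\<^sup>n\<^sup>+\<^sup>1\<close>. By the Poincare lemma \<open>E = dz\<close>. Since an alternating form in odd dimension
  is degenerate, there is a unique (Reeb) field \<open>R\<close> with \<open>W(R, \<cdot>) = 0\<close> and \<open>E(R) = 1\<close>, and its flow
  preserves \<open>W\<close>. Flowing from a transversal hyperplane until \<open>z\<close> reaches a prescribed value makes \<open>z\<close>
  linear and \<open>W\<close> a pullback from the hyperplane. Moser's trick then deforms this pullback into its
  constant value at the centre, along vector fields that annihilate \<open>E\<close>, and linear algebra
  puts the constant form into the standard shape.

  Both flows run over the unit time interval and start near a point that is stationary to first order in the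
  state, so that Picard's map is a contraction with constant \<open>1/2\<close> on a space of bounded continuous
  functions. Smooth dependence on parameters needs no Gronwall estimates: the derivative of a
  fixed point solves a linear fixed point equation whose coefficients are as smooth as the fixed
  point itself, so its order of differentiability can be increased step by step.
\<close>

section \<open>Calculus of smooth maps\<close>

text \<open>The order of the two deformations matters. Moser's field has to be annihilated by
  \<open>E\<close>, and this can be read off a primitive of the form only in coordinates where
  \<open>W\<close> annihilates a constant vector: the radial homotopy integral then vanishes on this
  vector too. Hence the Reeb direction is straightened before the deformation. Existence up to time
  1 comes from the centre in both flows: the Reeb field is multiplied by a travel time that vanishes
  there, and the primitive of \<open>W u - W 0\<close> vanishes there to second order, since its
  integrand carries a factor \<open>u\<close> besides the difference. Any contraction constant below
  1 would serve; \<open>1/2\<close> makes each absorption cost a factor 2. Smoothness is given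
  through derivatives in fixed directions. A direction that moves with the point is therefore
  expanded in a basis, and derivatives and forms are packaged as maps into spaces of bounded linear
  maps, where products, compositions and fixed point equations can be treated uniformly.\<close>

abbreviation fd :: "('a::real_normed_vector \<Rightarrow> 'b::real_normed_vector) \<Rightarrow> 'a \<Rightarrow> 'a \<Rightarrow> 'b" where
  "fd f u \<equiv> frechet_derivative f (at u)"

lemma fd_eqI: "(f has_derivative f') (at u) \<Longrightarrow> fd f u = f'"
  by (rule frechet_derivative_at[symmetric])

text \<open>Holds also where \<open>f\<close> is not differentiable: both choice operators range
  over the same predicate.\<close>

lemma fd_cong_open:
  assumes "open S" "u \<in> S" "\<And>x. x \<in> S \<Longrightarrow> f x = g x"
  shows "fd f u = fd g u"
proof -
  have "(f has_derivative f') (at u) = (g has_derivative f') (at u)" for f'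
    using has_derivative_transform_within_open[of f f' u UNIV S g]
      has_derivative_transform_within_open[of g f' u UNIV S f] assms by auto
  then show ?thesis unfolding frechet_derivative_def by simp
qed

text \<open>The congruence rule is a hypothesis because \<open>Ck_on_cong\<close> at order
  \<open>Suc k\<close> is itself proved through this rule from order \<open>k\<close>;
  \<open>Ck_on_SucI'\<close> discharges it afterwards.\<close>

lemma Ck_on_SucI:
  assumes "open S" "\<And>u. u \<in> S \<Longrightarrow> (f has_derivative f' u) (at u)"
    and "\<And>h. Ck_on k S (\<lambda>u. f' u h)"
    and cong: "\<And>g g' :: 'a \<Rightarrow> 'b. (\<And>x. x \<in> S \<Longrightarrow> g x = g' x) \<Longrightarrow> Ck_on k S g \<Longrightarrow> Ck_on k S g'"
  shows "Ck_on (Suc k) S (f :: 'a::real_normed_vector \<Rightarrow> 'b::real_normed_vector)"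
proof -
  have "fd f u = f' u" if "u \<in> S" for u using assms(2)[OF that] by (rule fd_eqI)
  moreover have "\<forall>u\<in>S. f differentiable (at u)" using assms(2) differentiable_def by blast
  moreover have "Ck_on k S (\<lambda>u. fd f u h)" for h
    using cong[OF _ assms(3)[of h]] calculation(1) by simp
  ultimately show ?thesis by simp
qed

lemma Ck_on_cong:
  fixes f g :: "'a::real_normed_vector \<Rightarrow> 'b::real_normed_vector"
  assumes "open S" "\<And>x. x \<in> S \<Longrightarrow> f x = g x" "Ck_on k S f"
  shows "Ck_on k S g"
  using assms(2,3)
proof (induction k arbitrary: f g)
  case 0 then show ?case using continuous_on_cong[of S S f g] by auto
next
  case (Suc k)
  have "(g has_derivative fd f u) (at u)" if "u \<in> S" for u
    using has_derivative_transform_within_open[of f "fd f u" u UNIV S g] that Suc.prems assms(1)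
    by (auto simp: frechet_derivative_works)
  then show ?case by (rule Ck_on_SucI[OF assms(1)]) (use Suc in auto)
qed

lemma Ck_on_SucI':
  assumes "open S" "\<And>u. u \<in> S \<Longrightarrow> (f has_derivative f' u) (at u)"
    and "\<And>h. Ck_on k S (\<lambda>u. f' u h)"
  shows "Ck_on (Suc k) S f"
  by (rule Ck_on_SucI[OF assms]) (use Ck_on_cong assms(1) in blast)+

lemma Ck_on_Suc_has_derivative:
  "Ck_on (Suc k) S f \<Longrightarrow> u \<in> S \<Longrightarrow> (f has_derivative fd f u) (at u)"
  by (auto simp: frechet_derivative_works)

lemma Ck_on_continuous: "Ck_on k S f \<Longrightarrow> continuous_on S f"
  by (cases k) (auto intro!: continuous_at_imp_continuous_on differentiable_imp_continuous_within)

lemma Ck_on_SucD: "Ck_on (Suc k) S f \<Longrightarrow> Ck_on k S f"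
proof (induction k arbitrary: f)
  case 0 then show ?case using Ck_on_continuous[OF 0] by simp
next
  case (Suc k)
  have "\<forall>u\<in>S. f differentiable (at u)" "\<And>h. Ck_on (Suc k) S (\<lambda>u. fd f u h)"
    using Suc.prems unfolding Ck_on.simps(2)[of "Suc k" S f] by blast+
  then show ?case using Suc.IH unfolding Ck_on.simps(2)[of k S f] by blast
qed

lemma Ck_on_subset: "Ck_on k S f \<Longrightarrow> T \<subseteq> S \<Longrightarrow> Ck_on k T f"
  by (induction k arbitrary: f) (auto intro: continuous_on_subset)

text \<open>Regularity is local, which matters where a linear system can only be preconditioned near
  one point.\<close>

lemma Ck_on_open_cover:
  assumes "\<And>x. x \<in> S \<Longrightarrow> \<exists>T. open T \<and> x \<in> T \<and> Ck_on k T f"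
  shows "Ck_on k S f"
  using assms
proof (induction k arbitrary: f)
  case 0
  have "isCont f x" if "x \<in> S" for x
    using 0[OF that] by (auto simp: continuous_on_eq_continuous_at)
  then show ?case by (simp add: continuous_at_imp_continuous_on)
next
  case (Suc k)
  have "f differentiable (at u)" if "u \<in> S" for u using Suc.prems[OF that] by auto
  moreover have "Ck_on k S (\<lambda>u. fd f u h)" for h
  proof (rule Suc.IH)
    fix x assume "x \<in> S"
    from Suc.prems[OF this] obtain T where "open T" "x \<in> T" "Ck_on (Suc k) T f" by blast
    then show "\<exists>T. open T \<and> x \<in> T \<and> Ck_on k T (\<lambda>u. fd f u h)" by auto
  qed
  ultimately show ?case by simp
qed

lemma Ck_on_const [simp, intro]: "Ck_on k S (\<lambda>x. c)"
proof (induction k arbitrary: c)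
  case (Suc k)
  have "fd (\<lambda>x. c) u = (\<lambda>h. 0)" for u :: 'a by (rule fd_eqI) (rule has_derivative_const)
  then show ?case using Suc by simp
qed simp

lemma Ck_on_add:
  assumes "open S" "Ck_on k S f" "Ck_on k S g"
  shows "Ck_on k S (\<lambda>x. f x + g x)"
  using assms(2,3)
proof (induction k arbitrary: f g)
  case 0 then show ?case by (auto intro: continuous_on_add)
next
  case (Suc k)
  show ?case
    by (rule Ck_on_SucI'[OF assms(1), where f'="\<lambda>u h. fd f u h + fd g u h"])
      (use Suc Ck_on_Suc_has_derivative in \<open>auto intro!: has_derivative_add simp: frechet_derivative_works\<close>)
qed

lemma Ck_on_bounded_linear:
  assumes "bounded_linear L" "open S" "Ck_on k S f"
  shows "Ck_on k S (\<lambda>x. L (f x))"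
  using assms(3)
proof (induction k arbitrary: f)
  case 0 then show ?case
    using assms(1) by (auto intro: bounded_linear.continuous_on)
next
  case (Suc k)
  show ?case
    by (rule Ck_on_SucI'[OF assms(2), where f'="\<lambda>u h. L (fd f u h)"])
      (use Suc in \<open>auto intro!: bounded_linear.has_derivative[OF assms(1)] simp: frechet_derivative_works\<close>)
qed

lemma Ck_on_linear: "bounded_linear L \<Longrightarrow> open S \<Longrightarrow> Ck_on k S L"
proof (induction k)
  case 0 then show ?case by (simp add: linear_continuous_on)
next
  case (Suc k)
  then show ?case
    by (intro Ck_on_SucI'[where f'="\<lambda>u. L"]) (auto intro: bounded_linear_imp_has_derivative)
qed

lemma Ck_on_sum:
  assumes "open S" "\<And>i. i \<in> I \<Longrightarrow> Ck_on k S (f i)"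
  shows "Ck_on k S (\<lambda>x. \<Sum>i\<in>I. f i x)"
proof (cases "finite I")
  case True then show ?thesis using assms(2)
    by (induction I rule: finite_induct) (auto intro: Ck_on_add[OF assms(1)])
qed simp

lemma Ck_on_bilinear:
  assumes "bounded_bilinear B" "open S" "Ck_on k S f" "Ck_on k S g"
  shows "Ck_on k S (\<lambda>x. B (f x) (g x))"
  using assms(3,4)
proof (induction k arbitrary: f g)
  case 0 then show ?case
    using assms(1) by (auto intro: bounded_bilinear.continuous_on)
next
  case (Suc k)
  show ?case
  proof (rule Ck_on_SucI'[OF assms(2), where f'="\<lambda>u h. B (f u) (fd g u h) + B (fd f u h) (g u)"])
    fix u assume "u \<in> S"
    then show "((\<lambda>x. B (f x) (g x)) has_derivative (\<lambda>h. B (f u) (fd g u h) + B (fd f u h) (g u))) (at u)"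
      using Suc.prems by (intro bounded_bilinear.FDERIV[OF assms(1)]) (auto simp: frechet_derivative_works)
  next
    fix h
    have "Ck_on k S f" "Ck_on k S g" using Suc.prems Ck_on_SucD by auto
    moreover have "Ck_on k S (\<lambda>u. fd f u h)" "Ck_on k S (\<lambda>u. fd g u h)" using Suc.prems by auto
    ultimately show "Ck_on k S (\<lambda>u. B (f u) (fd g u h) + B (fd f u h) (g u))"
      using Suc.IH by (intro Ck_on_add assms(2)) auto
  qed
qed

lemma vector_Basis_expansion:
  fixes L :: "'a::euclidean_space \<Rightarrow> 'b::real_vector"
  assumes "linear L"
  shows "L x = (\<Sum>b\<in>Basis. (x \<bullet> b) *\<^sub>R L b)"
proof -
  have "L x = L (\<Sum>b\<in>Basis. (x \<bullet> b) *\<^sub>R b)" by (simp add: euclidean_representation)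
  then show ?thesis by (simp only: linear_sum[OF assms] linear_scale[OF assms])
qed

text \<open>The chain rule produces \<open>fd f (g u)\<close> applied to a direction that depends on
  \<open>u\<close>, outside the reach of the induction hypothesis. Expanding this direction in a
  basis of the intermediate space leaves products of its coordinates with derivatives of
  \<open>f\<close> in constant directions.\<close>

lemma Ck_on_compose:
  fixes g :: "'a::real_normed_vector \<Rightarrow> 'b::euclidean_space"
    and f :: "'b \<Rightarrow> 'c::real_normed_vector"
  assumes "open S" "open T" "g ` S \<subseteq> T" "Ck_on k T f" "Ck_on k S g"
  shows "Ck_on k S (\<lambda>x. f (g x))"
  using assms(4,5)
proof (induction k arbitrary: f)
  case 0 then show ?case using assms(3) by (auto intro: continuous_on_compose2)
next
  case (Suc k)
  have lin: "linear (fd f (g u))" if "u \<in> S" for u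
    using Suc.prems assms(3) that linear_frechet_derivative by auto
  show ?case
  proof (rule Ck_on_SucI'[OF assms(1), where f'="\<lambda>u h. \<Sum>b\<in>Basis. (fd g u h \<bullet> b) *\<^sub>R fd f (g u) b"])
    fix u assume u: "u \<in> S"
    have "((f \<circ> g) has_derivative (fd f (g u) \<circ> fd g u)) (at u)"
      by (rule diff_chain_at) (use u Suc.prems assms(3) in \<open>auto simp: frechet_derivative_works\<close>)
    moreover have "fd f (g u) \<circ> fd g u = (\<lambda>h. \<Sum>b\<in>Basis. (fd g u h \<bullet> b) *\<^sub>R fd f (g u) b)"
    proof
      fix h
      let ?x = "fd g u h"
      show "(fd f (g u) \<circ> fd g u) h = (\<Sum>b\<in>Basis. (?x \<bullet> b) *\<^sub>R fd f (g u) b)"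
        using vector_Basis_expansion[OF lin[OF u], of ?x] by (simp only: comp_def)
    qed
    ultimately show "((\<lambda>x. f (g x)) has_derivative (\<lambda>h. \<Sum>b\<in>Basis. (fd g u h \<bullet> b) *\<^sub>R fd f (g u) b)) (at u)"
      by (simp only: comp_def)
  next
    fix h
    have "Ck_on k S g" using Ck_on_SucD[OF Suc.prems(2)] .
    then show "Ck_on k S (\<lambda>u. \<Sum>b\<in>Basis. (fd g u h \<bullet> b) *\<^sub>R fd f (g u) b)"
      using Suc by (intro Ck_on_sum assms(1) Ck_on_bilinear[OF bounded_bilinear_scaleR]
        Ck_on_bounded_linear[OF bounded_linear_inner_left]) auto
  qed
qed

section \<open>Closure properties of smooth maps\<close>

lemma smooth_onD: "smooth_on S f \<Longrightarrow> Ck_on k S f"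
  by (simp add: smooth_on_def)

lemma smooth_on_has_derivative:
  "smooth_on S f \<Longrightarrow> u \<in> S \<Longrightarrow> (f has_derivative fd f u) (at u)"
  by (rule Ck_on_Suc_has_derivative[OF smooth_onD])

lemma smooth_on_linear_fd: "smooth_on S f \<Longrightarrow> u \<in> S \<Longrightarrow> linear (fd f u)"
  using smooth_on_has_derivative has_derivative_linear by blast

lemma smooth_on_continuous: "smooth_on S f \<Longrightarrow> continuous_on S f"
  by (rule Ck_on_continuous[OF smooth_onD])

lemma smooth_on_fd: "smooth_on S f \<Longrightarrow> smooth_on S (\<lambda>u. fd f u h)"
  unfolding smooth_on_def by (metis Ck_on.simps(2))

lemma smooth_on_cong: "open S \<Longrightarrow> (\<And>x. x \<in> S \<Longrightarrow> f x = g x) \<Longrightarrow> smooth_on S f \<Longrightarrow> smooth_on S g"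
  unfolding smooth_on_def using Ck_on_cong by blast

lemma smooth_on_subset: "smooth_on S f \<Longrightarrow> T \<subseteq> S \<Longrightarrow> smooth_on T f"
  unfolding smooth_on_def using Ck_on_subset by blast

lemma smooth_on_const [simp, intro]: "smooth_on S (\<lambda>x. c)"
  by (simp add: smooth_on_def)

lemma smooth_on_linear: "bounded_linear L \<Longrightarrow> open S \<Longrightarrow> smooth_on S L"
  by (simp add: smooth_on_def Ck_on_linear)

lemma smooth_on_id: "open S \<Longrightarrow> smooth_on S (\<lambda>x. x)"
  by (rule smooth_on_linear[OF bounded_linear_ident])

lemma smooth_on_bounded_linear:
  "bounded_linear L \<Longrightarrow> open S \<Longrightarrow> smooth_on S f \<Longrightarrow> smooth_on S (\<lambda>x. L (f x))"
  by (simp add: smooth_on_def Ck_on_bounded_linear)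

lemma smooth_on_add:
  "open S \<Longrightarrow> smooth_on S f \<Longrightarrow> smooth_on S g \<Longrightarrow> smooth_on S (\<lambda>x. f x + g x)"
  by (simp add: smooth_on_def Ck_on_add)

lemma smooth_on_minus: "open S \<Longrightarrow> smooth_on S f \<Longrightarrow> smooth_on S (\<lambda>x. - f x)"
  by (rule smooth_on_bounded_linear[OF bounded_linear_minus[OF bounded_linear_ident]])

lemma smooth_on_diff:
  "open S \<Longrightarrow> smooth_on S f \<Longrightarrow> smooth_on S g \<Longrightarrow> smooth_on S (\<lambda>x. f x - g x)"
  using smooth_on_add[of S f "\<lambda>x. - g x"] smooth_on_minus[of S g] by simp

lemma smooth_on_sum:
  "open S \<Longrightarrow> (\<And>i. i \<in> I \<Longrightarrow> smooth_on S (f i)) \<Longrightarrow> smooth_on S (\<lambda>x. \<Sum>i\<in>I. f i x)"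
  by (simp add: smooth_on_def Ck_on_sum)

lemma smooth_on_bilinear:
  "bounded_bilinear B \<Longrightarrow> open S \<Longrightarrow> smooth_on S f \<Longrightarrow> smooth_on S g \<Longrightarrow> smooth_on S (\<lambda>x. B (f x) (g x))"
  by (simp add: smooth_on_def Ck_on_bilinear)

lemmas smooth_on_scaleR = smooth_on_bilinear[OF bounded_bilinear_scaleR]

lemma smooth_on_compose:
  fixes g :: "'a::real_normed_vector \<Rightarrow> 'b::euclidean_space"
    and f :: "'b \<Rightarrow> 'c::real_normed_vector"
  assumes "open S" "open T" "g ` S \<subseteq> T" "smooth_on T f" "smooth_on S g"
  shows "smooth_on S (\<lambda>x. f (g x))"
  unfolding smooth_on_def
  using Ck_on_compose[OF assms(1-3) smooth_onD[OF assms(4)] smooth_onD[OF assms(5)]] by blast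

section \<open>Smooth dependence of fixed points of contractions\<close>

text \<open>Absorption of the contracted part into the left side; the estimates for fixed points
  below rest on it.\<close>

lemma norm_le_twice:
  fixes a :: "'b::real_normed_vector"
  assumes "a = r + s" "norm s \<le> 1/2 * norm a" shows "norm a \<le> 2 * norm r"
  using norm_triangle_ineq[of r s] assms by simp

lemma half_contraction_bound:
  fixes M :: "'b::real_normed_vector \<Rightarrow>\<^sub>L 'b"
  assumes "norm M \<le> 1/2" shows "norm (M v) \<le> 1/2 * norm v"
  using norm_blinfun[of M v] mult_right_mono[OF assms norm_ge_zero[of v]] by linarith

lemma half_contraction_solution:
  fixes M :: "'b::banach \<Rightarrow>\<^sub>L 'b"
  assumes "norm M \<le> 1/2"
  shows "\<exists>!y. y = b + M y"
proof -
  have "dist (b + M x) (b + M y) \<le> 1/2 * dist x y" for x y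
    using half_contraction_bound[OF assms, of "x - y"] by (simp add: dist_norm blinfun.diff_right)
  then have "\<exists>!y. b + M y = y"
    by (intro banach_fix_type[where c="1/2"]) auto
  then show ?thesis by metis
qed

text \<open>Linearising \<open>y x = N x (y x)\<close> at \<open>u\<close> forces
  \<open>L h = Nx h + M (L h)\<close>, uniquely solvable since \<open>M\<close> halves norms. The
  error \<open>y x - y u - L (x - u)\<close> satisfies the same equation with the linearisation
  remainder in place of \<open>Nx h\<close>, so it is at most twice this remainder. The remainder is
  small relative to \<open>x - u\<close> only once \<open>y\<close> is known to be Lipschitz at
  \<open>u\<close>; that is the purpose of \<open>lip\<close>.\<close>

lemma fixed_point_has_derivative:
  fixes y :: "'p::real_normed_vector \<Rightarrow> 'b::banach" and M :: "'b \<Rightarrow>\<^sub>L 'b"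
  assumes U: "open U" "u \<in> U"
    and fix_eq: "\<And>x. x \<in> U \<Longrightarrow> y x = N x (y x)"
    and der: "((\<lambda>p. N (fst p) (snd p)) has_derivative (\<lambda>p. Nx (fst p) + M (snd p))) (at (u, y u))"
    and M: "norm M \<le> 1/2"
    and lip: "\<And>x. x \<in> U \<Longrightarrow> norm (N x (y x) - N x (y u)) \<le> 1/2 * norm (y x - y u)"
  shows "\<exists>L. (y has_derivative L) (at u) \<and> (\<forall>h. L h = Nx h + M (L h))"
proof -
  have blp: "bounded_linear (\<lambda>p. Nx (fst p) + M (snd p))" using der by (rule has_derivative_bounded_linear)
  have blN: "bounded_linear Nx"
    using bounded_linear_compose[OF blp bounded_linear_Pair[OF bounded_linear_ident bounded_linear_zero]]
    by (simp add: blinfun.zero_right)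
  define L where "L h = (THE l. l = Nx h + M l)" for h
  have L: "L h = Nx h + M (L h)" for h
    unfolding L_def using theI'[OF half_contraction_solution[OF M]] .
  have uniq: "l = L h" if "l = Nx h + M l" for l h
    using half_contraction_solution[OF M, of "Nx h"] that L[of h] by blast
  interpret N: bounded_linear Nx by (rule blN)
  have Lbound: "norm (L h) \<le> 2 * norm (Nx h)" for h
    by (rule norm_le_twice[OF L half_contraction_bound[OF M]])
  have "bounded_linear L"
  proof (rule bounded_linear_intro)
    fix h k r
    show "L (h + k) = L h + L k"
      by (rule uniq[symmetric]) (simp add: N.add blinfun.add_right, metis L add.assoc add.left_commute)
    show "L (r *\<^sub>R h) = r *\<^sub>R L h"
      by (rule uniq[symmetric]) (simp add: N.scale blinfun.scaleR_right, metis L scaleR_add_right)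
    show "norm (L h) \<le> norm h * (2 * onorm Nx)"
      using Lbound[of h] onorm[OF blN, of h] by (simp add: algebra_simps)
  qed
  moreover have "\<exists>d>0. \<forall>x. norm (x - u) < d \<longrightarrow> norm (y x - y u - L (x - u)) \<le> e * norm (x - u)"
    if "e > 0" for e
  proof -
    obtain d0 where d0: "d0 > 0" "ball u d0 \<subseteq> U" using U open_contains_ball by blast
    \<comment> \<open>\<open>C\<close> bounds the increment of \<open>N\<close> in its parameter:
      the linear part plus an error with factor 1. Then \<open>y\<close> has Lipschitz constant
      \<open>2 * C\<close> at \<open>u\<close>, the pair \<open>(x, y x)\<close> moves by at most
      \<open>(1 + 2 * C) * norm (x - u)\<close>, and \<open>e'\<close> is scaled to give the
      remainder the factor \<open>e / 2\<close>, which absorption doubles.\<close>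
    define C where "C = onorm Nx + 1"
    have C: "C \<ge> 1" using onorm_pos_le[OF blN] by (simp add: C_def)
    define e' where "e' = e / (2 * (1 + 2 * C))"
    have e': "e' > 0" using that C by (simp add: e'_def)
    \<comment> \<open>One linearisation serves both estimates: factor 1 for the Lipschitz bound,
      factor \<open>e'\<close> for the remainder.\<close>
    have "0 < min 1 e'" using e' by simp
    then have "\<exists>d>0. \<forall>q. norm (q - (u, y u)) < d \<longrightarrow>
        norm (N (fst q) (snd q) - N (fst (u, y u)) (snd (u, y u)) - (Nx (fst (q - (u, y u))) + M (snd (q - (u, y u)))))
          \<le> min 1 e' * norm (q - (u, y u))"
      using der unfolding has_derivative_at_alt by blast
    then obtain d1 where d1: "d1 > 0" "\<And>q. norm (q - (u, y u)) < d1 \<Longrightarrow>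
        norm (N (fst q) (snd q) - N u (y u) - (Nx (fst (q - (u, y u))) + M (snd (q - (u, y u)))))
          \<le> min 1 e' * norm (q - (u, y u))" by auto
    define d where "d = min d0 (d1 / (1 + 2 * C))"
    have d: "d > 0" using d0 d1 C by (simp add: d_def)
    have "norm (y x - y u - L (x - u)) \<le> e * norm (x - u)" if x: "norm (x - u) < d" for x
    proof -
      have xU: "x \<in> U" using x d0 by (auto simp: d_def dist_norm norm_minus_commute)
      have dd: "norm (x - u) < d1 / (1 + 2 * C)" using x by (simp add: d_def)
      then have dd': "(1 + 2 * C) * norm (x - u) < d1" using C by (simp add: field_simps)
      have x1: "norm (x - u) < d1" using dd' C mult_right_mono[of 1 "1 + 2 * C" "norm (x - u)"] by simp
      have nyx: "N x (y x) = y x" and nyu: "N u (y u) = y u" using fix_eq[OF xU] fix_eq[OF U(2)] by auto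
      have "norm (N x (y u) - N u (y u) - Nx (x - u)) \<le> min 1 e' * norm (x - u)"
        using d1(2)[of "(x, y u)"] x1 by (simp add: blinfun.zero_right)
      also have "\<dots> \<le> 1 * norm (x - u)" by (rule mult_right_mono) auto
      finally have "norm (N x (y u) - N u (y u) - Nx (x - u)) \<le> norm (x - u)" by simp
      then have 1: "norm (N x (y u) - N u (y u)) \<le> C * norm (x - u)"
        using norm_triangle_ineq[of "N x (y u) - N u (y u) - Nx (x - u)" "Nx (x - u)"] onorm[OF blN, of "x - u"]
        by (simp add: C_def algebra_simps)
      have "y x - y u = (N x (y u) - N u (y u)) + (N x (y x) - N x (y u))"
        using nyx nyu by simp
      then have "norm (y x - y u) \<le> 2 * norm (N x (y u) - N u (y u))"
        by (rule norm_le_twice) (use lip[OF xU] in simp)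
      with 1 have ylip: "norm (y x - y u) \<le> 2 * C * norm (x - u)" by simp
      have q: "norm ((x, y x) - (u, y u)) \<le> (1 + 2 * C) * norm (x - u)"
        using norm_Pair_le[of "x - u" "y x - y u"] ylip by (simp add: algebra_simps)
      define r where "r = N x (y x) - N u (y u) - (Nx (x - u) + M (y x - y u))"
      have "norm r \<le> min 1 e' * norm ((x, y x) - (u, y u))"
        using d1(2)[of "(x, y x)"] q dd' by (simp add: r_def)
      also have "\<dots> \<le> e' * norm ((x, y x) - (u, y u))" by (rule mult_right_mono) auto
      also have "\<dots> \<le> e' * ((1 + 2 * C) * norm (x - u))" using q e' by (intro mult_left_mono) auto
      also have "\<dots> = e / 2 * norm (x - u)" using C by (simp add: e'_def field_simps)
      finally have r: "norm r \<le> e / 2 * norm (x - u)" .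
      have "M (L (x - u)) = L (x - u) - Nx (x - u)" using L[of "x - u"] by (simp add: eq_diff_eq add.commute)
      then have "y x - y u - L (x - u) = r + M (y x - y u - L (x - u))"
        by (simp add: r_def nyx nyu blinfun.diff_right)
      then have "norm (y x - y u - L (x - u)) \<le> 2 * norm r"
        by (rule norm_le_twice[OF _ half_contraction_bound[OF M]])
      with r show ?thesis by simp
    qed
    with d show ?thesis by blast
  qed
  ultimately have "(y has_derivative L) (at u)" unfolding has_derivative_at_alt by blast
  with L show ?thesis by blast
qed

text \<open>The increment \<open>y x - y u\<close> solves the equation with inhomogeneity
  \<open>b x - b u + (M x - M u) (y u)\<close>. The increment of \<open>M\<close> acts on the fixed
  vector \<open>y u\<close>, so this term tends to 0 without prior control of
  \<open>y\<close>.\<close>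

lemma linear_solve_continuous:
  fixes y :: "'p::real_normed_vector \<Rightarrow> 'b::real_normed_vector" and M :: "'p \<Rightarrow> 'b \<Rightarrow>\<^sub>L 'b"
  assumes eq: "\<And>x. x \<in> U \<Longrightarrow> y x = b x + M x (y x)" and M: "\<And>x. x \<in> U \<Longrightarrow> norm (M x) \<le> 1/2"
    and "continuous_on U b" "continuous_on U M"
  shows "continuous_on U y"
  unfolding continuous_on_def
proof
  fix u assume u: "u \<in> U"
  have "((\<lambda>x. 2 * norm (b x - b u + (M x - M u) (y u))) \<longlongrightarrow> 2 * norm (b u - b u + (M u - M u) (y u))) (at u within U)"
    using assms(3,4) u unfolding continuous_on_def by (intro tendsto_intros) auto
  then have "((\<lambda>x. 2 * norm (b x - b u + (M x - M u) (y u))) \<longlongrightarrow> 0) (at u within U)" by simp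
  moreover have "\<forall>\<^sub>F x in at u within U. norm (y x - y u) \<le> 2 * norm (b x - b u + (M x - M u) (y u))"
    unfolding eventually_at_filter
  proof (rule always_eventually, intro allI impI)
    fix x assume "x \<in> U"
    then have "y x - y u = (b x - b u + (M x - M u) (y u)) + M x (y x - y u)"
      using eq[of x] eq[OF u] by (simp add: blinfun.diff_left blinfun.diff_right algebra_simps)
    then show "norm (y x - y u) \<le> 2 * norm (b x - b u + (M x - M u) (y u))"
      by (rule norm_le_twice[OF _ half_contraction_bound[OF M[OF \<open>x \<in> U\<close>]]])
  qed
  ultimately have "((\<lambda>x. y x - y u) \<longlongrightarrow> 0) (at u within U)" by (rule Lim_null_comparison[rotated])
  then show "(y \<longlongrightarrow> y u) (at u within U)" by (rule LIM_zero_cancel)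
qed

text \<open>A directional derivative of \<open>y\<close> solves an equation with the same operator
  \<open>M\<close> and inhomogeneity \<open>fd b u h + fd M u h (y u)\<close>. This contains
  \<open>y\<close> itself but no derivative of it, so order \<open>k\<close> for \<open>y\<close>
  suffices to apply the induction hypothesis to the derivative.\<close>

lemma linear_solve_Ck:
  fixes y :: "'p::real_normed_vector \<Rightarrow> 'b::banach" and M :: "'p \<Rightarrow> 'b \<Rightarrow>\<^sub>L 'b"
  assumes U: "open U"
    and eq: "\<And>x. x \<in> U \<Longrightarrow> y x = b x + M x (y x)" and M: "\<And>x. x \<in> U \<Longrightarrow> norm (M x) \<le> 1/2"
    and CM: "Ck_on k U M" and Cb: "Ck_on k U b"
  shows "Ck_on k U y"
  using eq CM Cb
proof (induction k arbitrary: y b)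
  case 0
  then show ?case using linear_solve_continuous[OF "0.prems"(1) M] by simp
next
  case (Suc k)
  have "\<exists>L. (y has_derivative L) (at u) \<and> (\<forall>h. L h = (fd b u h + fd M u h (y u)) + M u (L h))" if u: "u \<in> U" for u
  proof (rule fixed_point_has_derivative[where N="\<lambda>x v. b x + M x v", OF U u Suc.prems(1) _ M[OF u]])
    have "((\<lambda>p. b (fst p)) has_derivative (\<lambda>p. fd b u (fst p))) (at (u, y u))"
      "((\<lambda>p. M (fst p)) has_derivative (\<lambda>p. fd M u (fst p))) (at (u, y u))"
      using Ck_on_Suc_has_derivative[OF Suc.prems(2) u] Ck_on_Suc_has_derivative[OF Suc.prems(3) u]
      by (auto intro!: has_derivative_compose[of fst fst] has_derivative_fst has_derivative_ident)
    then show "((\<lambda>p. b (fst p) + M (fst p) (snd p)) has_derivative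
        (\<lambda>p. fd b u (fst p) + fd M u (fst p) (y u) + M u (snd p))) (at (u, y u))"
      by (auto intro!: derivative_eq_intros simp: algebra_simps)
  next
    show "norm (b x + M x (y x) - (b x + M x (y u))) \<le> 1/2 * norm (y x - y u)" if "x \<in> U" for x
      using half_contraction_bound[OF M[OF that], of "y x - y u"] by (simp add: blinfun.diff_right)
  qed
  then obtain L where L: "\<And>u. u \<in> U \<Longrightarrow> (y has_derivative L u) (at u)"
    "\<And>u h. u \<in> U \<Longrightarrow> L u h = (fd b u h + fd M u h (y u)) + M u (L u h)" by metis
  have Cy: "Ck_on k U y"
    using Suc.IH[OF Suc.prems(1)] Ck_on_SucD[OF Suc.prems(2)] Ck_on_SucD[OF Suc.prems(3)] by blast
  show ?case
  proof (rule Ck_on_SucI'[OF U L(1)])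
    fix h
    have "Ck_on k U (\<lambda>u. fd b u h)" "Ck_on k U (\<lambda>u. fd M u h)" using Suc.prems by auto
    then have "Ck_on k U (\<lambda>u. fd b u h + fd M u h (y u))"
      by (intro Ck_on_add U Ck_on_bilinear[OF bounded_bilinear_blinfun_apply] Cy)
    then show "Ck_on k U (\<lambda>u. L u h)"
      by (intro Suc.IH[of "\<lambda>u. L u h"]) (use L(2) Ck_on_SucD[OF Suc.prems(2)] in auto)
  qed
qed

lemma linear_solve_smooth:
  fixes y :: "'p::real_normed_vector \<Rightarrow> 'b::banach" and M :: "'p \<Rightarrow> 'b \<Rightarrow>\<^sub>L 'b"
  assumes "open U"
    and "\<And>x. x \<in> U \<Longrightarrow> y x = b x + M x (y x)" and "\<And>x. x \<in> U \<Longrightarrow> norm (M x) \<le> 1/2"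
    and "smooth_on U M" "smooth_on U b"
  shows "smooth_on U y"
  unfolding smooth_on_def
  by (intro allI linear_solve_Ck[where y=y and b=b and M=M, OF assms(1-3)] smooth_onD assms(4,5))

text \<open>\<open>M\<close> and \<open>Nx\<close> are the partial derivatives of \<open>N\<close>
  along the graph of \<open>y\<close>, hence only as regular as \<open>y\<close>. \<open>CM\<close>
  and \<open>CNx\<close> state this order by order, and each order of \<open>y\<close> pays for the
  next one through \<open>linear_solve_Ck\<close>.\<close>

lemma fixed_point_smooth:
  fixes y :: "'p::real_normed_vector \<Rightarrow> 'b::banach" and M :: "'p \<Rightarrow> 'b \<Rightarrow>\<^sub>L 'b"
  assumes U: "open U"
    and fix_eq: "\<And>x. x \<in> U \<Longrightarrow> y x = N x (y x)"
    and der: "\<And>u. u \<in> U \<Longrightarrow>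
      ((\<lambda>p. N (fst p) (snd p)) has_derivative (\<lambda>p. Nx u (fst p) + M u (snd p))) (at (u, y u))"
    and M: "\<And>u. u \<in> U \<Longrightarrow> norm (M u) \<le> 1/2"
    and lip: "\<And>x u. x \<in> U \<Longrightarrow> u \<in> U \<Longrightarrow> norm (N x (y x) - N x (y u)) \<le> 1/2 * norm (y x - y u)"
    and CM: "\<And>k. Ck_on k U y \<Longrightarrow> Ck_on k U M"
    and CNx: "\<And>k h. Ck_on k U y \<Longrightarrow> Ck_on k U (\<lambda>u. Nx u h)"
  shows "smooth_on U y" "\<And>u h. u \<in> U \<Longrightarrow> fd y u h = Nx u h + M u (fd y u h)"
proof -
  have "\<exists>L. (y has_derivative L) (at u) \<and> (\<forall>h. L h = Nx u h + M u (L h))" if u: "u \<in> U" for u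
    by (rule fixed_point_has_derivative[OF U u fix_eq der[OF u] M[OF u] lip]) (use u in auto)
  then obtain L where L: "\<And>u. u \<in> U \<Longrightarrow> (y has_derivative L u) (at u)"
    "\<And>u h. u \<in> U \<Longrightarrow> L u h = Nx u h + M u (L u h)" by metis
  then show "fd y u h = Nx u h + M u (fd y u h)" if "u \<in> U" for u h
    using that fd_eqI[OF L(1)[OF that]] by simp
  have "Ck_on k U y" for k
  proof (induction k)
    case 0
    have "isCont y u" if "u \<in> U" for u using L(1)[OF that] has_derivative_continuous by blast
    then show ?case by (simp add: continuous_at_imp_continuous_on)
  next
    case (Suc k)
    show ?case
      by (rule Ck_on_SucI'[OF U L(1)])
        (auto intro!: linear_solve_Ck[OF U L(2) M CM[OF Suc] CNx[OF Suc]])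
  qed
  then show "smooth_on U y" by (simp add: smooth_on_def)
qed

section \<open>Superposition operators on bounded continuous functions\<close>

lemma apply_Bcontfun:
  "continuous_on UNIV f \<Longrightarrow> (\<And>x. norm (f x) \<le> B) \<Longrightarrow> apply_bcontfun (Bcontfun f) t = f t"
  using Bcontfun_inverse[OF bcontfun_normI] by metis

lemma norm_Bcontfun_le:
  assumes "continuous_on UNIV f" "\<And>x. norm (f x) \<le> B"
  shows "norm (Bcontfun f) \<le> B"
  by (rule norm_bound) (use apply_Bcontfun[OF assms] assms(2) in simp)

lemma bounded_linear_apply_bcontfun: "bounded_linear (\<lambda>f. apply_bcontfun f t)"
  by (rule bounded_linear_intro[where K=1]) (auto simp: norm_bounded)

lemma bounded_linear_const_bcontfun: "bounded_linear const_bcontfun"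
  by (rule bounded_linear_intro[where K=1]) (auto intro!: bcontfun_eqI norm_bound simp: const_bcontfun.rep_eq)

definition bc_lin :: "('b \<Rightarrow> 'c) \<Rightarrow> ('d::topological_space \<Rightarrow>\<^sub>C 'b::real_normed_vector) \<Rightarrow> ('d \<Rightarrow>\<^sub>C 'c::real_normed_vector)" where
  "bc_lin L f = Bcontfun (\<lambda>t. L (apply_bcontfun f t))"

lemma bc_lin:
  fixes f :: "'d::topological_space \<Rightarrow>\<^sub>C 'b::real_normed_vector" and L :: "'b \<Rightarrow> 'c::real_normed_vector"
  assumes "bounded_linear L"
  shows apply_bc_lin: "apply_bcontfun (bc_lin L f) t = L (apply_bcontfun f t)"
    and bounded_linear_bc_lin: "bounded_linear (bc_lin L :: ('d \<Rightarrow>\<^sub>C 'b) \<Rightarrow> ('d \<Rightarrow>\<^sub>C 'c))"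
proof -
  interpret L: bounded_linear L by (rule assms)
  have b: "norm (L (apply_bcontfun f t)) \<le> onorm L * norm f" for f :: "'d \<Rightarrow>\<^sub>C 'b" and t
    using onorm[OF assms, of "apply_bcontfun f t"] mult_left_mono[OF norm_bounded[of f t] onorm_pos_le[OF assms]]
    by linarith
  have a: "apply_bcontfun (bc_lin L f) t = L (apply_bcontfun f t)" for f :: "'d \<Rightarrow>\<^sub>C 'b" and t
    unfolding bc_lin_def by (rule apply_Bcontfun[OF _ b]) (intro L.continuous_on continuous_on_apply_bcontfun)
  then show "apply_bcontfun (bc_lin L f) t = L (apply_bcontfun f t)" .
  show "bounded_linear (bc_lin L :: ('d \<Rightarrow>\<^sub>C 'b) \<Rightarrow> _)"
    by (rule bounded_linear_intro[where K="onorm L"])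
      (auto intro!: bcontfun_eqI norm_bound simp: a L.add L.scaleR, use b in \<open>simp add: mult.commute\<close>)
qed

definition bc_app :: "('d::topological_space \<Rightarrow>\<^sub>C ('b::real_normed_vector \<Rightarrow>\<^sub>L 'c::real_normed_vector)) \<Rightarrow> ('d \<Rightarrow>\<^sub>C 'b) \<Rightarrow> ('d \<Rightarrow>\<^sub>C 'c)" where
  "bc_app A f = Bcontfun (\<lambda>t. blinfun_apply (apply_bcontfun A t) (apply_bcontfun f t))"

lemma apply_bc_app: "apply_bcontfun (bc_app A f) t = blinfun_apply (apply_bcontfun A t) (apply_bcontfun f t)"
  and norm_bc_app: "norm (bc_app A f) \<le> norm A * norm f"
proof -
  have b: "norm (blinfun_apply (apply_bcontfun A t) (apply_bcontfun f t)) \<le> norm A * norm f" for t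
    using norm_blinfun[of "apply_bcontfun A t" "apply_bcontfun f t"]
      mult_mono[OF norm_bounded[of A t] norm_bounded[of f t]] by simp
  have c: "continuous_on UNIV (\<lambda>t. blinfun_apply (apply_bcontfun A t) (apply_bcontfun f t))"
    by (intro blinfun.continuous_on continuous_on_apply_bcontfun)
  show "apply_bcontfun (bc_app A f) t = blinfun_apply (apply_bcontfun A t) (apply_bcontfun f t)"
    unfolding bc_app_def by (rule apply_Bcontfun[OF c b])
  show "norm (bc_app A f) \<le> norm A * norm f"
    unfolding bc_app_def by (rule norm_Bcontfun_le[OF c b])
qed

lemma bounded_bilinear_bc_app: "bounded_bilinear bc_app"
proof
  show "\<exists>K. \<forall>a b. norm (bc_app a b) \<le> norm a * norm b * K"
    by (intro exI[of _ 1] allI) (simp add: norm_bc_app)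
qed (auto intro!: bcontfun_eqI simp: apply_bc_app blinfun.bilinear_simps)

text \<open>The derivative as one map into bounded linear operators. Summing over a basis makes it
  an operator even where \<open>f\<close> is not differentiable and reduces its regularity to that
  of finitely many directional derivatives.\<close>

definition fdL :: "('a::euclidean_space \<Rightarrow> 'b::real_normed_vector) \<Rightarrow> 'a \<Rightarrow> ('a \<Rightarrow>\<^sub>L 'b)" where
  "fdL f x = (\<Sum>b\<in>Basis. blinfun_scaleR_left (fd f x b) o\<^sub>L blinfun_inner_left b)"

lemma blinfun_apply_fdL: "linear (fd f x) \<Longrightarrow> blinfun_apply (fdL f x) h = fd f x h"
  unfolding fdL_def using vector_Basis_expansion[of "fd f x" h]
  by (simp add: blinfun.sum_left blinfun_scaleR_left.rep_eq)

lemma bounded_linear_rank_one: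
  "bounded_linear (\<lambda>c. blinfun_scaleR_left c o\<^sub>L blinfun_inner_left b)"
  using bounded_bilinear.bounded_linear_left[OF bounded_bilinear_blinfun_compose]
    bounded_linear_blinfun_scaleR_left bounded_linear_compose by blast

lemma Ck_on_fdL: "Ck_on (Suc k) S f \<Longrightarrow> open S \<Longrightarrow> Ck_on k S (fdL f)"
  unfolding fdL_def[abs_def] by (intro Ck_on_sum Ck_on_bounded_linear[OF bounded_linear_rank_one]) auto

lemma smooth_on_fdL: "smooth_on S f \<Longrightarrow> open S \<Longrightarrow> smooth_on S (fdL f)"
  unfolding smooth_on_def using Ck_on_fdL by blast

text \<open>Uniformity over \<open>C\<close> comes from uniform continuity of \<open>fdL g\<close>
  on a compact neighbourhood of \<open>C\<close>, combined with the mean value inequality on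
  balls.\<close>

lemma uniform_differentiability:
  fixes g :: "'a::euclidean_space \<Rightarrow> 'b::real_normed_vector"
  assumes C: "compact C" "C \<subseteq> W" and W: "open W" and g: "Ck_on (Suc 0) W g" and e: "e > 0"
  shows "\<exists>d>0. \<forall>x\<in>C. \<forall>y. norm (y - x) < d \<longrightarrow>
    y \<in> W \<and> norm (g y - g x - fdL g x (y - x)) \<le> e * norm (y - x)"
proof -
  obtain r where r: "r > 0" "(\<Union>x\<in>C. cball x r) \<subseteq> W"
    using compact_subset_open_imp_cball_epsilon_subset[OF C(1) W C(2)] by blast
  \<comment> \<open>The closed \<open>r\<close>-neighbourhood of \<open>C\<close>: compact, inside
    \<open>W\<close>, and containing the segments from points of \<open>C\<close> to nearby
    points.\<close>
  define C' where "C' = {x + y | x y. x \<in> C \<and> y \<in> cball 0 r}"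
  have "compact C'" unfolding C'_def by (rule compact_sums[OF C(1) compact_cball])
  have CC: "cball x r \<subseteq> C'" if "x \<in> C" for x
  proof
    fix y assume "y \<in> cball x r"
    then have "y = x + (y - x)" "y - x \<in> cball 0 r" by (auto simp: dist_norm norm_minus_commute)
    with that show "y \<in> C'" unfolding C'_def by blast
  qed
  have C'W: "C' \<subseteq> W"
    using r(2) by (force simp: C'_def dist_norm)
  have "continuous_on C' (fdL g)"
    using Ck_on_fdL[OF g W] C'W by (auto intro: continuous_on_subset)
  then have "uniformly_continuous_on C' (fdL g)"
    using \<open>compact C'\<close> compact_uniformly_continuous by blast
  then obtain d where d: "d > 0" "\<And>x y. x \<in> C' \<Longrightarrow> y \<in> C' \<Longrightarrow> dist y x < d \<Longrightarrow> dist (fdL g y) (fdL g x) < e"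
    using e unfolding uniformly_continuous_on_def by metis
  have "y \<in> W \<and> norm (g y - g x - fdL g x (y - x)) \<le> e * norm (y - x)"
    if x: "x \<in> C" and y: "norm (y - x) < min d r" for x y
  proof -
    let ?S = "ball x (min d r)"
    have S: "?S \<subseteq> C'" using CC[OF x] by auto
    have ySW: "y \<in> ?S" using y by (simp add: dist_norm norm_minus_commute)
    have seg: "x + t *\<^sub>R (y - x) \<in> ?S" if "t \<in> {0..1}" for t
    proof -
      have "t * norm (y - x) \<le> norm (y - x)" using that by (intro mult_left_le_one_le) auto
      then show ?thesis using that y by (simp add: dist_norm)
    qed
    have "norm (g y - g x - fdL g x (y - x)) \<le> norm (y - x) * e"
    proof (rule differentiable_bound_linearization[OF seg])
      fix z assume z: "z \<in> ?S"
      then have "z \<in> W" using S C'W by blast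
      then have "(g has_derivative fd g z) (at z)" using Ck_on_Suc_has_derivative[OF g] by blast
      moreover have "blinfun_apply (fdL g z) = fd g z"
        using blinfun_apply_fdL[OF has_derivative_linear[OF calculation]] by blast
      ultimately show "(g has_derivative blinfun_apply (fdL g z)) (at z within ?S)"
        by (simp add: has_derivative_at_withinI)
      have "dist (fdL g z) (fdL g x) < e"
        using d(2)[of x z] z subsetD[OF S z] subsetD[OF CC[OF x], of x] r(1) by (simp add: dist_commute)
      then show "onorm (blinfun_apply (fdL g z) - blinfun_apply (fdL g x)) \<le> e"
        by (simp add: dist_norm norm_blinfun.rep_eq minus_blinfun.rep_eq fun_diff_def)
    qed (use r d in auto)
    with ySW S C'W show ?thesis by (auto simp: mult.commute)
  qed
  then show ?thesis using d r by (intro exI[of _ "min d r"]) auto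
qed

text \<open>The superposition (Nemytskii) operator of \<open>g\<close>. \<open>Bcontfun\<close> is
  meaningful here only if the composition is bounded and continuous, hence the compact sets
  containing the range of \<open>f\<close> in the lemmas below.\<close>

definition nem :: "('b \<Rightarrow> 'c) \<Rightarrow> ('d::topological_space \<Rightarrow>\<^sub>C 'b::metric_space) \<Rightarrow> ('d \<Rightarrow>\<^sub>C 'c::metric_space)" where
  "nem g f = Bcontfun (\<lambda>t. g (apply_bcontfun f t))"

lemma apply_nem:
  assumes "compact C" "range (apply_bcontfun f) \<subseteq> C" "continuous_on C g"
  shows "apply_bcontfun (nem g f) t = g (apply_bcontfun f t)"
proof -
  have "continuous_on UNIV (\<lambda>t. g (apply_bcontfun f t))"
    by (rule continuous_on_compose2[OF assms(3) continuous_on_apply_bcontfun assms(2)])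
  moreover have "bounded (range (\<lambda>t. g (apply_bcontfun f t)))"
    by (rule bounded_subset[OF compact_imp_bounded[OF compact_continuous_image[OF assms(3,1)]]])
      (use assms(2) in auto)
  ultimately have "(\<lambda>t. g (apply_bcontfun f t)) \<in> bcontfun" by (simp add: bcontfun_def)
  then show ?thesis unfolding nem_def by (simp add: Bcontfun_inverse)
qed

text \<open>In the supremum norm the pointwise remainder must be small uniformly in
  \<open>t\<close>. The values of \<open>f\<close> lie in a compact set, so
  \<open>uniform_differentiability\<close> provides this.\<close>

lemma nem_has_derivative:
  fixes g :: "'b::euclidean_space \<Rightarrow> 'c::real_normed_vector"
    and f :: "'d::topological_space \<Rightarrow>\<^sub>C 'b"
  assumes C: "compact C" "C \<subseteq> W" and W: "open W" and g: "Ck_on (Suc 0) W g"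
    and f: "range (apply_bcontfun f) \<subseteq> C"
  shows "(nem g has_derivative bc_app (nem (fdL g) f)) (at f)"
  unfolding has_derivative_at_alt
proof (intro conjI allI impI)
  show "bounded_linear (bc_app (nem (fdL g) f))"
    by (rule bounded_bilinear.bounded_linear_right[OF bounded_bilinear_bc_app])
  fix e :: real assume e: "0 < e"
  obtain d where d: "d > 0" "\<And>x y. x \<in> C \<Longrightarrow> norm (y - x) < d \<Longrightarrow>
    y \<in> W \<and> norm (g y - g x - fdL g x (y - x)) \<le> e * norm (y - x)"
    using uniform_differentiability[OF C W g e] by blast
  obtain r where r: "r > 0" "(\<Union>x\<in>C. cball x r) \<subseteq> W"
    using compact_subset_open_imp_cball_epsilon_subset[OF C(1) W C(2)] by blast
  \<comment> \<open>Functions near \<open>f\<close> take values in this larger compact set, so that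
    \<open>nem g y\<close> is a genuine superposition too.\<close>
  define C' where "C' = {x + y | x y. x \<in> C \<and> y \<in> cball 0 r}"
  have C': "compact C'" unfolding C'_def by (rule compact_sums[OF C(1) compact_cball])
  have C'W: "C' \<subseteq> W" using r(2) by (force simp: C'_def dist_norm)
  have cg: "continuous_on W g" using g Ck_on_continuous by blast
  have cL: "continuous_on W (fdL g)" using Ck_on_fdL[OF g W] by simp
  have "norm (nem g y - nem g f - bc_app (nem (fdL g) f) (y - f)) \<le> e * norm (y - f)"
    if y: "norm (y - f) < min d r" for y
  proof (rule norm_bound)
    fix t
    have nt: "norm (apply_bcontfun y s - apply_bcontfun f s) \<le> norm (y - f)" for s
      using norm_bounded[of "y - f" s] by simp
    have "range (apply_bcontfun y) \<subseteq> C'"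
    proof
      fix z assume "z \<in> range (apply_bcontfun y)"
      then obtain s where z: "z = apply_bcontfun y s" by blast
      have "z = apply_bcontfun f s + (apply_bcontfun y s - apply_bcontfun f s)" by (simp add: z)
      moreover have "apply_bcontfun f s \<in> C" using f by auto
      moreover have "apply_bcontfun y s - apply_bcontfun f s \<in> cball 0 r" using nt[of s] y by simp
      ultimately show "z \<in> C'" unfolding C'_def by blast
    qed
    then have 1: "apply_bcontfun (nem g y) t = g (apply_bcontfun y t)"
      by (rule apply_nem[OF C' _ continuous_on_subset[OF cg C'W]])
    have 2: "apply_bcontfun (nem g f) t = g (apply_bcontfun f t)"
      by (rule apply_nem[OF C(1) f continuous_on_subset[OF cg C(2)]])
    have 3: "apply_bcontfun (nem (fdL g) f) t = fdL g (apply_bcontfun f t)"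
      by (rule apply_nem[OF C(1) f continuous_on_subset[OF cL C(2)]])
    have "norm (g (apply_bcontfun y t) - g (apply_bcontfun f t)
        - fdL g (apply_bcontfun f t) (apply_bcontfun y t - apply_bcontfun f t))
      \<le> e * norm (apply_bcontfun y t - apply_bcontfun f t)"
      using d(2)[of "apply_bcontfun f t" "apply_bcontfun y t"] f nt[of t] y by auto
    also have "\<dots> \<le> e * norm (y - f)" using nt e by simp
    finally show "norm (apply_bcontfun (nem g y - nem g f - bc_app (nem (fdL g) f) (y - f)) t) \<le> e * norm (y - f)"
      by (simp add: 1 2 3 apply_bc_app)
  qed
  then show "\<exists>d>0. \<forall>y. norm (y - f) < d \<longrightarrow>
      norm (nem g y - nem g f - bc_app (nem (fdL g) f) (y - f)) \<le> e * norm (y - f)"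
    using d r by (intro exI[of _ "min d r"]) auto
qed

text \<open>The derivative of a superposition involves \<open>fdL g\<close>, whose values have
  another type than those of \<open>g\<close>. Writing it through superpositions of the directional
  derivatives returns to the type of \<open>g\<close>, so that the induction in
  \<open>Ck_on_nem\<close> can proceed.\<close>

lemma nem_fdL:
  fixes g :: "'b::euclidean_space \<Rightarrow> 'c::real_normed_vector"
  assumes C: "compact C" "C \<subseteq> W" and W: "open W" and g: "Ck_on (Suc 0) W g"
    and f: "range (apply_bcontfun f) \<subseteq> C"
  shows "nem (fdL g) f =
    (\<Sum>b\<in>Basis. bc_lin (\<lambda>c. blinfun_scaleR_left c o\<^sub>L blinfun_inner_left b) (nem (\<lambda>x. fd g x b) f))"
proof (rule bcontfun_eqI)
  fix t
  have cL: "continuous_on C (fdL g)" using Ck_on_fdL[OF g W] C(2) continuous_on_subset by auto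
  have cg: "continuous_on C (\<lambda>x. fd g x b)" for b using g continuous_on_subset[OF _ C(2)] by auto
  have s: "apply_bcontfun (sum F I) t = (\<Sum>i\<in>I. apply_bcontfun (F i) t)"
    for F :: "'b \<Rightarrow> 'a \<Rightarrow>\<^sub>C ('b \<Rightarrow>\<^sub>L 'c)" and I
    by (rule linear_sum[OF bounded_linear.linear[OF bounded_linear_apply_bcontfun]])
  show "apply_bcontfun (nem (fdL g) f) t =
    apply_bcontfun (\<Sum>b\<in>Basis. bc_lin (\<lambda>c. blinfun_scaleR_left c o\<^sub>L blinfun_inner_left b) (nem (\<lambda>x. fd g x b) f)) t"
    by (simp add: s apply_nem[OF C(1) f cL] apply_nem[OF C(1) f cg] apply_bc_lin[OF bounded_linear_rank_one] fdL_def)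
qed

lemma Ck_on_nem:
  fixes g :: "'b::euclidean_space \<Rightarrow> 'c::real_normed_vector"
    and F :: "'p::real_normed_vector \<Rightarrow> ('d::topological_space \<Rightarrow>\<^sub>C 'b)"
  assumes U: "open U" and W: "open W"
    and C: "\<And>u. u \<in> U \<Longrightarrow> \<exists>C. compact C \<and> C \<subseteq> W \<and> range (apply_bcontfun (F u)) \<subseteq> C"
    and g: "smooth_on W g" and F: "Ck_on k U F"
  shows "Ck_on k U (\<lambda>u. nem g (F u))"
  using g F
proof (induction k arbitrary: g)
  case 0
  have "isCont (\<lambda>u. nem g (F u)) u" if u: "u \<in> U" for u
  proof -
    obtain C where "compact C" "C \<subseteq> W" "range (apply_bcontfun (F u)) \<subseteq> C" using C[OF u] by blast
    then have n: "isCont (nem g) (F u)"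
      using nem_has_derivative[OF _ _ W smooth_onD[OF "0.prems"(1)]] has_derivative_continuous by blast
    have "isCont F u" using "0.prems"(2) U u by (simp add: continuous_on_eq_continuous_at)
    then show ?thesis using n by (rule isCont_o2)
  qed
  then show ?case by (simp add: continuous_at_imp_continuous_on)
next
  case (Suc k)
  let ?R = "\<lambda>b c. blinfun_scaleR_left c o\<^sub>L blinfun_inner_left (b :: 'b)"
  show ?case
  proof (rule Ck_on_SucI'[OF U, where f'="\<lambda>u h. bc_app (nem (fdL g) (F u)) (fd F u h)"])
    fix u assume u: "u \<in> U"
    obtain C where C': "compact C" "C \<subseteq> W" "range (apply_bcontfun (F u)) \<subseteq> C" using C[OF u] by blast
    show "((\<lambda>u. nem g (F u)) has_derivative (\<lambda>h. bc_app (nem (fdL g) (F u)) (fd F u h))) (at u)"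
      by (rule has_derivative_compose[OF Ck_on_Suc_has_derivative[OF Suc.prems(2) u]
            nem_has_derivative[OF C'(1,2) W smooth_onD[OF Suc.prems(1)] C'(3)]])
  next
    fix h
    have "Ck_on k U (\<lambda>u. \<Sum>b\<in>Basis. bc_lin (?R b) (nem (\<lambda>x. fd g x b) (F u)))"
      using Suc.IH[OF smooth_on_fd[OF Suc.prems(1)] Ck_on_SucD[OF Suc.prems(2)]]
      by (intro Ck_on_sum U Ck_on_bounded_linear[OF bounded_linear_bc_lin[OF bounded_linear_rank_one]])
    then have "Ck_on k U (\<lambda>u. nem (fdL g) (F u))"
    proof (rule Ck_on_cong[OF U, rotated])
      fix u assume "u \<in> U"
      then obtain C where C': "compact C" "C \<subseteq> W" "range (apply_bcontfun (F u)) \<subseteq> C" using C by blast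
      show "(\<Sum>b\<in>Basis. bc_lin (?R b) (nem (\<lambda>x. fd g x b) (F u))) = nem (fdL g) (F u)"
        by (rule nem_fdL[OF C'(1,2) W smooth_onD[OF Suc.prems(1)] C'(3), symmetric])
    qed
    then show "Ck_on k U (\<lambda>u. bc_app (nem (fdL g) (F u)) (fd F u h))"
      using Suc.prems(2) by (intro Ck_on_bilinear[OF bounded_bilinear_bc_app U]) auto
  qed
qed

section \<open>Parameter integrals and ordinary differential equations\<close>

instance bcontfun :: (metric_space, banach) banach ..

text \<open>Curves on \<open>{0..1}\<close> are modelled as bounded continuous functions on the
  whole line; the retraction onto the unit interval extends them by their end values.\<close>

definition clamp01 :: "real \<Rightarrow> real" where "clamp01 t = max 0 (min 1 t)"

lemma clamp01_mem [simp]: "clamp01 t \<in> {0..1}"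
  and clamp01_eq: "t \<in> {0..1} \<Longrightarrow> clamp01 t = t"
  and continuous_on_clamp01: "continuous_on S clamp01"
  by (auto simp: clamp01_def intro!: continuous_intros)

definition bc_clamp :: "real \<Rightarrow>\<^sub>C real" where "bc_clamp = Bcontfun clamp01"

lemma apply_bc_clamp: "apply_bcontfun bc_clamp t = clamp01 t"
  unfolding bc_clamp_def
  by (rule apply_Bcontfun[OF continuous_on_clamp01, where B=1]) (auto simp: clamp01_def)

text \<open>The integral operator of Picard's iteration. The clamped upper limit keeps its norm at
  most 1, so a Lipschitz constant of the integrand is inherited by Picard's map.\<close>

definition bc_int :: "(real \<Rightarrow>\<^sub>C 'b::banach) \<Rightarrow> (real \<Rightarrow>\<^sub>C 'b)" where
  "bc_int f = Bcontfun (\<lambda>t. integral {0..clamp01 t} (apply_bcontfun f))"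

lemma bc_int_aux:
  fixes f :: "real \<Rightarrow>\<^sub>C 'b::banach"
  shows bc_int_integrable: "apply_bcontfun f integrable_on {0..t}"
    and apply_bc_int: "apply_bcontfun (bc_int f) t = integral {0..clamp01 t} (apply_bcontfun f)"
    and norm_bc_int: "norm (bc_int f) \<le> norm f"
proof -
  show i: "apply_bcontfun f integrable_on {0..t}" for t
    by (rule integrable_continuous_interval) simp
  have b: "norm (integral {0..clamp01 t} (apply_bcontfun f)) \<le> norm f" for t
  proof -
    have "norm (integral {0..clamp01 t} (apply_bcontfun f)) \<le> norm f * (clamp01 t - 0)"
      by (rule integral_bound) (auto simp: clamp01_def norm_bounded)
    also have "\<dots> \<le> norm f * 1" using clamp01_mem[of t] by (intro mult_left_mono) auto
    finally show ?thesis by simp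
  qed
  have c: "continuous_on UNIV (\<lambda>t. integral {0..clamp01 t} (apply_bcontfun f))"
    by (rule continuous_on_compose2[OF indefinite_integral_continuous_1[OF i[of 1]] continuous_on_clamp01])
      (use clamp01_mem in blast)
  show "apply_bcontfun (bc_int f) t = integral {0..clamp01 t} (apply_bcontfun f)"
    unfolding bc_int_def by (rule apply_Bcontfun[OF c b])
  show "norm (bc_int f) \<le> norm f" unfolding bc_int_def by (rule norm_Bcontfun_le[OF c b])
qed

lemma bounded_linear_bc_int: "bounded_linear bc_int"
  by (rule bounded_linear_intro[where K=1])
    (auto intro!: bcontfun_eqI simp: apply_bc_int norm_bc_int integral_add[OF bc_int_integrable bc_int_integrable])

lemma bc_int_has_vector_derivative:
  assumes "t \<in> {0..1}"
  shows "((\<lambda>t. apply_bcontfun (bc_int f) t) has_vector_derivative apply_bcontfun f t) (at t within {0..1})"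
proof (rule has_vector_derivative_transform[OF assms])
  show "((\<lambda>t. integral {0..t} (apply_bcontfun f)) has_vector_derivative apply_bcontfun f t) (at t within {0..1})"
    by (rule integral_has_vector_derivative[OF _ assms]) simp
qed (simp add: apply_bc_int clamp01_eq)

text \<open>The integral is a bounded linear map applied to the superposition of \<open>g\<close>
  with the curve \<open>(clamp01 t, u)\<close>. This curve is affine in \<open>u\<close>, so
  differentiation under the integral sign is an instance of the calculus of
  \<open>nem\<close>.\<close>

lemma parameter_integral:
  fixes g :: "real \<times> 'p::euclidean_space \<Rightarrow> 'c::banach"
  assumes W: "open W" and U: "open U" and sub: "{0..1} \<times> U \<subseteq> W" and g: "smooth_on W g"
  shows smooth_on_parameter_integral: "smooth_on U (\<lambda>u. integral {0..1} (\<lambda>t. g (t, u)))"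
    and fd_parameter_integral: "u \<in> U \<Longrightarrow>
      fd (\<lambda>u. integral {0..1} (\<lambda>t. g (t, u))) u h = integral {0..1} (\<lambda>t. fd g (t, u) (0, h))"
proof -
  define J :: "'p \<Rightarrow> (real \<Rightarrow>\<^sub>C (real \<times> 'p))" where "J = (\<lambda>u. const_bcontfun (0, u))"
  define F where "F u = bc_lin (\<lambda>t. (t, 0)) bc_clamp + J u" for u
  have blJ: "bounded_linear J" unfolding J_def
    by (intro bounded_linear_compose[OF bounded_linear_const_bcontfun] bounded_linear_Pair
        bounded_linear_zero bounded_linear_ident)
  have bl: "bounded_linear (\<lambda>t::real. (t, 0::'p))"
    by (intro bounded_linear_Pair bounded_linear_zero bounded_linear_ident)
  have F: "apply_bcontfun (F u) t = (clamp01 t, u)" for u t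
    by (simp add: F_def J_def apply_bc_lin[OF bl] apply_bc_clamp const_bcontfun.rep_eq)
  have C: "compact ({0..1::real} \<times> {u})" "{0..1} \<times> {u} \<subseteq> W" "range (apply_bcontfun (F u)) \<subseteq> {0..1} \<times> {u}"
    if "u \<in> U" for u
    using sub that by (auto simp: F compact_Times simp del: atLeastAtMost_iff)
  have Fd: "(F has_derivative J) (at u)" for u
    unfolding F_def[abs_def] using has_derivative_add[OF has_derivative_const bounded_linear_imp_has_derivative[OF blJ]]
    by simp
  have CF: "Ck_on k U F" for k
    unfolding F_def[abs_def] by (intro Ck_on_add U Ck_on_const Ck_on_linear blJ)
  have L: "bounded_linear (\<lambda>f. apply_bcontfun (bc_int f) 1 :: 'c)"
    by (rule bounded_linear_compose[OF bounded_linear_apply_bcontfun bounded_linear_bc_int])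
  have eq: "apply_bcontfun (bc_int (nem g (F u))) 1 = integral {0..1} (\<lambda>t. g (t, u))" if "u \<in> U" for u
  proof -
    have "apply_bcontfun (nem g (F u)) t = g (clamp01 t, u)" for t
      using apply_nem[OF C(1,3)[OF that] continuous_on_subset[OF smooth_on_continuous[OF g] C(2)[OF that]]]
      by (simp add: F)
    then show ?thesis by (auto simp: apply_bc_int clamp01_eq intro!: integral_cong)
  qed
  have "Ck_on k U (\<lambda>u. nem g (F u))" for k
  proof (rule Ck_on_nem[OF U W _ g CF])
    show "\<exists>C. compact C \<and> C \<subseteq> W \<and> range (apply_bcontfun (F u)) \<subseteq> C" if "u \<in> U" for u
      using C[OF that] by (intro exI[of _ "{0..1} \<times> {u}"] conjI)
  qed
  then have "smooth_on U (\<lambda>u. apply_bcontfun (bc_int (nem g (F u))) 1)"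
    unfolding smooth_on_def by (intro allI Ck_on_bounded_linear[OF L U]) auto
  then show "smooth_on U (\<lambda>u. integral {0..1} (\<lambda>t. g (t, u)))"
    by (rule smooth_on_cong[OF U, rotated]) (rule eq)
  assume u: "u \<in> U"
  have "((\<lambda>u. apply_bcontfun (bc_int (nem g (F u))) 1) has_derivative
      (\<lambda>h. apply_bcontfun (bc_int (bc_app (nem (fdL g) (F u)) (J h))) 1)) (at u)"
    by (rule bounded_linear.has_derivative[OF L has_derivative_compose[OF Fd
            nem_has_derivative[OF C(1,2)[OF u] W smooth_onD[OF g] C(3)[OF u]]]])
  then have "((\<lambda>u. integral {0..1} (\<lambda>t. g (t, u))) has_derivative
      (\<lambda>h. apply_bcontfun (bc_int (bc_app (nem (fdL g) (F u)) (J h))) 1)) (at u)"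
    by (rule has_derivative_transform_within_open[OF _ U u eq])
  then have "fd (\<lambda>u. integral {0..1} (\<lambda>t. g (t, u))) u h
      = apply_bcontfun (bc_int (bc_app (nem (fdL g) (F u)) (J h))) 1"
    by (simp add: fd_eqI)
  also have "\<dots> = integral {0..1} (\<lambda>t. fd g (t, u) (0, h))"
  proof -
    have "apply_bcontfun (bc_app (nem (fdL g) (F u)) (J h)) t = fd g (clamp01 t, u) (0, h)" for t
    proof -
      have "(clamp01 t, u) \<in> W" using sub u clamp01_mem[of t] by blast
      then have "linear (fd g (clamp01 t, u))" using smooth_on_linear_fd[OF g] by blast
      then show ?thesis
        using apply_nem[OF C(1,3)[OF u] continuous_on_subset[OF smooth_on_continuous[OF smooth_on_fdL[OF g W]] C(2)[OF u]]]
        by (simp add: F apply_bc_app J_def const_bcontfun.rep_eq blinfun_apply_fdL)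
    qed
    then show ?thesis by (auto simp: apply_bc_int clamp01_eq intro!: integral_cong)
  qed
  finally show "fd (\<lambda>u. integral {0..1} (\<lambda>t. g (t, u))) u h = integral {0..1} (\<lambda>t. fd g (t, u) (0, h))" .
qed

section \<open>Flows of time dependent vector fields with parameters\<close>

lemma open_less_on:
  fixes f :: "'a::topological_space \<Rightarrow> real"
  assumes "open S" "continuous_on S f"
  shows "open {x \<in> S. f x < c}"
proof -
  have "{x \<in> S. f x < c} = S \<inter> f -` {..<c}" by auto
  then show ?thesis using continuous_open_preimage[OF assms(2,1) open_lessThan] by simp
qed

text \<open>Here \<open>u\<close> is a parameter and the last argument of \<open>f\<close> the
  state; \<open>\<gamma> t u\<close> is the solution starting at \<open>g u\<close>, obtained as a
  fixed point of Picard's map on a ball of curves around the constant curve \<open>v0\<close>. The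
  equation for \<open>fd (\<gamma> t) u h\<close> is the first variation, which governs the time
  derivative of pulled back forms.\<close>

theorem smooth_flow:
  fixes f :: "real \<times> 'p::euclidean_space \<times> 'e::euclidean_space \<Rightarrow> 'e" and g :: "'p \<Rightarrow> 'e"
  assumes W: "open W" "{0..1} \<times> {(u0, v0)} \<subseteq> W" "smooth_on W f"
    and V: "open V" "u0 \<in> V" "smooth_on V g" "g u0 = v0"
    and f0: "\<And>t. t \<in> {0..1} \<Longrightarrow> f (t, u0, v0) = 0"
    and df0: "\<And>t k. t \<in> {0..1} \<Longrightarrow> fd f (t, u0, v0) (0, 0, k) = 0"
  obtains U \<gamma> where "open U" "u0 \<in> U" "U \<subseteq> V" "\<And>t. smooth_on U (\<gamma> t)"
    "\<And>u t. u \<in> U \<Longrightarrow> t \<in> {0..1} \<Longrightarrow> (t, u, \<gamma> t u) \<in> W"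
    "\<And>u. u \<in> U \<Longrightarrow> \<gamma> 0 u = g u"
    "\<And>u t. u \<in> U \<Longrightarrow> t \<in> {0..1} \<Longrightarrow>
      ((\<lambda>t. \<gamma> t u) has_vector_derivative f (t, u, \<gamma> t u)) (at t within {0..1})"
    "\<And>u t h. u \<in> U \<Longrightarrow> t \<in> {0..1} \<Longrightarrow>
      ((\<lambda>t. fd (\<gamma> t) u h) has_vector_derivative fd f (t, u, \<gamma> t u) (0, h, fd (\<gamma> t) u h)) (at t within {0..1})"
    "\<And>t. \<gamma> t u0 = v0"
proof -
  define E :: "'e \<Rightarrow>\<^sub>L (real \<times> 'p \<times> 'e)" where "E = Blinfun (\<lambda>k. (0, 0, k))"
  have blE: "bounded_linear (\<lambda>k::'e. (0::real, 0::'p, k))"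
    by (intro bounded_linear_Pair bounded_linear_zero bounded_linear_ident)
  have E: "blinfun_apply E k = (0, 0, k)" for k
    by (simp add: E_def bounded_linear_Blinfun_apply[OF blE])
  have sL: "smooth_on W (fdL f)" by (rule smooth_on_fdL[OF W(3,1)])
  have aL: "blinfun_apply (fdL f q) = fd f q" if "q \<in> W" for q
    using blinfun_apply_fdL[OF smooth_on_linear_fd[OF W(3) that]] by blast
  \<comment> \<open>Here the partial derivative in the state is below \<open>1/2\<close>, the
    contraction constant of Picard's map.\<close>
  define W1 where "W1 = {q \<in> W. norm (fdL f q o\<^sub>L E) < 1/2}"
  have "open W1" unfolding W1_def
    by (rule open_less_on[OF W(1)])
      (intro continuous_intros bounded_bilinear.continuous_on[OF bounded_bilinear_blinfun_compose] smooth_on_continuous[OF sL])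
  have K0: "compact ({0..1::real} \<times> {(u0, v0)})" by (simp add: compact_Times)
  have "{0..1} \<times> {(u0, v0)} \<subseteq> W1"
  proof
    fix q :: "real \<times> 'p \<times> 'e" assume q: "q \<in> {0..1} \<times> {(u0, v0)}"
    then have "fdL f q o\<^sub>L E = 0"
      using df0 aL[of q] W(2) by (auto intro!: blinfun_eqI simp: E blinfun.zero_left)
    then show "q \<in> W1" using q W(2) by (auto simp: W1_def)
  qed
  then obtain e1 where e1: "e1 > 0" "(\<Union>q\<in>{0..1} \<times> {(u0, v0)}. cball q e1) \<subseteq> W1"
    using compact_subset_open_imp_cball_epsilon_subset[OF K0 \<open>open W1\<close>] by blast
  \<comment> \<open>Parameter and state may each deviate by \<open>r\<close>; together that is at
    most \<open>e1\<close> in the product metric.\<close>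
  define r where "r = e1 / 2"
  have r: "r > 0" using e1 by (simp add: r_def)
  define Q where "Q = {0..1::real} \<times> cball u0 r \<times> cball v0 r"
  have "compact Q" by (simp add: Q_def compact_Times)
  have QW1: "Q \<subseteq> W1"
  proof
    fix q assume "q \<in> Q"
    then obtain t u v where q: "q = (t, u, v)" "t \<in> {0..1}" "dist u0 u \<le> r" "dist v0 v \<le> r"
      unfolding Q_def by auto
    have "dist (t, u0, v0) (t, u, v) \<le> dist u0 u + dist v0 v"
      unfolding dist_Pair_Pair by (simp add: sqrt_sum_squares_le_sum)
    then have "q \<in> cball (t, u0, v0) e1" using q by (simp add: r_def)
    then show "q \<in> W1" using e1(2) q(2) by blast
  qed
  have QW: "Q \<subseteq> W" using QW1 by (auto simp: W1_def)
  \<comment> \<open>Budget for mapping the ball of radius \<open>r\<close> into itself: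
    \<open>r / 4\<close> from the initial value, \<open>r / 4\<close> from \<open>f\<close> at the
    centre state, and \<open>r / 2\<close> from the Lipschitz bound over that ball.\<close>
  define W2 where "W2 = {q \<in> W. norm (f q) < r / 4}"
  have "open W2" unfolding W2_def
    by (rule open_less_on[OF W(1)])
      (intro continuous_intros smooth_on_continuous[OF W(3)])
  have "{0..1} \<times> {(u0, v0)} \<subseteq> W2" using W(2) f0 r by (auto simp: W2_def)
  then obtain e2 where e2: "e2 > 0" "(\<Union>q\<in>{0..1} \<times> {(u0, v0)}. cball q e2) \<subseteq> W2"
    using compact_subset_open_imp_cball_epsilon_subset[OF K0 \<open>open W2\<close>] by blast
  define V' where "V' = {u \<in> V. norm (g u - v0) < r / 4}"
  have "open V'" unfolding V'_def
    by (rule open_less_on[OF V(1)])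
      (intro continuous_intros smooth_on_continuous[OF V(3)])
  define U where "U = V' \<inter> ball u0 (min r e2)"
  have U: "open U" "u0 \<in> U" "U \<subseteq> V"
    using \<open>open V'\<close> V r e2 by (auto simp: U_def V'_def)
  have Ur: "u \<in> cball u0 r" and Ug: "norm (g u - v0) < r / 4" and Uf: "\<And>t. t \<in> {0..1} \<Longrightarrow> norm (f (t, u, v0)) < r / 4"
    if "u \<in> U" for u
  proof -
    show "u \<in> cball u0 r" "norm (g u - v0) < r / 4" using that by (auto simp: U_def V'_def)
    fix t :: real assume "t \<in> {0..1}"
    moreover have "(t, u, v0) \<in> cball (t, u0, v0) e2" using that by (simp add: U_def dist_Pair_Pair)
    ultimately have "(t, u, v0) \<in> W2" using e2(2) by blast
    then show "norm (f (t, u, v0)) < r / 4" by (simp add: W2_def)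
  qed
  have flip: "norm (f (t, u, v) - f (t, u, w)) \<le> 1/2 * norm (v - w)"
    if t: "t \<in> {0..1}" "u \<in> cball u0 r" "v \<in> cball v0 r" "w \<in> cball v0 r" for t u v w
  proof (rule differentiable_bound[OF convex_cball _ _ that(3,4), where f'="\<lambda>z. blinfun_apply (fdL f (t, u, z) o\<^sub>L E)"])
    fix z assume z: "z \<in> cball v0 r"
    then have q: "(t, u, z) \<in> Q" using t unfolding Q_def by blast
    then have qW: "(t, u, z) \<in> W" using QW by blast
    have "((\<lambda>z. (t, u, z)) has_derivative (\<lambda>k. (0, 0, k))) (at z within cball v0 r)"
      by (intro has_derivative_Pair has_derivative_const has_derivative_ident)
    then have "((\<lambda>z. f (t, u, z)) has_derivative (\<lambda>k. fd f (t, u, z) (0, 0, k))) (at z within cball v0 r)"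
      by (rule has_derivative_compose[where g=f and f="\<lambda>z. (t, u, z)", OF _ smooth_on_has_derivative[OF W(3) qW]])
    then show "((\<lambda>z. f (t, u, z)) has_derivative blinfun_apply (fdL f (t, u, z) o\<^sub>L E)) (at z within cball v0 r)"
      by (rule has_derivative_eq_rhs) (auto simp: E aL[OF qW])
    show "onorm (blinfun_apply (fdL f (t, u, z) o\<^sub>L E)) \<le> 1/2"
      using q QW1 by (auto simp: W1_def norm_blinfun.rep_eq simp del: blinfun_apply_blinfun_compose)
  qed
  define J :: "'p \<Rightarrow> (real \<Rightarrow>\<^sub>C (real \<times> 'p \<times> 'e))" where "J = (\<lambda>u. const_bcontfun (0, u, 0))"
  define I :: "(real \<Rightarrow>\<^sub>C 'e) \<Rightarrow> (real \<Rightarrow>\<^sub>C (real \<times> 'p \<times> 'e))" where "I = bc_lin (\<lambda>k. (0, 0, k))"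
  define T0 :: "real \<Rightarrow>\<^sub>C (real \<times> 'p \<times> 'e)" where "T0 = bc_lin (\<lambda>t. (t, 0, 0)) bc_clamp"
  \<comment> \<open>The curve \<open>(clamp01 t, u, y t)\<close>, jointly affine in \<open>u\<close>
    and \<open>y\<close>, so that the integrand of Picard's map is a superposition after an affine
    map.\<close>
  define \<Delta> where "\<Delta> u y = T0 + J u + I y" for u y
  have blJ: "bounded_linear J" unfolding J_def
    by (intro bounded_linear_compose[OF bounded_linear_const_bcontfun] bounded_linear_Pair
        bounded_linear_zero bounded_linear_ident)
  have blI: "bounded_linear I" unfolding I_def by (rule bounded_linear_bc_lin[OF blE])
  have blT: "bounded_linear (\<lambda>t::real. (t, 0::'p, 0::'e))"
    by (intro bounded_linear_Pair bounded_linear_zero bounded_linear_ident)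
  have aI: "apply_bcontfun (I k) t = (0, 0, apply_bcontfun k t)" for k t
    unfolding I_def by (rule apply_bc_lin[OF blE])
  have aJ: "apply_bcontfun (J u) t = (0, u, 0)" for u t by (simp add: J_def const_bcontfun.rep_eq)
  have a\<Delta>: "apply_bcontfun (\<Delta> u y) t = (clamp01 t, u, apply_bcontfun y t)" for u y t
    by (simp add: \<Delta>_def aI aJ T0_def apply_bc_lin[OF blT] apply_bc_clamp)
  define S where "S = cball (const_bcontfun v0 :: real \<Rightarrow>\<^sub>C 'e) r"
  have Sv: "apply_bcontfun y t \<in> cball v0 r" if "y \<in> S" for y t
    using that dist_bounded[of "const_bcontfun v0" t y] by (auto simp: S_def const_bcontfun.rep_eq intro: order_trans)
  have rng: "range (apply_bcontfun (\<Delta> u y)) \<subseteq> Q" if "u \<in> U" "y \<in> S" for u y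
    using Ur[OF that(1)] Sv[OF that(2)] clamp01_mem by (auto simp: a\<Delta> Q_def simp del: mem_cball atLeastAtMost_iff)
  have cf: "continuous_on Q f" using smooth_on_continuous[OF W(3)] QW by (rule continuous_on_subset)
  have cL: "continuous_on Q (fdL f)" using smooth_on_continuous[OF sL] QW by (rule continuous_on_subset)
  have anem: "apply_bcontfun (nem f (\<Delta> u y)) t = f (clamp01 t, u, apply_bcontfun y t)" if "u \<in> U" "y \<in> S" for u y t
    using apply_nem[OF \<open>compact Q\<close> rng[OF that] cf, of t] by (simp add: a\<Delta>)
  have anemL: "apply_bcontfun (nem (fdL f) (\<Delta> u y)) t = fdL f (clamp01 t, u, apply_bcontfun y t)" if "u \<in> U" "y \<in> S" for u y t
    using apply_nem[OF \<open>compact Q\<close> rng[OF that] cL, of t] by (simp add: a\<Delta>)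
  define N where "N u y = const_bcontfun (g u) + bc_int (nem f (\<Delta> u y))" for u y
  interpret K: bounded_linear "bc_int :: (real \<Rightarrow>\<^sub>C 'e) \<Rightarrow> _" by (rule bounded_linear_bc_int)
  have Nlip: "norm (N u y - N u z) \<le> 1/2 * norm (y - z)" if u: "u \<in> U" and y: "y \<in> S" and z: "z \<in> S" for u y z
  proof -
    have "norm (nem f (\<Delta> u y) - nem f (\<Delta> u z)) \<le> 1/2 * norm (y - z)"
    proof (rule norm_bound)
      fix t
      have "norm (f (clamp01 t, u, apply_bcontfun y t) - f (clamp01 t, u, apply_bcontfun z t))
          \<le> 1/2 * norm (apply_bcontfun y t - apply_bcontfun z t)"
        by (rule flip[OF clamp01_mem Ur[OF u] Sv[OF y] Sv[OF z]])
      also have "\<dots> \<le> 1/2 * norm (y - z)" using norm_bounded[of "y - z" t] by simp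
      finally show "norm (apply_bcontfun (nem f (\<Delta> u y) - nem f (\<Delta> u z)) t) \<le> 1/2 * norm (y - z)"
        by (simp add: anem u y z)
    qed
    then show ?thesis using norm_bc_int[of "nem f (\<Delta> u y) - nem f (\<Delta> u z)"] by (simp add: N_def K.diff)
  qed
  have cS: "const_bcontfun v0 \<in> S" using r by (simp add: S_def)
  have NS: "N u y \<in> S" if u: "u \<in> U" and y: "y \<in> S" for u y
  proof -
    have "norm (nem f (\<Delta> u y)) \<le> 3/4 * r"
    proof (rule norm_bound)
      fix t
      have "norm (f (clamp01 t, u, apply_bcontfun y t) - f (clamp01 t, u, v0)) \<le> 1/2 * norm (apply_bcontfun y t - v0)"
        by (rule flip[OF clamp01_mem Ur[OF u] Sv[OF y]]) (use r in simp)
      moreover have "norm (apply_bcontfun y t - v0) \<le> r" using Sv[OF y, of t] by (simp add: dist_norm norm_minus_commute)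
      ultimately show "norm (apply_bcontfun (nem f (\<Delta> u y)) t) \<le> 3/4 * r"
        using Uf[OF u clamp01_mem[of t]] norm_triangle_sub[of "f (clamp01 t, u, apply_bcontfun y t)" "f (clamp01 t, u, v0)"]
        by (simp add: anem u y)
    qed
    moreover have "N u y - const_bcontfun v0 = const_bcontfun (g u - v0) + bc_int (nem f (\<Delta> u y))"
      by (simp add: N_def linear_diff[OF bounded_linear.linear[OF bounded_linear_const_bcontfun]])
    moreover have "norm (const_bcontfun (g u - v0) :: real \<Rightarrow>\<^sub>C 'e) \<le> r / 4"
      using Ug[OF u] by (intro norm_bound) (simp add: const_bcontfun.rep_eq)
    ultimately have "norm (N u y - const_bcontfun v0) \<le> r"
      using norm_triangle_ineq[of "const_bcontfun (g u - v0)" "bc_int (nem f (\<Delta> u y))"] norm_bc_int[of "nem f (\<Delta> u y)"]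
      by simp
    then show ?thesis by (simp add: S_def dist_norm norm_minus_commute)
  qed
  have uniq: "\<exists>!y\<in>S. N u y = y" if "u \<in> U" for u
  proof (rule Banach_fix[where c="1/2"])
    show "complete S" unfolding S_def complete_eq_closed by simp
    show "dist (N u x) (N u y) \<le> 1/2 * dist x y" if "x \<in> S" "y \<in> S" for x y
      using Nlip[OF \<open>u \<in> U\<close> that] by (simp add: dist_norm)
  qed (use cS NS[OF that] in auto)
  define y where "y u = (THE y. y \<in> S \<and> N u y = y)" for u
  have yS: "y u \<in> S" and yN: "y u = N u (y u)" if "u \<in> U" for u
    using theI'[OF uniq[OF that]] by (auto simp: y_def)
  define A where "A u = nem (fdL f) (\<Delta> u (y u))" for u
  \<comment> \<open>\<open>Nx\<close> and \<open>M\<close> are the partial derivatives of Picard's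
    map in the parameter and in the curve. \<open>M\<close> is assembled from bounded linear and
    bilinear operations in order that its regularity follows from that of \<open>A\<close>.\<close>
  define Nx where "Nx u h = const_bcontfun (fd g u h) + bc_int (bc_app (A u) (J h))" for u h
  define M where "M u = Blinfun bc_int o\<^sub>L (bounded_bilinear.prod_right bc_app (A u) o\<^sub>L Blinfun I)" for u
  have aM: "blinfun_apply (M u) k = bc_int (bc_app (A u) (I k))" for u k
    by (simp add: M_def bounded_linear_Blinfun_apply blI bounded_linear_bc_int
        bounded_bilinear.prod_right.rep_eq[OF bounded_bilinear_bc_app])
  have der: "((\<lambda>p. N (fst p) (snd p)) has_derivative (\<lambda>p. Nx u (fst p) + M u (snd p))) (at (u, y u))" if u: "u \<in> U" for u
  proof -
    have "((\<lambda>p. \<Delta> (fst p) (snd p)) has_derivative (\<lambda>p. 0 + J (fst p) + I (snd p))) (at (u, y u))"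
      unfolding \<Delta>_def
      by (intro has_derivative_add has_derivative_const bounded_linear.has_derivative[OF blJ]
          bounded_linear.has_derivative[OF blI] has_derivative_fst has_derivative_snd has_derivative_ident)
    then have "((\<lambda>p. nem f (\<Delta> (fst p) (snd p))) has_derivative (\<lambda>p. bc_app (A u) (0 + J (fst p) + I (snd p)))) (at (u, y u))"
      unfolding A_def
      by (rule has_derivative_compose)
        (simp, rule nem_has_derivative[OF \<open>compact Q\<close> QW W(1) smooth_onD[OF W(3)] rng[OF u yS[OF u]]])
    moreover have "((\<lambda>p. g (fst p)) has_derivative (\<lambda>p. fd g u (fst p))) (at (u, y u))"
      by (rule has_derivative_compose[OF has_derivative_fst[OF has_derivative_ident]])
        (simp, use smooth_on_has_derivative[OF V(3)] u U(3) in blast)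
    ultimately have "((\<lambda>p. N (fst p) (snd p)) has_derivative
       (\<lambda>p. const_bcontfun (fd g u (fst p)) + bc_int (bc_app (A u) (0 + J (fst p) + I (snd p))))) (at (u, y u))"
      unfolding N_def
      by (intro has_derivative_add K.has_derivative bounded_linear.has_derivative[OF bounded_linear_const_bcontfun])
    then show ?thesis
      by (rule has_derivative_eq_rhs)
        (simp add: fun_eq_iff Nx_def aM bounded_bilinear.add_right[OF bounded_bilinear_bc_app] K.add)
  qed
  have normM: "norm (M u) \<le> 1/2" if u: "u \<in> U" for u
  proof (rule norm_blinfun_bound)
    fix k
    have "norm (bc_app (A u) (I k)) \<le> 1/2 * norm k"
    proof (rule norm_bound)
      fix t
      have "(clamp01 t, u, apply_bcontfun (y u) t) \<in> W1"
        using rng[OF u yS[OF u]] QW1 by (auto simp: a\<Delta>)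
      then have "norm (fdL f (clamp01 t, u, apply_bcontfun (y u) t) o\<^sub>L E) \<le> 1/2" by (simp add: W1_def)
      from mult_right_mono[OF this norm_ge_zero[of "apply_bcontfun k t"]]
        norm_blinfun[of "fdL f (clamp01 t, u, apply_bcontfun (y u) t) o\<^sub>L E" "apply_bcontfun k t"]
      show "norm (apply_bcontfun (bc_app (A u) (I k)) t) \<le> 1/2 * norm k"
        using norm_bounded[of k t] by (simp add: apply_bc_app A_def anemL u yS aI E)
    qed
    then show "norm (blinfun_apply (M u) k) \<le> 1/2 * norm k"
      using norm_bc_int[of "bc_app (A u) (I k)"] by (simp add: aM)
  qed simp
  have CA: "Ck_on k U A" if "Ck_on k U y" for k
    unfolding A_def[abs_def]
  proof (rule Ck_on_nem[OF U(1) W(1) _ sL])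
    show "\<exists>C. compact C \<and> C \<subseteq> W \<and> range (apply_bcontfun (\<Delta> u (y u))) \<subseteq> C" if "u \<in> U" for u
      using rng[OF that yS[OF that]] \<open>compact Q\<close> QW by blast
    show "Ck_on k U (\<lambda>u. \<Delta> u (y u))" unfolding \<Delta>_def
      by (intro Ck_on_add U(1) Ck_on_const Ck_on_linear[OF blJ] Ck_on_bounded_linear[OF blI] that)
  qed
  have CM: "Ck_on k U M" if "Ck_on k U y" for k
    unfolding M_def[abs_def]
    by (intro Ck_on_bilinear[OF bounded_bilinear_blinfun_compose U(1)] Ck_on_const
        Ck_on_bounded_linear[OF bounded_bilinear.bounded_linear_prod_right[OF bounded_bilinear_bc_app] U(1)] CA that)
  have CNx: "Ck_on k U (\<lambda>u. Nx u h)" if "Ck_on k U y" for k h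
    unfolding Nx_def
    by (intro Ck_on_add U(1) Ck_on_bounded_linear[OF bounded_linear_const_bcontfun]
        Ck_on_bounded_linear[OF bounded_linear_bc_int] Ck_on_bilinear[OF bounded_bilinear_bc_app] CA that Ck_on_const
        Ck_on_subset[OF smooth_onD[OF smooth_on_fd[OF V(3)]] U(3)])
  have lip: "norm (N x (y x) - N x (y u)) \<le> 1/2 * norm (y x - y u)" if "x \<in> U" "u \<in> U" for x u
    by (rule Nlip[OF that(1) yS[OF that(1)] yS[OF that(2)]])
  have fp1: "smooth_on U y"
    by (rule fixed_point_smooth(1)[where N=N and Nx=Nx and M=M, OF U(1)];
        (rule yN der normM lip CM CNx; assumption))
  have fp2: "fd y u h = Nx u h + M u (fd y u h)" if "u \<in> U" for u h
    by (rule fixed_point_smooth(2)[where N=N and Nx=Nx and M=M, OF U(1) _ _ _ _ _ _ that];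
        (rule yN der normM lip CM CNx; assumption))
  define \<gamma> where "\<gamma> t u = apply_bcontfun (y u) t" for t u
  have fd\<gamma>: "fd (\<gamma> t) u h = apply_bcontfun (fd y u h) t" if "u \<in> U" for t u h
  proof -
    have "(\<gamma> t has_derivative (\<lambda>h. apply_bcontfun (fd y u h) t)) (at u)"
      unfolding \<gamma>_def[abs_def]
      by (rule bounded_linear.has_derivative[OF bounded_linear_apply_bcontfun smooth_on_has_derivative[OF fp1 that]])
    then show ?thesis by (simp add: fd_eqI)
  qed
  show thesis
  proof (rule that[OF U])
    show "smooth_on U (\<gamma> t)" for t unfolding \<gamma>_def[abs_def]
      by (rule smooth_on_bounded_linear[OF bounded_linear_apply_bcontfun U(1) fp1])
    show inW: "(t, u, \<gamma> t u) \<in> W" if "u \<in> U" "t \<in> {0..1}" for u t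
    proof -
      have "apply_bcontfun (\<Delta> u (y u)) t \<in> W" using rng[OF that(1) yS[OF that(1)]] QW by blast
      then show ?thesis by (simp add: a\<Delta> \<gamma>_def clamp01_eq[OF that(2)])
    qed
    have N0: "apply_bcontfun (N u z) t = g u + apply_bcontfun (bc_int (nem f (\<Delta> u z))) t" for u z t
      by (simp add: N_def const_bcontfun.rep_eq)
    show "\<gamma> 0 u = g u" if "u \<in> U" for u
      using N0[of u "y u" 0] yN[OF that] by (simp add: \<gamma>_def apply_bc_int clamp01_eq)
    show "((\<lambda>t. \<gamma> t u) has_vector_derivative f (t, u, \<gamma> t u)) (at t within {0..1})" if "u \<in> U" "t \<in> {0..1}" for u t
    proof -
      have "((\<lambda>t. g u + apply_bcontfun (bc_int (nem f (\<Delta> u (y u)))) t) has_vector_derivative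
          0 + apply_bcontfun (nem f (\<Delta> u (y u))) t) (at t within {0..1})"
        by (intro has_vector_derivative_add has_vector_derivative_const bc_int_has_vector_derivative that(2))
      moreover have "(\<lambda>t. g u + apply_bcontfun (bc_int (nem f (\<Delta> u (y u)))) t) = (\<lambda>t. \<gamma> t u)"
        using yN[OF that(1)] N0 by (metis \<gamma>_def)
      ultimately show ?thesis by (simp add: anem that(1) yS \<gamma>_def clamp01_eq[OF that(2)])
    qed
    show "((\<lambda>t. fd (\<gamma> t) u h) has_vector_derivative fd f (t, u, \<gamma> t u) (0, h, fd (\<gamma> t) u h)) (at t within {0..1})"
      if "u \<in> U" "t \<in> {0..1}" for u t h
    proof -
      \<comment> \<open>The fixed point equation for \<open>fd y u h\<close> is the integrated form
        of the first variation equation, with integrand \<open>q\<close>.\<close>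
      define q where "q = bc_app (A u) (J h + I (fd y u h))"
      have "fd y u h = const_bcontfun (fd g u h) + bc_int q"
        using fp2[OF that(1), of h]
        unfolding Nx_def aM q_def bounded_bilinear.add_right[OF bounded_bilinear_bc_app] K.add add.assoc .
      then have "(\<lambda>t. fd (\<gamma> t) u h) = (\<lambda>t. fd g u h + apply_bcontfun (bc_int q) t)"
        by (simp add: fd\<gamma>[OF that(1)] const_bcontfun.rep_eq)
      moreover have "((\<lambda>t. fd g u h + apply_bcontfun (bc_int q) t) has_vector_derivative 0 + apply_bcontfun q t) (at t within {0..1})"
        by (intro has_vector_derivative_add has_vector_derivative_const bc_int_has_vector_derivative that(2))
      moreover have "apply_bcontfun q t = fd f (t, u, \<gamma> t u) (0, h, fd (\<gamma> t) u h)"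
        by (simp add: q_def apply_bc_app A_def anemL that(1) yS clamp01_eq[OF that(2)] aI aJ fd\<gamma>[OF that(1)]
            aL[OF inW[OF that, unfolded \<gamma>_def]] \<gamma>_def)
      ultimately show ?thesis by simp
    qed
    \<comment> \<open>At the centre the constant curve solves the equation because \<open>f\<close>
      vanishes along it; uniqueness identifies it with \<open>y u0\<close>.\<close>
    have "N u0 (const_bcontfun v0) = const_bcontfun v0"
    proof -
      have "nem f (\<Delta> u0 (const_bcontfun v0)) = 0"
        by (rule bcontfun_eqI) (simp add: anem[OF U(2) cS] const_bcontfun.rep_eq f0[OF clamp01_mem])
      then show ?thesis by (simp add: N_def V(4) K.zero)
    qed
    then have "y u0 = const_bcontfun v0"
      using uniq[OF U(2)] cS yS[OF U(2)] yN[OF U(2)] by metis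
    then show "\<gamma> t u0 = v0" for t by (simp add: \<gamma>_def const_bcontfun.rep_eq)
  qed
qed

section \<open>Alternating bilinear forms\<close>

lemma bilinear_altD:
  fixes \<beta> :: "'a::real_vector \<Rightarrow> 'a \<Rightarrow> real"
  assumes "bilinear \<beta>" "\<And>x. \<beta> x x = 0"
  shows "\<beta> x y = - \<beta> y x"
  using assms(2)[of "x + y"] assms(2)[of x] assms(2)[of y]
  by (simp add: bilinear_ladd[OF assms(1)] bilinear_radd[OF assms(1)])

lemma bilinearD_linear: "bilinear \<beta> \<Longrightarrow> linear (\<lambda>y. \<beta> x y)" "bilinear \<beta> \<Longrightarrow> linear (\<lambda>x. \<beta> x y)"
  by (auto simp: bilinear_def)

text \<open>\<open>a\<close> is not in the radical, and if \<open>b - r *\<^sub>R a\<close> were,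
  pairing it with \<open>a\<close> would give \<open>\<beta> b a = 0\<close>.\<close>

lemma dim_radical_insert2:
  fixes \<beta> :: "'a::euclidean_space \<Rightarrow> 'a \<Rightarrow> real"
  assumes "bilinear \<beta>" "\<And>x. \<beta> x x = 0" "\<beta> a b \<noteq> 0"
  shows "dim {x. \<forall>y. \<beta> x y = 0} + 2 \<le> dim (insert b (insert a {x. \<forall>y. \<beta> x y = 0}))"
proof -
  let ?R = "{x. \<forall>y. \<beta> x y = 0}"
  have R: "subspace ?R"
    by (auto simp: subspace_def bilinear_lzero[OF assms(1)] bilinear_ladd[OF assms(1)] bilinear_lmul[OF assms(1)])
  then have "a \<notin> span ?R" using assms(3) by (auto simp: span_eq_iff[THEN iffD2])
  moreover have "b \<notin> span (insert a ?R)"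
  proof
    assume "b \<in> span (insert a ?R)"
    then obtain r where "b - r *\<^sub>R a \<in> span ?R" using span_breakdown_eq by blast
    then have "b - r *\<^sub>R a \<in> ?R" using R by (simp add: span_eq_iff[THEN iffD2])
    then have "\<beta> (b - r *\<^sub>R a) a = 0" by blast
    then have "\<beta> b a = 0"
      by (simp add: bilinear_lsub[OF assms(1)] bilinear_lmul[OF assms(1)] assms(2))
    then show False using bilinear_altD[OF assms(1,2), of a b] assms(3) by simp
  qed
  ultimately show ?thesis by (simp add: dim_insert)
qed

text \<open>Induction splits off one hyperbolic pair at a time, which enlarges the radical by at
  least two dimensions. The slack \<open>+ 1\<close> accommodates odd dimensions: a nonzero
  alternating form has rank at least 2, so rank at most 1 means zero. The covectors may vanish, so
  \<open>k\<close> need only bound half the rank.\<close>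

lemma alternating_normal_form:
  fixes \<beta> :: "'a::euclidean_space \<Rightarrow> 'a \<Rightarrow> real"
  assumes "bilinear \<beta>" "\<And>x. \<beta> x x = 0" "DIM('a) \<le> dim {x. \<forall>y. \<beta> x y = 0} + 2 * k + 1"
  shows "\<exists>x y :: nat \<Rightarrow> 'a \<Rightarrow> real. (\<forall>i. linear (x i) \<and> linear (y i)) \<and>
    (\<forall>h l. \<beta> h l = (\<Sum>i=1..k. x i h * y i l - x i l * y i h))"
  using assms
proof (induction k arbitrary: \<beta>)
  case 0
  have "\<beta> a b = 0" for a b
  proof (rule ccontr)
    assume "\<beta> a b \<noteq> 0"
    from dim_radical_insert2[OF 0(1,2) this] 0(3) dim_subset_UNIV[of "insert b (insert a {x. \<forall>y. \<beta> x y = 0})"]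
    show False by simp
  qed
  then show ?case by (intro exI[of _ "\<lambda>i x. 0"]) (auto simp: linear_zero)
next
  case (Suc k)
  show ?case
  proof (cases "\<forall>a b. \<beta> a b = 0")
    case True
    then show ?thesis by (intro exI[of _ "\<lambda>i x. 0"]) (auto simp: linear_zero)
  next
    case False
    then obtain a b' where ab': "\<beta> a b' \<noteq> 0" by blast
    note lin = bilinear_ladd[OF Suc.prems(1)] bilinear_lmul[OF Suc.prems(1)]
      bilinear_radd[OF Suc.prems(1)] bilinear_rmul[OF Suc.prems(1)]
    note alt = bilinear_altD[OF Suc.prems(1,2)]
    define b where "b = b' /\<^sub>R \<beta> a b'"
    have ab: "\<beta> a b = 1" using ab' by (simp add: b_def lin)
    \<comment> \<open>With \<open>\<beta> a b = 1\<close> the subtracted term agrees with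
      \<open>\<beta>\<close> whenever one argument is \<open>a\<close> or \<open>b\<close>, so both
      vectors join the radical of \<open>\<beta>'\<close>, which keeps the old radical.\<close>
    define \<beta>' where "\<beta>' h l = \<beta> h l - (\<beta> h b * \<beta> a l - \<beta> l b * \<beta> a h)" for h l
    have bil: "bilinear \<beta>'"
      unfolding bilinear_def \<beta>'_def
      by (auto intro!: linearI simp: lin algebra_simps)
    have alt': "\<beta>' x x = 0" for x by (simp add: \<beta>'_def Suc.prems(2))
    have "insert b (insert a {x. \<forall>y. \<beta> x y = 0}) \<subseteq> {x. \<forall>y. \<beta>' x y = 0}"
    proof -
      have "\<beta>' a y = 0" "\<beta>' b y = 0" for y
        using ab alt[of y b] Suc.prems(2) by (auto simp: \<beta>'_def)
      moreover have "\<beta>' x y = 0" if "\<forall>y. \<beta> x y = 0" for x y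
        using that alt[of a x] by (auto simp: \<beta>'_def)
      ultimately show ?thesis by auto
    qed
    then have "dim {x. \<forall>y. \<beta> x y = 0} + 2 \<le> dim {x. \<forall>y. \<beta>' x y = 0}"
      using dim_radical_insert2[OF Suc.prems(1,2), of a b] ab
        dim_subset[of "insert b (insert a {x. \<forall>y. \<beta> x y = 0})" "{x. \<forall>y. \<beta>' x y = 0}"] by linarith
    then have "DIM('a) \<le> dim {x. \<forall>y. \<beta>' x y = 0} + 2 * k + 1" using Suc.prems(3) by simp
    from Suc.IH[OF bil alt' this] obtain x y :: "nat \<Rightarrow> 'a \<Rightarrow> real"
      where xy: "\<And>i. linear (x i)" "\<And>i. linear (y i)"
        "\<And>h l. \<beta>' h l = (\<Sum>i=1..k. x i h * y i l - x i l * y i h)" by blast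
    define x' where "x' i = (if i = Suc k then \<lambda>h. \<beta> h b else x i)" for i
    define y' where "y' i = (if i = Suc k then \<lambda>h. \<beta> a h else y i)" for i
    have "\<beta> h l = (\<Sum>i=1..Suc k. x' i h * y' i l - x' i l * y' i h)" for h l
    proof -
      have "(\<Sum>i=1..k. x' i h * y' i l - x' i l * y' i h) = \<beta>' h l"
        unfolding xy(3) by (intro sum.cong) (auto simp: x'_def y'_def)
      then show ?thesis by (simp add: \<beta>'_def) (simp add: x'_def y'_def)
    qed
    moreover have "linear (x' i)" "linear (y' i)" for i
      using xy(1,2) bilinearD_linear[OF Suc.prems(1)] by (auto simp: x'_def y'_def)
    ultimately show ?thesis by blast
  qed
qed

lemma linear_functional_inner:
  fixes f :: "'a::euclidean_space \<Rightarrow> real"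
  assumes "linear f" shows "f h = h \<bullet> (\<Sum>b\<in>Basis. f b *\<^sub>R b)"
  using vector_Basis_expansion[OF assms, of h] by (simp add: inner_sum_right mult.commute)

text \<open>The normal form uses only \<open>2 * n\<close> covectors, whose common kernel in
  dimension \<open>2 * n + 1\<close> is nontrivial and lies in the radical.\<close>

lemma alternating_odd_kernel:
  fixes \<beta> :: "'a::euclidean_space \<Rightarrow> 'a \<Rightarrow> real"
  assumes "bilinear \<beta>" "\<And>x. \<beta> x x = 0" "DIM('a) = 2 * n + 1"
  shows "\<exists>v. v \<noteq> 0 \<and> (\<forall>k. \<beta> v k = 0)"
proof -
  have "DIM('a) \<le> dim {x. \<forall>y. \<beta> x y = 0} + 2 * n + 1" using assms(3) by simp
  from alternating_normal_form[OF assms(1,2) this] obtain x y :: "nat \<Rightarrow> 'a \<Rightarrow> real"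
    where xy: "\<And>i. linear (x i)" "\<And>i. linear (y i)"
      "\<And>h l. \<beta> h l = (\<Sum>i=1..n. x i h * y i l - x i l * y i h)" by blast
  define r where "r f = (\<Sum>b\<in>Basis. f b *\<^sub>R b)" for f :: "'a \<Rightarrow> real"
  define S where "S = (\<lambda>i. r (x i)) ` {1..n} \<union> (\<lambda>i. r (y i)) ` {1..n}"
  have fS: "finite S" by (simp add: S_def)
  have "card S \<le> card ((\<lambda>i. r (x i)) ` {1..n}) + card ((\<lambda>i. r (y i)) ` {1..n})"
    unfolding S_def by (rule card_Un_le)
  also have "\<dots> \<le> n + n"
    using card_image_le[of "{1..n}" "\<lambda>i. r (x i)"] card_image_le[of "{1..n}" "\<lambda>i. r (y i)"] by simp
  finally have "dim S < DIM('a)" using dim_le_card'[OF fS] assms(3) by linarith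
  then obtain v where v: "v \<noteq> 0" "\<And>s. s \<in> span S \<Longrightarrow> orthogonal v s"
    using orthogonal_to_subspace_exists by blast
  have "x i v = 0 \<and> y i v = 0" if "i \<in> {1..n}" for i
  proof -
    have "r (x i) \<in> span S" "r (y i) \<in> span S" using that by (auto simp: S_def intro!: span_base)
    then have "v \<bullet> r (x i) = 0" "v \<bullet> r (y i) = 0" using v(2) by (auto simp: orthogonal_def)
    then show ?thesis
      using linear_functional_inner[OF xy(1)[of i], of v] linear_functional_inner[OF xy(2)[of i], of v]
      by (simp add: r_def)
  qed
  then have "\<beta> v k = 0" for k unfolding xy(3) by (intro sum.neutral) auto
  with v(1) show ?thesis by blast
qed

section \<open>Smooth solutions of linear systems\<close>

lemma injective_blinfun_inverse:
  fixes B :: "'a::euclidean_space \<Rightarrow>\<^sub>L 'a"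
  assumes "\<And>h. B h = 0 \<Longrightarrow> h = 0"
  obtains C where "C o\<^sub>L B = id_blinfun" "B o\<^sub>L C = id_blinfun"
proof -
  have lB: "linear (blinfun_apply B)" by (rule bounded_linear.linear[OF blinfun.bounded_linear_right])
  then have "inj (blinfun_apply B)" using assms linear_injective_0 by blast
  from linear_injective_isomorphism[OF lB this] obtain c
    where c: "linear c" "\<forall>x. c (blinfun_apply B x) = x" "\<forall>x. blinfun_apply B (c x) = x" by blast
  have "blinfun_apply (Blinfun c) = c"
    using c(1) by (intro bounded_linear_Blinfun_apply) (simp add: linear_conv_bounded_linear)
  with c show ?thesis by (intro that[of "Blinfun c"]) (auto intro!: blinfun_eqI)
qed

lemma near_identity_injective:
  fixes B :: "'a::real_normed_vector \<Rightarrow>\<^sub>L 'a"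
  assumes "norm (id_blinfun - (C o\<^sub>L B)) \<le> 1/2" "B h = 0"
  shows "h = 0"
  using half_contraction_bound[OF assms(1), of h] assms(2)
  by (simp add: blinfun.diff_left blinfun.zero_right)

text \<open>Preconditioning with a constant approximate inverse \<open>C\<close> turns the system
  into a fixed point equation for \<open>y u\<close> with operator
  \<open>id_blinfun - (C o\<^sub>L B u)\<close>, so smoothness of the solution is obtained without
  differentiating the inverse of \<open>B u\<close>.\<close>

lemma smooth_on_linear_system:
  fixes B :: "'p::real_normed_vector \<Rightarrow> 'a::banach \<Rightarrow>\<^sub>L 'a"
  assumes U: "open U" and B: "smooth_on U B" and b: "smooth_on U b"
    and sol: "\<And>u. u \<in> U \<Longrightarrow> B u (y u) = b u"
    and C: "\<And>u. u \<in> U \<Longrightarrow> norm (id_blinfun - (C o\<^sub>L B u)) \<le> 1/2"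
  shows "smooth_on U y"
proof (rule linear_solve_smooth[where M="\<lambda>u. id_blinfun - (C o\<^sub>L B u)" and b="\<lambda>u. C (b u)", OF U _ C])
  show "y u = C (b u) + (id_blinfun - (C o\<^sub>L B u)) (y u)" if "u \<in> U" for u
    using sol[OF that] by (simp add: blinfun.diff_left id_blinfun.rep_eq)
  show "smooth_on U (\<lambda>u. id_blinfun - (C o\<^sub>L B u))"
    by (intro smooth_on_diff U smooth_on_const smooth_on_bilinear[OF bounded_bilinear_blinfun_compose] B)
  show "smooth_on U (\<lambda>u. C (b u))"
    by (intro smooth_on_bounded_linear[OF blinfun.bounded_linear_right] U b)
qed

section \<open>The Poincare lemma on balls\<close>

lemma scaleR_ball:
  fixes u :: "'a::real_normed_vector"
  shows "s \<in> {0..1} \<Longrightarrow> u \<in> ball 0 r \<Longrightarrow> s *\<^sub>R u \<in> ball 0 r"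
  using le_less_trans[OF mult_left_le_one_le[of "norm u" s]] by simp

text \<open>\<open>W\<close> enlarges the cylinder over the ball to an open set in which time is a
  free variable too, as joint differentiation in time and space requires.\<close>

lemma homotopy_integrand:
  fixes F :: "'a::euclidean_space \<Rightarrow> 'c::real_normed_vector"
  assumes "smooth_on (ball 0 r) F"
  defines "W \<equiv> {p :: real \<times> 'a. fst p *\<^sub>R snd p \<in> ball 0 r}"
  shows "open W" "{0..1} \<times> ball 0 r \<subseteq> W" "smooth_on W (\<lambda>p. F (fst p *\<^sub>R snd p))"
    "p \<in> W \<Longrightarrow> ((\<lambda>p. F (fst p *\<^sub>R snd p)) has_derivative
       (\<lambda>d. fd F (fst p *\<^sub>R snd p) (fst d *\<^sub>R snd p + fst p *\<^sub>R snd d))) (at p)"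
proof -
  have "W = (\<lambda>p. fst p *\<^sub>R snd p) -` ball 0 r" by (auto simp: W_def)
  then show W: "open W" by (auto intro!: open_vimage continuous_intros)
  show "{0..1} \<times> ball 0 r \<subseteq> W"
    unfolding W_def using scaleR_ball[where r=r and 'a='a] by (auto simp del: mem_ball atLeastAtMost_iff)
  show "smooth_on W (\<lambda>p. F (fst p *\<^sub>R snd p))"
  proof (rule smooth_on_compose[OF W open_ball _ assms(1)])
    show "(\<lambda>p. fst p *\<^sub>R snd p) ` W \<subseteq> ball 0 r" by (auto simp: W_def)
    show "smooth_on W (\<lambda>p. fst p *\<^sub>R snd p)"
      by (intro smooth_on_scaleR W smooth_on_linear[OF bounded_linear_fst] smooth_on_linear[OF bounded_linear_snd])
  qed
  assume "p \<in> W"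
  then have "(F has_derivative fd F (fst p *\<^sub>R snd p)) (at (fst p *\<^sub>R snd p))"
    using smooth_on_has_derivative[OF assms(1)] by (simp add: W_def)
  then have "((\<lambda>p. F (fst p *\<^sub>R snd p)) has_derivative
      (\<lambda>d. fd F (fst p *\<^sub>R snd p) (fst p *\<^sub>R snd d + fst d *\<^sub>R snd p))) (at p)"
    by (rule has_derivative_compose[where f="\<lambda>p. fst p *\<^sub>R snd p", rotated])
      (intro has_derivative_scaleR has_derivative_fst has_derivative_snd has_derivative_ident)
  then show "((\<lambda>p. F (fst p *\<^sub>R snd p)) has_derivative
       (\<lambda>d. fd F (fst p *\<^sub>R snd p) (fst d *\<^sub>R snd p + fst p *\<^sub>R snd d))) (at p)"
    by (simp add: add.commute)
qed

lemma scaled_ray_has_vector_derivative: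
  assumes "smooth_on (ball 0 r) F" "u \<in> ball 0 r" "s \<in> {0..1}"
  shows "((\<lambda>s. F (s *\<^sub>R u)) has_vector_derivative fd F (s *\<^sub>R u) u) (at s within {0..1})"
proof -
  have "((\<lambda>s. s *\<^sub>R u) has_derivative (\<lambda>d. d *\<^sub>R u)) (at s within {0..1})"
    by (intro derivative_eq_intros) auto
  from has_derivative_compose[OF this smooth_on_has_derivative[OF assms(1) scaleR_ball[OF assms(3,2)]]]
  show ?thesis
    using linear_scale[OF smooth_on_linear_fd[OF assms(1) scaleR_ball[OF assms(3,2)]]]
    by (simp add: has_vector_derivative_def)
qed

text \<open>The primitive is the integral of \<open>E\<close> along rays from 0. By closedness the
  derivative of its integrand in direction \<open>h\<close> is the \<open>t\<close>-derivative of
  \<open>t * E (t *\<^sub>R u) h\<close>.\<close>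

lemma poincare_one_form:
  fixes E :: "'a::euclidean_space \<Rightarrow> 'a \<Rightarrow>\<^sub>L real"
  assumes E: "smooth_on (ball 0 r) E"
    and cl: "\<And>u h k. u \<in> ball 0 r \<Longrightarrow> fd E u h k = fd E u k h"
  obtains z where "smooth_on (ball 0 r) z" "z 0 = 0" "\<And>u h. u \<in> ball 0 r \<Longrightarrow> fd z u h = E u h"
proof -
  note hi = homotopy_integrand[OF E]
  let ?W = "{p :: real \<times> 'a. fst p *\<^sub>R snd p \<in> ball 0 r}"
  define g where "g p = E (fst p *\<^sub>R snd p) (snd p)" for p :: "real \<times> 'a"
  have g: "smooth_on ?W g" unfolding g_def[abs_def]
    by (intro smooth_on_bilinear[OF bounded_bilinear_blinfun_apply] hi smooth_on_linear[OF bounded_linear_snd])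
  define z where "z u = integral {0..1} (\<lambda>t. g (t, u))" for u
  have "fd z u h = E u h" if u: "u \<in> ball 0 r" for u h
  proof -
    have "fd z u h = integral {0..1} (\<lambda>t. fd g (t, u) (0, h))"
      unfolding z_def[abs_def] by (rule fd_parameter_integral[OF hi(1) open_ball hi(2) g u])
    also have "\<dots> = integral {0..1} (\<lambda>t. t * fd E (t *\<^sub>R u) u h + E (t *\<^sub>R u) h)"
    proof (rule integral_cong)
      fix t :: real assume t: "t \<in> {0..1}"
      have tu: "t *\<^sub>R u \<in> ball 0 r" by (rule scaleR_ball[OF t u])
      have "(g has_derivative (\<lambda>d. E (t *\<^sub>R u) (snd d) + fd E (t *\<^sub>R u) (fst d *\<^sub>R u + t *\<^sub>R snd d) u)) (at (t, u))"
        unfolding g_def[abs_def]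
        using blinfun.FDERIV[OF hi(4)[of "(t, u)"] has_derivative_snd[OF has_derivative_ident]] tu by simp
      then show "fd g (t, u) (0, h) = t * fd E (t *\<^sub>R u) u h + E (t *\<^sub>R u) h"
        using linear_scale[OF smooth_on_linear_fd[OF E tu]] cl[OF tu, of h u]
        by (simp add: fd_eqI blinfun.scaleR_left)
    qed
    also have "\<dots> = 1 * E (1 *\<^sub>R u) h - 0 * E (0 *\<^sub>R u) h"
    proof (rule integral_unique, rule fundamental_theorem_of_calculus)
      fix t :: real assume t: "t \<in> {0..1}"
      have 1: "((\<lambda>t. E (t *\<^sub>R u) h) has_vector_derivative fd E (t *\<^sub>R u) u h) (at t within {0..1})"
        by (rule bounded_linear.has_vector_derivative[OF blinfun.bounded_linear_left scaled_ray_has_vector_derivative[OF E u t]])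
      show "((\<lambda>t. t * E (t *\<^sub>R u) h) has_vector_derivative t * fd E (t *\<^sub>R u) u h + E (t *\<^sub>R u) h) (at t within {0..1})"
        using has_vector_derivative_mult[OF has_vector_derivative_id 1] by simp
    qed simp
    finally show ?thesis by simp
  qed
  moreover have "z 0 = 0" by (simp add: z_def g_def blinfun.zero_right)
  ultimately show ?thesis
    using that[of z] smooth_on_parameter_integral[OF hi(1) open_ball hi(2) g] unfolding z_def[abs_def] by auto
qed

text \<open>Polarisation of the derivative of \<open>\<sigma> u h h = 0\<close>.\<close>

lemma fd_blinfun_alternating:
  fixes \<sigma> :: "'a::real_normed_vector \<Rightarrow> 'b::real_normed_vector \<Rightarrow>\<^sub>L 'b \<Rightarrow>\<^sub>L real"
  assumes "open V" "smooth_on V \<sigma>" "\<And>u h. u \<in> V \<Longrightarrow> \<sigma> u h h = 0" "u \<in> V"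
  shows "fd \<sigma> u d h k = - fd \<sigma> u d k h"
proof -
  have "((\<lambda>u. \<sigma> u h h) has_derivative (\<lambda>d. fd \<sigma> u d h h)) (at u)" for h
    by (intro bounded_linear.has_derivative[OF blinfun.bounded_linear_left] smooth_on_has_derivative[OF assms(2,4)])
  moreover have "((\<lambda>u. \<sigma> u h h) has_derivative (\<lambda>d. 0)) (at u)" for h
    by (rule has_derivative_transform_within_open[OF has_derivative_const assms(1,4)]) (simp add: assms(3))
  ultimately have "fd \<sigma> u d h h = 0" for h by (metis has_derivative_unique)
  from this[of "h + k"] this[of h] this[of k] show ?thesis
    by (simp add: blinfun.add_left blinfun.add_right)
qed

text \<open>The radial homotopy operator: \<open>\<alpha> u\<close> integrates
  \<open>t *\<^sub>R \<sigma> (t *\<^sub>R u) u\<close>. The factor \<open>u\<close> together with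
  \<open>\<sigma> 0 = 0\<close> makes \<open>\<alpha>\<close> vanish to second order at 0, and a
  constant vector annihilated by \<open>\<sigma>\<close> is annihilated by \<open>\<alpha>\<close>;
  Moser's argument relies on both.\<close>

lemma poincare_two_form:
  fixes \<sigma> :: "'a::euclidean_space \<Rightarrow> 'a \<Rightarrow>\<^sub>L 'a \<Rightarrow>\<^sub>L real"
  assumes \<sigma>: "smooth_on (ball 0 r) \<sigma>"
    and alt: "\<And>u h. u \<in> ball 0 r \<Longrightarrow> \<sigma> u h h = 0"
    and cl: "\<And>u h k l. u \<in> ball 0 r \<Longrightarrow> fd \<sigma> u h k l - fd \<sigma> u k h l + fd \<sigma> u l h k = 0"
    and \<sigma>0: "\<sigma> 0 = 0" and r: "r > 0"
  obtains \<alpha> :: "'a \<Rightarrow> 'a \<Rightarrow>\<^sub>L real" where "smooth_on (ball 0 r) \<alpha>" "\<alpha> 0 = 0" "\<And>h. fd \<alpha> 0 h = 0"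
    "\<And>u h k. u \<in> ball 0 r \<Longrightarrow> fd \<alpha> u h k - fd \<alpha> u k h = \<sigma> u h k"
    "\<And>e u. u \<in> ball 0 r \<Longrightarrow> (\<And>v k. v \<in> ball 0 r \<Longrightarrow> \<sigma> v k e = 0) \<Longrightarrow> \<alpha> u e = 0"
proof -
  note hi = homotopy_integrand[OF \<sigma>]
  let ?W = "{p :: real \<times> 'a. fst p *\<^sub>R snd p \<in> ball 0 r}"
  define g where "g p = fst p *\<^sub>R \<sigma> (fst p *\<^sub>R snd p) (snd p)" for p :: "real \<times> 'a"
  have g: "smooth_on ?W g" unfolding g_def[abs_def]
    by (intro smooth_on_scaleR smooth_on_bilinear[OF bounded_bilinear_blinfun_apply] hi
        smooth_on_linear[OF bounded_linear_snd] smooth_on_linear[OF bounded_linear_fst])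
  define \<alpha> where "\<alpha> u = integral {0..1} (\<lambda>t. g (t, u))" for u
  have gint: "(\<lambda>t. g (t, u)) integrable_on {0..1}" if "u \<in> ball 0 r" for u
    by (rule integrable_continuous_interval, rule continuous_on_compose2[OF smooth_on_continuous[OF g]])
      (use scaleR_ball[OF _ that] in \<open>auto intro!: continuous_intros simp del: mem_ball atLeastAtMost_iff\<close>)
  have dint: "(\<lambda>t. fd g (t, u) (0, h)) integrable_on {0..1}" if "u \<in> ball 0 r" for u h
    by (rule integrable_continuous_interval, rule continuous_on_compose2[OF smooth_on_continuous[OF smooth_on_fd[OF g]]])
      (use scaleR_ball[OF _ that] in \<open>auto intro!: continuous_intros simp del: mem_ball atLeastAtMost_iff\<close>)
  have app: "blinfun_apply (integral {0..1} f) k = integral {0..1} (\<lambda>t. f t k)"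
    if "f integrable_on {0..1}" for f :: "real \<Rightarrow> 'a \<Rightarrow>\<^sub>L real" and k
    using integral_linear[OF that blinfun.bounded_linear_left, of k] by (simp add: comp_def)
  have fd\<alpha>: "fd \<alpha> u h = integral {0..1} (\<lambda>t. fd g (t, u) (0, h))" if "u \<in> ball 0 r" for u h
    unfolding \<alpha>_def[abs_def] by (rule fd_parameter_integral[OF hi(1) open_ball hi(2) g that])
  have fdg: "fd g (t, u) (0, h) = t *\<^sub>R (\<sigma> (t *\<^sub>R u) h + t *\<^sub>R fd \<sigma> (t *\<^sub>R u) h u)"
    if t: "t \<in> {0..1}" and u: "u \<in> ball 0 r" for t u h
  proof -
    have tu: "t *\<^sub>R u \<in> ball 0 r" by (rule scaleR_ball[OF t u])
    have "((\<lambda>p. \<sigma> (fst p *\<^sub>R snd p) (snd p)) has_derivative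
        (\<lambda>d. \<sigma> (t *\<^sub>R u) (snd d) + fd \<sigma> (t *\<^sub>R u) (fst d *\<^sub>R u + t *\<^sub>R snd d) u)) (at (t, u))"
      using blinfun.FDERIV[OF hi(4)[of "(t, u)"] has_derivative_snd[OF has_derivative_ident]] tu by simp
    from has_derivative_scaleR[OF has_derivative_fst[OF has_derivative_ident] this]
    have "(g has_derivative (\<lambda>d. t *\<^sub>R (\<sigma> (t *\<^sub>R u) (snd d) + fd \<sigma> (t *\<^sub>R u) (fst d *\<^sub>R u + t *\<^sub>R snd d) u)
        + fst d *\<^sub>R \<sigma> (t *\<^sub>R u) u)) (at (t, u))"
      unfolding g_def[abs_def] by simp
    then show ?thesis
      using linear_scale[OF smooth_on_linear_fd[OF \<sigma> tu]] by (simp add: fd_eqI blinfun.scaleR_left)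
  qed
  show thesis
  proof (rule that)
    show "smooth_on (ball 0 r) \<alpha>"
      unfolding \<alpha>_def[abs_def] by (rule smooth_on_parameter_integral[OF hi(1) open_ball hi(2) g])
    show "\<alpha> 0 = 0" by (simp add: \<alpha>_def g_def blinfun.zero_right)
    have 0: "(0::'a) \<in> ball 0 r" using r by simp
    show "fd \<alpha> 0 h = 0" for h
    proof -
      have "integral {0..1} (\<lambda>t. fd g (t, 0) (0, h)) = integral {0..1} (\<lambda>t::real. 0 :: 'a \<Rightarrow>\<^sub>L real)"
        by (rule integral_cong) (simp only: fdg[OF _ 0], simp add: \<sigma>0 blinfun.zero_left blinfun.zero_right)
      then show ?thesis by (simp add: fd\<alpha>[OF 0])
    qed
    show "\<alpha> u e = 0" if u: "u \<in> ball 0 r" and e: "\<And>v k. v \<in> ball 0 r \<Longrightarrow> \<sigma> v k e = 0" for u e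
    proof -
      have "integral {0..1} (\<lambda>t. g (t, u) e) = integral {0..1} (\<lambda>t::real. 0 :: real)"
        by (rule integral_cong) (simp add: g_def blinfun.scaleR_left e[OF scaleR_ball[OF _ u]] del: atLeastAtMost_iff)
      then show ?thesis by (simp add: \<alpha>_def app[OF gint[OF u]])
    qed
    show "fd \<alpha> u h k - fd \<alpha> u k h = \<sigma> u h k" if u: "u \<in> ball 0 r" for u h k
    proof -
      have int: "(\<lambda>t. fd g (t, u) (0, h) k) integrable_on {0..1}" for h k :: 'a
        using integrable_linear[OF dint[OF u] blinfun.bounded_linear_left, of h k] integrable_linear[OF dint[OF u] blinfun.bounded_linear_left, of k h] by (simp add: comp_def)
      have "fd \<alpha> u h k - fd \<alpha> u k h = integral {0..1} (\<lambda>t. fd g (t, u) (0, h) k - fd g (t, u) (0, k) h)"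
        by (simp add: fd\<alpha>[OF u] app[OF dint[OF u]] integral_diff[OF int int])
      \<comment> \<open>The new integrand is the \<open>t\<close>-derivative of
        \<open>t\<^sup>2 * \<sigma> (t *\<^sub>R u) h k\<close>: closedness trades the derivatives
        in directions \<open>h\<close> and \<open>k\<close> for the radial one, and alternation
        doubles the undifferentiated term.\<close>
      also have "\<dots> = integral {0..1} (\<lambda>t. t\<^sup>2 * fd \<sigma> (t *\<^sub>R u) u h k + 2 * t * \<sigma> (t *\<^sub>R u) h k)"
      proof (rule integral_cong)
        fix t :: real assume t: "t \<in> {0..1}"
        have tu: "t *\<^sub>R u \<in> ball 0 r" by (rule scaleR_ball[OF t u])
        have "\<sigma> (t *\<^sub>R u) k h = - \<sigma> (t *\<^sub>R u) h k"
          using alt[OF tu, of "h + k"] alt[OF tu, of h] alt[OF tu, of k]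
          by (simp add: blinfun.add_left blinfun.add_right)
        moreover have "fd \<sigma> (t *\<^sub>R u) h u k - fd \<sigma> (t *\<^sub>R u) k u h = fd \<sigma> (t *\<^sub>R u) u h k"
          using cl[OF tu, of h u k] fd_blinfun_alternating[OF open_ball \<sigma> alt tu, of k h u] by simp
        ultimately show "fd g (t, u) (0, h) k - fd g (t, u) (0, k) h = t\<^sup>2 * fd \<sigma> (t *\<^sub>R u) u h k + 2 * t * \<sigma> (t *\<^sub>R u) h k"
          by (simp add: fdg[OF t u] blinfun.scaleR_left blinfun.add_left algebra_simps power2_eq_square)
      qed
      also have "\<dots> = 1\<^sup>2 * \<sigma> (1 *\<^sub>R u) h k - 0\<^sup>2 * \<sigma> (0 *\<^sub>R u) h k"
      proof (rule integral_unique, rule fundamental_theorem_of_calculus)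
        fix t :: real assume t: "t \<in> {0..1}"
        have 1: "((\<lambda>t. \<sigma> (t *\<^sub>R u) h k) has_vector_derivative fd \<sigma> (t *\<^sub>R u) u h k) (at t within {0..1})"
          by (intro bounded_linear.has_vector_derivative[OF blinfun.bounded_linear_left]
              scaled_ray_has_vector_derivative[OF \<sigma> u t])
        have 2: "((\<lambda>t. t\<^sup>2) has_vector_derivative 2 * t) (at t within {0..1})"
          by (auto intro!: derivative_eq_intros simp: has_real_derivative_iff_has_vector_derivative[symmetric])
        show "((\<lambda>t. t\<^sup>2 * \<sigma> (t *\<^sub>R u) h k) has_vector_derivative
            t\<^sup>2 * fd \<sigma> (t *\<^sub>R u) u h k + 2 * t * \<sigma> (t *\<^sub>R u) h k) (at t within {0..1})"
          using has_vector_derivative_mult[OF 2 1] by simp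
      qed simp
      finally show ?thesis by simp
    qed
  qed
qed

section \<open>The local normal form\<close>

lemma blinfun_alternating:
  fixes w :: "'a::real_normed_vector \<Rightarrow>\<^sub>L 'a \<Rightarrow>\<^sub>L real"
  assumes "\<And>h. w h h = 0" shows "w h k = - w k h"
  using assms[of "h + k"] assms[of h] assms[of k] by (simp add: blinfun.add_left blinfun.add_right)

lemma bilinear_blinfun2: "bilinear (\<lambda>h k. blinfun_apply (blinfun_apply w h) k :: real)"
  unfolding bilinear_def by (auto intro!: linearI simp: blinfun.bilinear_simps)

text \<open>Cartan's formula \<open>L\<^sub>X w = d (i\<^sub>X w)\<close> for a closed form \<open>w\<close>, in terms of first order jets at a point:
  \<open>dw\<close>, \<open>X'\<close> and \<open>\<beta>'\<close> are the derivatives of \<open>w\<close>, \<open>X\<close> and \<open>i\<^sub>X w\<close>.\<close>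

lemma cartan_formula:
  fixes w :: "'a::real_normed_vector \<Rightarrow>\<^sub>L 'a \<Rightarrow>\<^sub>L real"
  assumes alt: "\<And>h. w h h = 0" and dalt: "\<And>d h k. dw d h k = - dw d k h"
    and cl: "\<And>h k l. dw h k l - dw k h l + dw l h k = (0::real)"
    and \<beta>: "\<And>d k. \<beta>' d k = dw d X k + w (X' d) k"
  shows "dw X a b + w (X' a) b + w a (X' b) = \<beta>' a b - \<beta>' b a"
  using cl[of a X b] dalt[of b a X] blinfun_alternating[OF alt, of a "X' b"] by (simp add: \<beta>)

lemma zero_derivative_endpoints:
  fixes f :: "real \<Rightarrow> 'a::real_normed_vector"
  assumes "\<And>t. t \<in> {0..1} \<Longrightarrow> (f has_vector_derivative 0) (at t within {0..1})"
  shows "f 1 = f 0"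
proof -
  obtain c where "\<And>t. t \<in> {0..1} \<Longrightarrow> f t = c"
    by (rule has_vector_derivative_zero_constant[OF convex_real_interval(5) assms]) (assumption, (rule that; assumption))
  then show ?thesis by simp
qed

text \<open>Applied with \<open>A\<close> and \<open>B\<close> the images of two tangent vectors
  under the differential of a flow: the last hypothesis is then the vanishing of the time derivative
  of the pulled back form.\<close>

lemma pairing_constant:
  fixes \<Omega> :: "real \<Rightarrow> 'a::real_normed_vector \<Rightarrow>\<^sub>L 'a \<Rightarrow>\<^sub>L real"
  assumes "\<And>t. t \<in> {0..1} \<Longrightarrow> (\<Omega> has_vector_derivative \<Omega>' t) (at t within {0..1})"
    and "\<And>t. t \<in> {0..1} \<Longrightarrow> (A has_vector_derivative A' t) (at t within {0..1})"
    and "\<And>t. t \<in> {0..1} \<Longrightarrow> (B has_vector_derivative B' t) (at t within {0..1})"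
    and "\<And>t. t \<in> {0..1} \<Longrightarrow> \<Omega>' t (A t) (B t) + \<Omega> t (A' t) (B t) + \<Omega> t (A t) (B' t) = 0"
  shows "\<Omega> 1 (A 1) (B 1) = \<Omega> 0 (A 0) (B 0)"
proof (rule zero_derivative_endpoints[of "\<lambda>t. \<Omega> t (A t) (B t)"])
    fix t :: real assume t: "t \<in> {0..1}"
    note hv = bounded_bilinear.has_vector_derivative[OF bounded_bilinear_blinfun_apply]
    show "((\<lambda>t. \<Omega> t (A t) (B t)) has_vector_derivative 0) (at t within {0..1})"
      using hv[OF hv[OF assms(1)[OF t] assms(2)[OF t]] assms(3)[OF t]] assms(4)[OF t]
      by (simp add: blinfun.add_left algebra_simps)
qed

lemma curve_has_vector_derivative:
  assumes "smooth_on V F" "c t \<in> V" "(c has_vector_derivative c') (at t within S)"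
  shows "((\<lambda>t. F (c t)) has_vector_derivative fd F (c t) c') (at t within S)"
  using has_derivative_compose[OF assms(3)[unfolded has_vector_derivative_def] smooth_on_has_derivative[OF assms(1,2)]]
    linear_scale[OF smooth_on_linear_fd[OF assms(1,2)]]
  by (simp add: has_vector_derivative_def)

section \<open>The isomorphism given by a cosymplectic structure, and its Reeb field\<close>

definition riesz :: "('a::euclidean_space \<Rightarrow>\<^sub>L real) \<Rightarrow>\<^sub>L 'a" where
  "riesz = Blinfun (\<lambda>\<phi>. \<Sum>c\<in>Basis. blinfun_apply \<phi> c *\<^sub>R c)"

lemma riesz_inner: "riesz \<phi> \<bullet> k = \<phi> k"
proof -
  have bl: "bounded_linear (\<lambda>\<phi>::'a \<Rightarrow>\<^sub>L real. \<Sum>c\<in>Basis. \<phi> c *\<^sub>R c)"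
    by (intro bounded_linear_sum bounded_linear_scaleR_const[OF blinfun.bounded_linear_left])
  have "riesz \<phi> \<bullet> k = (\<Sum>c\<in>Basis. (k \<bullet> c) *\<^sub>R \<phi> c)"
    unfolding riesz_def bounded_linear_Blinfun_apply[OF bl]
    by (simp add: inner_sum_left inner_commute[of k] mult.commute)
  then show ?thesis
    using vector_Basis_expansion[OF bounded_linear.linear[OF blinfun.bounded_linear_right], of \<phi> k] by simp
qed

lemma riesz_eq_0: "riesz \<phi> = 0 \<Longrightarrow> \<phi> = 0"
  using riesz_inner[of \<phi>] by (intro blinfun_eqI) simp

text \<open>The bijection from the definition of a cosymplectic structure, sending \<open>h\<close>
  to \<open>w h + e h *\<^sub>R e\<close>. Composition with the Riesz identification makes it an
  endomorphism, so that it can be compared with the identity.\<close>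

definition flat :: "('a::euclidean_space \<Rightarrow>\<^sub>L 'a \<Rightarrow>\<^sub>L real) \<Rightarrow> ('a \<Rightarrow>\<^sub>L real) \<Rightarrow> 'a \<Rightarrow>\<^sub>L 'a" where
  "flat w e = riesz o\<^sub>L (w + (blinfun_scaleR_left e o\<^sub>L e))"

lemma flat_apply: "flat w e h = riesz (w h + e h *\<^sub>R e)"
  by (simp add: flat_def blinfun.add_left blinfun_scaleR_left.rep_eq)

lemma flat_eq_riesz_iff: "flat w e h = riesz \<phi> \<longleftrightarrow> w h + e h *\<^sub>R e = \<phi>"
  using riesz_eq_0[of "w h + e h *\<^sub>R e - \<phi>"] by (auto simp: flat_apply blinfun.diff_right)

lemma flat_eq_0D: "flat w e h = 0 \<Longrightarrow> w h k + e h * e k = 0"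
  using riesz_inner[of "w h + e h *\<^sub>R e" k] by (simp add: flat_apply blinfun.add_left blinfun.scaleR_left)

lemma smooth_on_flat:
  fixes w :: "'p::real_normed_vector \<Rightarrow> 'a::euclidean_space \<Rightarrow>\<^sub>L 'a \<Rightarrow>\<^sub>L real"
  assumes "open U" "smooth_on U w" "smooth_on U e"
  shows "smooth_on U (\<lambda>u. flat (w u) (e u))"
  unfolding flat_def
  by (intro smooth_on_bilinear[OF bounded_bilinear_blinfun_compose] smooth_on_add assms smooth_on_const
      smooth_on_bounded_linear[OF bounded_linear_blinfun_scaleR_left])

lemma near_identity_nbhd:
  fixes B :: "'p::real_normed_vector \<Rightarrow> 'a::euclidean_space \<Rightarrow>\<^sub>L 'a"
  assumes "open U" "smooth_on U B"
  shows "open {u \<in> U. norm (id_blinfun - (C o\<^sub>L B u)) < 1/2}"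
  by (rule open_less_on[OF assms(1)])
    (intro continuous_intros bounded_bilinear.continuous_on[OF bounded_bilinear_blinfun_compose]
      smooth_on_continuous[OF assms(2)])

text \<open>Odd dimension gives a nonzero kernel vector of \<open>W u\<close>. By nondegeneracy
  \<open>E u\<close> cannot annihilate it as well, so it can be normalised. The resulting field
  solves \<open>flat (W u) (E u) (R u) = riesz (E u)\<close>, and its smoothness near 0 is that of a
  solution of a linear system.\<close>

lemma reeb_field:
  fixes W :: "'a::euclidean_space \<Rightarrow> 'a \<Rightarrow>\<^sub>L 'a \<Rightarrow>\<^sub>L real" and E :: "'a \<Rightarrow> 'a \<Rightarrow>\<^sub>L real"
  assumes V: "open V" "0 \<in> V" and W: "smooth_on V W" and E: "smooth_on V E"
    and alt: "\<And>u h. u \<in> V \<Longrightarrow> W u h h = 0"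
    and nondeg: "\<And>u h. u \<in> V \<Longrightarrow> (\<And>k. W u h k + E u h * E u k = 0) \<Longrightarrow> h = 0"
    and dim: "DIM('a) = 2 * n + 1"
  obtains V1 R where "open V1" "0 \<in> V1" "V1 \<subseteq> V" "smooth_on V1 R"
    "\<And>u. u \<in> V1 \<Longrightarrow> W u (R u) = 0" "\<And>u. u \<in> V1 \<Longrightarrow> E u (R u) = 1"
proof -
  have "\<exists>v. W u v = 0 \<and> E u v = 1" if u: "u \<in> V" for u
  proof -
    obtain v where v: "v \<noteq> 0" "\<And>k. W u v k = 0"
      using alternating_odd_kernel[OF bilinear_blinfun2 alt[OF u] dim] by blast
    then have "E u v \<noteq> 0" using nondeg[OF u, of v] by auto
    then have "E u (v /\<^sub>R E u v) = 1" "W u (v /\<^sub>R E u v) = 0"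
      using v(2) by (auto simp: blinfun.scaleR_right blinfun.scaleR_left intro!: blinfun_eqI)
    then show ?thesis by blast
  qed
  then obtain R where R: "\<And>u. u \<in> V \<Longrightarrow> W u (R u) = 0" "\<And>u. u \<in> V \<Longrightarrow> E u (R u) = 1" by metis
  define B where "B u = flat (W u) (E u)" for u
  have B: "smooth_on V B" unfolding B_def[abs_def] by (rule smooth_on_flat[OF V(1) W E])
  have "h = 0" if "B 0 h = 0" for h
    by (rule nondeg[OF V(2)]) (use flat_eq_0D that in \<open>simp add: B_def\<close>)
  then obtain C where C: "C o\<^sub>L B 0 = id_blinfun" using injective_blinfun_inverse by metis
  define V1 where "V1 = {u \<in> V. norm (id_blinfun - (C o\<^sub>L B u)) < 1/2}"
  have V1: "open V1" "0 \<in> V1" "V1 \<subseteq> V"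
    using near_identity_nbhd[OF V(1) B, of C] V(2) C by (auto simp: V1_def)
  have "smooth_on V1 R"
  proof (rule smooth_on_linear_system[OF V1(1) smooth_on_subset[OF B V1(3)]])
    show "smooth_on V1 (\<lambda>u. riesz (E u))"
      by (rule smooth_on_bounded_linear[OF blinfun.bounded_linear_right V1(1) smooth_on_subset[OF E V1(3)]])
    show "B u (R u) = riesz (E u)" if "u \<in> V1" for u
      using R V1(3) that unfolding B_def flat_eq_riesz_iff by auto
    show "norm (id_blinfun - (C o\<^sub>L B u)) \<le> 1/2" if "u \<in> V1" for u using that by (simp add: V1_def)
  qed
  then show ?thesis using that V1 R by blast
qed

text \<open>The map \<open>\<psi>\<close> follows the flow of \<open>R\<close> from the point \<open>P u\<close> of a transversal hyperplane until the
  function \<open>z\<close> reaches the value \<open>E 0 u\<close>. The flow time depends on \<open>u\<close>, but this does not affect the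
  pullback of \<open>W\<close>, since \<open>W\<close> annihilates \<open>R\<close>.\<close>

lemma flow_box:
  fixes W :: "'a::euclidean_space \<Rightarrow> 'a \<Rightarrow>\<^sub>L 'a \<Rightarrow>\<^sub>L real" and E :: "'a \<Rightarrow> 'a \<Rightarrow>\<^sub>L real"
  assumes V: "open V" "0 \<in> V" and W: "smooth_on V W" and R: "smooth_on V R" and z: "smooth_on V z"
    and alt: "\<And>u h. u \<in> V \<Longrightarrow> W u h h = 0"
    and cl: "\<And>u h k l. u \<in> V \<Longrightarrow> fd W u h k l - fd W u k h l + fd W u l h k = 0"
    and WR: "\<And>u. u \<in> V \<Longrightarrow> W u (R u) = 0" and ER: "\<And>u. u \<in> V \<Longrightarrow> E u (R u) = 1"
    and dz: "\<And>u h. u \<in> V \<Longrightarrow> fd z u h = E u h" and z0: "z 0 = 0"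
    and P_def: "P = (\<lambda>u. u - E 0 u *\<^sub>R R 0)"
  obtains U \<psi> where "open U" "0 \<in> U" "smooth_on U \<psi>" "\<psi> 0 = 0" "\<psi> ` U \<subseteq> V" "P ` U \<subseteq> V"
    "\<And>u. u \<in> U \<Longrightarrow> z (\<psi> u) = E 0 u"
    "\<And>u h k. u \<in> U \<Longrightarrow> W (\<psi> u) (fd \<psi> u h) (fd \<psi> u k) = W (P u) (P h) (P k)"
proof -
  have blP: "bounded_linear P" unfolding P_def
    by (intro bounded_linear_sub bounded_linear_ident bounded_linear_scaleR_const blinfun.bounded_linear_right)
  have P0: "P 0 = 0" by (simp add: P_def blinfun.zero_right)
  have fdP: "fd P u = P" for u by (rule fd_eqI[OF bounded_linear_imp_has_derivative[OF blP]])
  define V0 where "V0 = P -` V"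
  have V0: "open V0" "0 \<in> V0" "P ` V0 \<subseteq> V"
    using V P0 open_vimage[OF V(1)] linear_continuous_on[OF blP] by (auto simp: V0_def)
  have sP: "smooth_on V0 P" by (rule smooth_on_linear[OF blP V0(1)])
  \<comment> \<open>Along \<open>R\<close> the function \<open>z\<close> grows at unit rate, so
    \<open>\<tau> u\<close> is the time needed from \<open>P u\<close> to the level
    \<open>E 0 u\<close>.\<close>
  define \<tau> where "\<tau> u = E 0 u - z (P u)" for u
  have \<tau>: "smooth_on V0 \<tau>" unfolding \<tau>_def[abs_def]
    by (intro smooth_on_diff V0 smooth_on_linear[OF blinfun.bounded_linear_right]
        smooth_on_compose[OF V0(1) V(1) V0(3) z] sP)
  have \<tau>0: "\<tau> 0 = 0" by (simp add: \<tau>_def P0 z0 blinfun.zero_right)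
  define D where "D = (UNIV :: real set) \<times> V0 \<times> V"
  have D: "open D" unfolding D_def by (intro open_Times V V0 open_UNIV)
  \<comment> \<open>Rescaling by \<open>\<tau> u\<close> reduces all travel times to 1. As
    \<open>\<tau> 0 = 0\<close>, the field and its derivative in the state vanish at parameter
    0.\<close>
  define f where "f p = \<tau> (fst (snd p)) *\<^sub>R R (snd (snd p))" for p :: "real \<times> 'a \<times> 'a"
  note bl2 = bounded_linear_compose[OF bounded_linear_fst bounded_linear_snd]
    bounded_linear_compose[OF bounded_linear_snd bounded_linear_snd]
  have f: "smooth_on D f" unfolding f_def[abs_def]
  proof (intro smooth_on_scaleR D)
    show "smooth_on D (\<lambda>p. \<tau> (fst (snd p)))"
      by (rule smooth_on_compose[OF D V0(1) _ \<tau> smooth_on_linear[OF bl2(1) D]]) (auto simp: D_def)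
    show "smooth_on D (\<lambda>p. R (snd (snd p)))"
      by (rule smooth_on_compose[OF D V(1) _ R smooth_on_linear[OF bl2(2) D]]) (auto simp: D_def)
  qed
  have fdf: "fd f (t, u, v) (0, h, k) = \<tau> u *\<^sub>R fd R v k + fd \<tau> u h *\<^sub>R R v"
    if "u \<in> V0" "v \<in> V" for t u v h k
  proof -
    have "((\<lambda>p. \<tau> (fst (snd p))) has_derivative (\<lambda>d. fd \<tau> u (fst (snd d)))) (at (t, u, v))"
      using has_derivative_compose[OF bounded_linear_imp_has_derivative[OF bl2(1)], of \<tau> "fd \<tau> u" "(t, u, v)"]
        smooth_on_has_derivative[OF \<tau> that(1)] by simp
    moreover have "((\<lambda>p. R (snd (snd p))) has_derivative (\<lambda>d. fd R v (snd (snd d)))) (at (t, u, v))"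
      using has_derivative_compose[OF bounded_linear_imp_has_derivative[OF bl2(2)], of R "fd R v" "(t, u, v)"]
        smooth_on_has_derivative[OF R that(2)] by simp
    ultimately have "(f has_derivative (\<lambda>d. \<tau> u *\<^sub>R fd R v (snd (snd d)) + fd \<tau> u (fst (snd d)) *\<^sub>R R v)) (at (t, u, v))"
      unfolding f_def[abs_def] using has_derivative_scaleR by fastforce
    then show ?thesis by (simp add: fd_eqI)
  qed
  have f0: "f (t, 0, 0) = 0" for t by (simp add: f_def \<tau>0)
  have df0: "fd f (t, 0, 0) (0, 0, k) = 0" for t k
    using fdf[OF V0(2) V(2), of t 0 k] linear_0[OF smooth_on_linear_fd[OF \<tau> V0(2)]] by (simp add: \<tau>0)
  have sub: "{0..1} \<times> {(0, 0)} \<subseteq> D" using V0 V by (auto simp: D_def)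
  obtain U \<gamma> where U: "open U" "0 \<in> U" "U \<subseteq> V0" and \<gamma>: "\<And>t. smooth_on U (\<gamma> t)"
    and \<gamma>D: "\<And>u t. u \<in> U \<Longrightarrow> t \<in> {0..1} \<Longrightarrow> (t, u, \<gamma> t u) \<in> D"
    and \<gamma>0: "\<And>u. u \<in> U \<Longrightarrow> \<gamma> 0 u = P u"
    and d\<gamma>: "\<And>u t. u \<in> U \<Longrightarrow> t \<in> {0..1} \<Longrightarrow>
      ((\<lambda>t. \<gamma> t u) has_vector_derivative f (t, u, \<gamma> t u)) (at t within {0..1})"
    and dd\<gamma>: "\<And>u t h. u \<in> U \<Longrightarrow> t \<in> {0..1} \<Longrightarrow>
      ((\<lambda>t. fd (\<gamma> t) u h) has_vector_derivative fd f (t, u, \<gamma> t u) (0, h, fd (\<gamma> t) u h)) (at t within {0..1})"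
    and \<gamma>00: "\<And>t. \<gamma> t 0 = 0"
    by (rule smooth_flow[OF D sub f V0(1,2) sP P0 f0 df0]) (rule that; assumption)
  have \<gamma>V: "\<gamma> t u \<in> V" if "u \<in> U" "t \<in> {0..1}" for t u using \<gamma>D[OF that] by (simp add: D_def)
  show thesis
  proof (rule that[OF U(1,2) \<gamma>[of 1] \<gamma>00])
    show "\<gamma> 1 ` U \<subseteq> V" using \<gamma>V[of _ 1] by auto
    show "P ` U \<subseteq> V" using U(3) V0(3) by blast
    show "z (\<gamma> 1 u) = E 0 u" if u: "u \<in> U" for u
    proof -
      have "z (\<gamma> 1 u) - 1 * \<tau> u = z (\<gamma> 0 u) - 0 * \<tau> u"
      proof (rule zero_derivative_endpoints[of "\<lambda>t. z (\<gamma> t u) - t * \<tau> u"])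
        fix t :: real assume t: "t \<in> {0..1}"
        have "fd z (\<gamma> t u) (f (t, u, \<gamma> t u)) = \<tau> u"
          by (simp add: dz[OF \<gamma>V[OF u t]] f_def blinfun.scaleR_right ER[OF \<gamma>V[OF u t]])
        then have "((\<lambda>t. z (\<gamma> t u)) has_vector_derivative \<tau> u) (at t within {0..1})"
          using curve_has_vector_derivative[OF z \<gamma>V[OF u t] d\<gamma>[OF u t]] by simp
        moreover have "((\<lambda>t. t * \<tau> u) has_vector_derivative \<tau> u) (at t within {0..1})"
          using has_vector_derivative_mult_left[OF has_vector_derivative_id, of "\<tau> u"] by simp
        ultimately show "((\<lambda>t. z (\<gamma> t u) - t * \<tau> u) has_vector_derivative 0) (at t within {0..1})"
          using has_vector_derivative_diff by fastforce
      qed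
      then show ?thesis by (simp add: \<gamma>0[OF u] \<tau>_def)
    qed
    show "W (\<gamma> 1 u) (fd (\<gamma> 1) u h) (fd (\<gamma> 1) u k) = W (P u) (P h) (P k)" if u: "u \<in> U" for u h k
    proof -
      have "fd (\<gamma> 0) u = P" using fd_cong_open[OF U(1) u \<gamma>0] fdP by simp
      moreover have "W (\<gamma> 1 u) (fd (\<gamma> 1) u h) (fd (\<gamma> 1) u k) = W (\<gamma> 0 u) (fd (\<gamma> 0) u h) (fd (\<gamma> 0) u k)"
      proof (rule pairing_constant[OF _ dd\<gamma>[OF u] dd\<gamma>[OF u]])
        fix t :: real assume t: "t \<in> {0..1}"
        let ?v = "\<gamma> t u"
        note v = \<gamma>V[OF u t]
        have u0: "u \<in> V0" using u U(3) by blast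
        show "((\<lambda>t. W (\<gamma> t u)) has_vector_derivative fd W ?v (f (t, u, ?v))) (at t within {0..1})"
          by (rule curve_has_vector_derivative[OF W v d\<gamma>[OF u t]])
        \<comment> \<open>Differentiating \<open>W v (R v) = 0\<close> shows that the contraction of
          \<open>W\<close> with \<open>R\<close> has zero derivative, so Cartan's formula applies
          with \<open>\<beta>'\<close> equal to 0.\<close>
        have "((\<lambda>v. W v (R v)) has_derivative (\<lambda>d. W ?v (fd R ?v d) + fd W ?v d (R ?v))) (at ?v)"
          by (rule blinfun.FDERIV[OF smooth_on_has_derivative[OF W v] smooth_on_has_derivative[OF R v]])
        moreover have "((\<lambda>v. W v (R v)) has_derivative (\<lambda>d. 0)) (at ?v)"
          by (rule has_derivative_transform_within_open[OF has_derivative_const V(1) v]) (simp add: WR)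
        ultimately have "(\<lambda>d. W ?v (fd R ?v d) + fd W ?v d (R ?v)) = (\<lambda>d. 0)" by (rule has_derivative_unique)
        then have "W ?v (fd R ?v d) + fd W ?v d (R ?v) = 0" for d by (rule fun_cong)
        from arg_cong[OF this, of "\<lambda>\<phi>. blinfun_apply \<phi> _"]
        have "0 = fd W ?v d (R ?v) k + W ?v (fd R ?v d) k" for d k
          by (simp add: blinfun.add_left add.commute)
        from cartan_formula[where \<beta>'="\<lambda>d k. 0", OF alt[OF v] fd_blinfun_alternating[OF V(1) W alt v] cl[OF v] this]
        have L: "fd W ?v (R ?v) a b + W ?v (fd R ?v a) b + W ?v a (fd R ?v b) = 0" for a b by simp
        \<comment> \<open>These kill the terms with \<open>fd \<tau> u h *\<^sub>R R ?v\<close>,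
          which come from the dependence of the travel time on \<open>u\<close>; what remains is
          \<open>\<tau> u\<close> times \<open>L\<close>.\<close>
        have 1: "W ?v (R ?v) b = 0" "W ?v b (R ?v) = 0" for b
          using WR[OF v] blinfun_alternating[OF alt[OF v], of b "R ?v"] by (auto simp: blinfun.zero_left)
        show "fd W ?v (f (t, u, ?v)) (fd (\<gamma> t) u h) (fd (\<gamma> t) u k)
            + W ?v (fd f (t, u, ?v) (0, h, fd (\<gamma> t) u h)) (fd (\<gamma> t) u k)
            + W ?v (fd (\<gamma> t) u h) (fd f (t, u, ?v) (0, k, fd (\<gamma> t) u k)) = 0"
          using arg_cong[OF L, of "\<lambda>x. \<tau> u * x" "fd (\<gamma> t) u h" "fd (\<gamma> t) u k"]
          by (simp add: fdf[OF u0 v] f_def linear_scale[OF smooth_on_linear_fd[OF W v]]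
              blinfun.bilinear_simps 1 algebra_simps)
      qed
      ultimately show ?thesis by (simp add: \<gamma>0[OF u])
    qed
  qed
qed

text \<open>The field \<open>X\<close> is determined by two conditions: its contraction with the
  interpolating form is \<open>- \<alpha>\<close>, and \<open>\<zeta>\<close> annihilates it. One
  solution of the \<open>flat\<close> equation meets both, since the forms on the path and
  \<open>\<alpha>\<close> annihilate \<open>e\<close>. The second condition is what makes the flow
  preserve \<open>\<zeta>\<close>.\<close>

lemma moser:
  fixes W :: "'a::euclidean_space \<Rightarrow> 'a \<Rightarrow>\<^sub>L 'a \<Rightarrow>\<^sub>L real" and \<zeta> :: "'a \<Rightarrow>\<^sub>L real"
  assumes V: "open V" "0 \<in> V" and W: "smooth_on V W"
    and alt: "\<And>u h. u \<in> V \<Longrightarrow> W u h h = 0"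
    and cl: "\<And>u h k l. u \<in> V \<Longrightarrow> fd W u h k l - fd W u k h l + fd W u l h k = 0"
    and We: "\<And>u. u \<in> V \<Longrightarrow> W u e = 0" and \<zeta>e: "\<zeta> e = 1"
    and nondeg: "\<And>h. (\<And>k. W 0 h k + \<zeta> h * \<zeta> k = 0) \<Longrightarrow> h = 0"
  obtains U \<phi> where "open U" "0 \<in> U" "smooth_on U \<phi>" "\<phi> 0 = 0" "\<phi> ` U \<subseteq> V"
    "\<And>u. u \<in> U \<Longrightarrow> \<zeta> (\<phi> u) = \<zeta> u"
    "\<And>u h k. u \<in> U \<Longrightarrow> W (\<phi> u) (fd \<phi> u h) (fd \<phi> u k) = W 0 h k"
proof -
  obtain r where r: "r > 0" "ball 0 r \<subseteq> V" using V open_contains_ball by blast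
  have r0: "(0::'a) \<in> ball 0 r" using r by simp
  define \<sigma> where "\<sigma> u = W u - W 0" for u
  have \<sigma>: "smooth_on (ball 0 r) \<sigma>" unfolding \<sigma>_def[abs_def]
    by (intro smooth_on_diff open_ball smooth_on_subset[OF W r(2)] smooth_on_const)
  have fd\<sigma>: "fd \<sigma> u = fd W u" if "u \<in> ball 0 r" for u
    unfolding \<sigma>_def[abs_def]
    using has_derivative_diff[OF smooth_on_has_derivative[OF W] has_derivative_const] that r(2)
    by (intro fd_eqI) auto
  have \<sigma>alt: "\<sigma> u h h = 0" if "u \<in> ball 0 r" for u h
    using alt that r(2) V(2) by (auto simp: \<sigma>_def blinfun.diff_left)
  have \<sigma>cl: "fd \<sigma> u h k l - fd \<sigma> u k h l + fd \<sigma> u l h k = 0" if "u \<in> ball 0 r" for u h k l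
    unfolding fd\<sigma>[OF that] using cl that r(2) by blast
  have \<sigma>0: "\<sigma> 0 = 0" by (simp add: \<sigma>_def)
  obtain \<alpha> :: "'a \<Rightarrow> 'a \<Rightarrow>\<^sub>L real" where \<alpha>: "smooth_on (ball 0 r) \<alpha>" and \<alpha>0: "\<alpha> 0 = 0" "\<And>h. fd \<alpha> 0 h = 0"
    and d\<alpha>: "\<And>u h k. u \<in> ball 0 r \<Longrightarrow> fd \<alpha> u h k - fd \<alpha> u k h = \<sigma> u h k"
    and \<alpha>e: "\<And>e u. u \<in> ball 0 r \<Longrightarrow> (\<And>v k. v \<in> ball 0 r \<Longrightarrow> \<sigma> v k e = 0) \<Longrightarrow> \<alpha> u e = 0"
  proof (rule poincare_two_form[OF \<sigma> \<sigma>alt \<sigma>cl \<sigma>0 r(1)], assumption, assumption)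
    fix \<alpha> :: "'a \<Rightarrow> 'a \<Rightarrow>\<^sub>L real"
    assume "smooth_on (ball 0 r) \<alpha>" "\<alpha> 0 = 0" "\<And>h. fd \<alpha> 0 h = 0"
      "\<And>u h k. u \<in> ball 0 r \<Longrightarrow> fd \<alpha> u h k - fd \<alpha> u k h = \<sigma> u h k"
      "\<And>e u. u \<in> ball 0 r \<Longrightarrow> (\<And>v k. v \<in> ball 0 r \<Longrightarrow> \<sigma> v k e = 0) \<Longrightarrow> \<alpha> u e = 0"
    then show thesis by (rule that[of \<alpha>])
  qed
  have Wke: "W u k e = 0" if "u \<in> ball 0 r" for u k
    using blinfun_alternating[OF alt, of u k e] We that r(2) by (auto simp: blinfun.zero_left)
  have \<alpha>e0: "\<alpha> u e = 0" if "u \<in> ball 0 r" for u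
    by (rule \<alpha>e[OF that]) (simp add: \<sigma>_def blinfun.diff_left Wke Wke[OF r0] del: mem_ball)
  define D0 where "D0 = (UNIV :: real set) \<times> ball (0::'a) r"
  have D0: "open D0" unfolding D0_def by (intro open_Times open_UNIV open_ball)
  define Wt where "Wt p = W 0 + fst p *\<^sub>R \<sigma> (snd p)" for p :: "real \<times> 'a"
  have sn: "smooth_on D0 (\<lambda>p. F (snd p))" if "smooth_on (ball 0 r) F" for F :: "'a \<Rightarrow> 'c::real_normed_vector"
    by (rule smooth_on_compose[OF D0 open_ball _ that smooth_on_linear[OF bounded_linear_snd D0]]) (auto simp: D0_def)
  have Wt: "smooth_on D0 Wt" unfolding Wt_def[abs_def]
    by (intro smooth_on_add D0 smooth_on_const smooth_on_scaleR smooth_on_linear[OF bounded_linear_fst] sn \<sigma>)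
  define B where "B p = flat (Wt p) \<zeta>" for p
  have B: "smooth_on D0 B" unfolding B_def[abs_def] by (rule smooth_on_flat[OF D0 Wt smooth_on_const])
  have B0: "B (t, 0) = flat (W 0) \<zeta>" for t by (simp add: B_def Wt_def \<sigma>0)
  have "h = 0" if "flat (W 0) \<zeta> h = 0" for h
    by (rule nondeg) (rule flat_eq_0D[OF that])
  then obtain C where C: "C o\<^sub>L flat (W 0) \<zeta> = id_blinfun" using injective_blinfun_inverse by metis
  \<comment> \<open>Where the \<open>flat\<close> operator of the path is close to its value at the
    centre, it is invertible. All points \<open>(t, 0)\<close> belong to \<open>D\<close>, as
    \<open>\<sigma> 0 = 0\<close> makes the path constant there.\<close>
  define D where "D = {p \<in> D0. norm (id_blinfun - (C o\<^sub>L B p)) < 1/2}"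
  have D: "open D" "D \<subseteq> D0" using near_identity_nbhd[OF D0 B, of C] by (auto simp: D_def)
  have tD: "(t, 0) \<in> D" for t using C r0 by (simp add: D_def D0_def B0)
  \<comment> \<open>The sign makes the Lie derivative of the path along \<open>X\<close> equal to
    the exterior derivative of \<open>- \<alpha>\<close>, that is \<open>- \<sigma>\<close>, which
    cancels the derivative of the path in \<open>t\<close>.\<close>
  define b where "b p = riesz (- \<alpha> (snd p))" for p :: "real \<times> 'a"
  have b: "smooth_on D0 b" unfolding b_def[abs_def]
    by (intro smooth_on_bounded_linear[OF blinfun.bounded_linear_right] D0 smooth_on_minus sn \<alpha>)
  have Binj: "h = 0" if "p \<in> D" "B p h = 0" for p h
    by (rule near_identity_injective[of C "B p"]) (use that in \<open>auto simp: D_def\<close>)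
  have "\<exists>x. B p x = b p" if p: "p \<in> D" for p
  proof -
    obtain C' where "B p o\<^sub>L C' = id_blinfun" using injective_blinfun_inverse[of "B p"] Binj[OF p] by metis
    then have "B p (C' (b p)) = b p" by (metis blinfun_apply_blinfun_compose id_blinfun.rep_eq)
    then show ?thesis by blast
  qed
  then obtain X where X: "\<And>p. p \<in> D \<Longrightarrow> B p (X p) = b p" by metis
  have sX: "smooth_on D X"
    by (rule smooth_on_linear_system[where C=C, OF D(1) smooth_on_subset[OF B D(2)] smooth_on_subset[OF b D(2)] X])
      (auto simp: D_def)
  have WX: "Wt p (X p) = - \<alpha> (snd p)" and \<zeta>X: "\<zeta> (X p) = 0" if p: "p \<in> D" for p
  proof -
    have eq: "Wt p (X p) + \<zeta> (X p) *\<^sub>R \<zeta> = - \<alpha> (snd p)"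
      using X[OF p] unfolding B_def b_def flat_eq_riesz_iff .
    have pr: "snd p \<in> ball 0 r" using p D(2) by (auto simp: D0_def)
    \<comment> \<open>Evaluating the \<open>flat\<close> equation at \<open>e\<close> isolates
      \<open>\<zeta> (X p)\<close>, because \<open>Wt p (X p)\<close> and
      \<open>\<alpha> (snd p)\<close> vanish on \<open>e\<close> and
      \<open>\<zeta> e = 1\<close>.\<close>
    have "Wt p (X p) e = 0"
      by (simp add: Wt_def blinfun.add_left blinfun.scaleR_left \<sigma>_def blinfun.diff_left Wke[OF pr] Wke[OF r0])
    then show "\<zeta> (X p) = 0"
      using arg_cong[OF eq, of "\<lambda>\<phi>. blinfun_apply \<phi> e"] \<alpha>e0[OF pr]
      by (simp add: blinfun.add_left blinfun.scaleR_left blinfun.minus_left \<zeta>e)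
    then show "Wt p (X p) = - \<alpha> (snd p)" using eq by simp
  qed
  have X0: "X (t, 0) = 0" for t
  proof (rule Binj[OF tD])
    show "B (t, 0) (X (t, 0)) = 0" using X[OF tD, of t] by (simp add: b_def \<alpha>0 blinfun.zero_right)
  qed
  \<comment> \<open>The equation \<open>B p (X p) = b p\<close> is differentiated at
    \<open>(t, 0)\<close>: the term with \<open>fd B\<close> is applied to
    \<open>X (t, 0) = 0\<close>, and the derivative of \<open>b\<close> vanishes with
    \<open>fd \<alpha> 0\<close>, so injectivity of \<open>B (t, 0)\<close> finishes.\<close>
  have dX0: "fd X (t, 0) (0, k) = 0" for t k
  proof (rule Binj[OF tD])
    have "((\<lambda>p. B p (X p)) has_derivative (\<lambda>d. B (t, 0) (fd X (t, 0) d) + fd B (t, 0) d (X (t, 0)))) (at (t, 0))"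
      by (rule blinfun.FDERIV[OF smooth_on_has_derivative[OF B] smooth_on_has_derivative[OF sX tD]])
        (use tD D(2) in auto)
    then have 1: "(b has_derivative (\<lambda>d. B (t, 0) (fd X (t, 0) d) + fd B (t, 0) d (X (t, 0)))) (at (t, 0))"
      by (rule has_derivative_transform_within_open[OF _ D(1) tD X])
    have "((\<lambda>p. \<alpha> (snd p)) has_derivative (\<lambda>d. fd \<alpha> 0 (snd d))) (at (t, 0))"
      using has_derivative_compose[OF bounded_linear_imp_has_derivative[OF bounded_linear_snd], of \<alpha> "fd \<alpha> 0" "(t, 0)"]
        smooth_on_has_derivative[OF \<alpha> r0] by simp
    then have 2: "(b has_derivative (\<lambda>d. riesz (- fd \<alpha> 0 (snd d)))) (at (t, 0))"
      unfolding b_def[abs_def]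
      by (intro bounded_linear.has_derivative[OF blinfun.bounded_linear_right] has_derivative_minus)
    from fun_cong[OF has_derivative_unique[OF 1 2], of "(0, k)"]
    show "B (t, 0) (fd X (t, 0) (0, k)) = 0" by (simp add: X0 \<alpha>0 blinfun.zero_right)
  qed
  define f where "f p = X (fst p, snd (snd p))" for p :: "real \<times> 'a \<times> 'a"
  have blj: "bounded_linear (\<lambda>p :: real \<times> 'a \<times> 'a. (fst p, snd (snd p)))"
    by (intro bounded_linear_Pair bounded_linear_fst bounded_linear_compose[OF bounded_linear_snd bounded_linear_snd])
  define D' where "D' = (\<lambda>p :: real \<times> 'a \<times> 'a. (fst p, snd (snd p))) -` D"
  have D': "open D'" unfolding D'_def by (rule open_vimage[OF D(1) linear_continuous_on[OF blj]])
  have f: "smooth_on D' f" unfolding f_def[abs_def]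
    by (rule smooth_on_compose[OF D' D(1) _ sX smooth_on_linear[OF blj D']]) (auto simp: D'_def)
  have fdf: "fd f (t, u, v) (0, h, k) = fd X (t, v) (0, k)" if "(t, v) \<in> D" for t u v h k
  proof -
    have "(f has_derivative (\<lambda>d. fd X (t, v) (fst d, snd (snd d)))) (at (t, u, v))"
      unfolding f_def[abs_def]
      using has_derivative_compose[OF bounded_linear_imp_has_derivative[OF blj], of X "fd X (t, v)" "(t, u, v)"]
        smooth_on_has_derivative[OF sX that] by simp
    then show ?thesis by (simp add: fd_eqI)
  qed
  have sub: "{0..1} \<times> {(0, 0)} \<subseteq> D'" using tD by (auto simp: D'_def)
  have f0: "f (t, 0, 0) = 0" for t by (simp add: f_def X0)
  have df0: "fd f (t, 0, 0) (0, 0, k) = 0" for t k by (simp add: fdf[OF tD] dX0)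
  obtain U \<gamma> where U: "open U" "0 \<in> U" and \<gamma>: "\<And>t. smooth_on U (\<gamma> t)"
    and \<gamma>D: "\<And>u t. u \<in> U \<Longrightarrow> t \<in> {0..1} \<Longrightarrow> (t, u, \<gamma> t u) \<in> D'"
    and \<gamma>0: "\<And>u. u \<in> U \<Longrightarrow> \<gamma> 0 u = u"
    and d\<gamma>: "\<And>u t. u \<in> U \<Longrightarrow> t \<in> {0..1} \<Longrightarrow>
      ((\<lambda>t. \<gamma> t u) has_vector_derivative f (t, u, \<gamma> t u)) (at t within {0..1})"
    and dd\<gamma>: "\<And>u t h. u \<in> U \<Longrightarrow> t \<in> {0..1} \<Longrightarrow>
      ((\<lambda>t. fd (\<gamma> t) u h) has_vector_derivative fd f (t, u, \<gamma> t u) (0, h, fd (\<gamma> t) u h)) (at t within {0..1})"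
    and \<gamma>00: "\<And>t. \<gamma> t 0 = 0"
    by (rule smooth_flow[OF D' sub f open_UNIV UNIV_I smooth_on_id[OF open_UNIV] refl f0 df0]) (rule that; assumption)
  have tv: "(t, \<gamma> t u) \<in> D" if "u \<in> U" "t \<in> {0..1}" for t u using \<gamma>D[OF that] by (simp add: D'_def)
  have vr: "\<gamma> t u \<in> ball 0 r" if "u \<in> U" "t \<in> {0..1}" for t u using tv[OF that] D(2) by (auto simp: D0_def)
  show thesis
  proof (rule that[OF U \<gamma>[of 1] \<gamma>00])
    show "\<gamma> 1 ` U \<subseteq> V" using vr[of _ 1] r(2) by auto
    show "\<zeta> (\<gamma> 1 u) = \<zeta> u" if u: "u \<in> U" for u
    proof -
      have "\<zeta> (\<gamma> 1 u) = \<zeta> (\<gamma> 0 u)"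
      proof (rule zero_derivative_endpoints[of "\<lambda>t. \<zeta> (\<gamma> t u)"])
        fix t :: real assume t: "t \<in> {0..1}"
        show "((\<lambda>t. \<zeta> (\<gamma> t u)) has_vector_derivative 0) (at t within {0..1})"
          using bounded_linear.has_vector_derivative[OF blinfun.bounded_linear_right d\<gamma>[OF u t], of \<zeta>]
          by (simp add: f_def \<zeta>X[OF tv[OF u t]])
      qed
      then show ?thesis by (simp add: \<gamma>0[OF u])
    qed
    show "W (\<gamma> 1 u) (fd (\<gamma> 1) u h) (fd (\<gamma> 1) u k) = W 0 h k" if u: "u \<in> U" for u h k
    proof -
      have "fd (\<gamma> 0) u = (\<lambda>h. h)"
        using fd_cong_open[OF U(1) u \<gamma>0] by (simp add: fd_eqI[OF has_derivative_ident])
      moreover have "(W 0 + 1 *\<^sub>R \<sigma> (\<gamma> 1 u)) (fd (\<gamma> 1) u h) (fd (\<gamma> 1) u k)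
          = (W 0 + 0 *\<^sub>R \<sigma> (\<gamma> 0 u)) (fd (\<gamma> 0) u h) (fd (\<gamma> 0) u k)"
      proof (rule pairing_constant[OF _ dd\<gamma>[OF u] dd\<gamma>[OF u]])
        fix t :: real assume t: "t \<in> {0..1}"
        let ?v = "\<gamma> t u"
        let ?X = "X (t, ?v)"
        note v = vr[OF u t]
        have fX: "f (t, u, ?v) = ?X" by (simp add: f_def)
        have "((\<lambda>t. t *\<^sub>R \<sigma> (\<gamma> t u)) has_vector_derivative (t *\<^sub>R fd \<sigma> ?v ?X + 1 *\<^sub>R \<sigma> ?v)) (at t within {0..1})"
          using curve_has_vector_derivative[where F=\<sigma> and c="\<lambda>t. \<gamma> t u", OF \<sigma> v d\<gamma>[OF u t]]
          by (intro has_vector_derivative_scaleR) (auto simp: fX DERIV_ident)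
        from has_vector_derivative_add[OF has_vector_derivative_const this]
        show "((\<lambda>t. W 0 + t *\<^sub>R \<sigma> (\<gamma> t u)) has_vector_derivative (t *\<^sub>R fd \<sigma> ?v ?X + \<sigma> ?v)) (at t within {0..1})"
          by simp
        define dX where "dX d = fd X (t, ?v) (0, d)" for d
        have "((\<lambda>x. (t, x)) has_derivative (\<lambda>d. (0, d))) (at ?v)"
          by (intro has_derivative_Pair has_derivative_const has_derivative_ident)
        from has_derivative_compose[OF this smooth_on_has_derivative[OF sX tv[OF u t]]]
        have hX: "((\<lambda>x. X (t, x)) has_derivative dX) (at ?v)" unfolding dX_def[abs_def] .
        have "((\<lambda>x. W 0 + t *\<^sub>R \<sigma> x) has_derivative (\<lambda>d. t *\<^sub>R fd \<sigma> ?v d)) (at ?v)"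
          using has_derivative_add[OF has_derivative_const has_derivative_scaleR_right[OF smooth_on_has_derivative[OF \<sigma> v]]]
          by simp
        from blinfun.FDERIV[OF this hX]
        have 1: "((\<lambda>x. (W 0 + t *\<^sub>R \<sigma> x) (X (t, x))) has_derivative
            (\<lambda>d. (W 0 + t *\<^sub>R \<sigma> ?v) (dX d) + (t *\<^sub>R fd \<sigma> ?v d) ?X)) (at ?v)" .
        have o: "open (Pair t -` D)" "?v \<in> Pair t -` D"
          using tv[OF u t] by (auto intro!: open_vimage D(1) continuous_intros)
        \<comment> \<open>The relation \<open>Wt p (X p) = - \<alpha> (snd p)\<close> holds near
          \<open>?v\<close> at fixed \<open>t\<close>; its derivative supplies the
          \<open>\<beta>'\<close> of Cartan's formula.\<close>
        have "((\<lambda>x. - \<alpha> x) has_derivative (\<lambda>d. (W 0 + t *\<^sub>R \<sigma> ?v) (dX d) + (t *\<^sub>R fd \<sigma> ?v d) ?X)) (at ?v)"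
          by (rule has_derivative_transform_within_open[OF 1 o])
            (use WX in \<open>auto simp: Wt_def\<close>)
        note that' = has_derivative_unique[OF this has_derivative_minus[OF smooth_on_has_derivative[OF \<alpha> v]]]
        have \<beta>: "(- fd \<alpha> ?v d) k = (t *\<^sub>R fd \<sigma> ?v d) ?X k + (W 0 + t *\<^sub>R \<sigma> ?v) (dX d) k" for d k
          using arg_cong[OF fun_cong[OF that', of d], of "\<lambda>\<phi>. blinfun_apply \<phi> k"]
          by (simp add: blinfun.add_left add.commute)
        have walt: "(W 0 + t *\<^sub>R \<sigma> ?v) h h = 0" for h
          by (simp add: blinfun.bilinear_simps \<sigma>alt[OF v] alt[OF V(2)])
        have wdalt: "(t *\<^sub>R fd \<sigma> ?v d) h k = - (t *\<^sub>R fd \<sigma> ?v d) k h" for d h k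
          using fd_blinfun_alternating[OF open_ball \<sigma> \<sigma>alt v, of d h k] by (simp add: blinfun.bilinear_simps)
        have wcl: "(t *\<^sub>R fd \<sigma> ?v h) k l - (t *\<^sub>R fd \<sigma> ?v k) h l + (t *\<^sub>R fd \<sigma> ?v l) h k = 0" for h k l
          using arg_cong[OF \<sigma>cl[OF v, of h k l], of "\<lambda>x. t * x"] by (simp add: blinfun.bilinear_simps algebra_simps)
        from cartan_formula[where dw="\<lambda>d. t *\<^sub>R fd \<sigma> ?v d" and \<beta>'="\<lambda>d k. (- fd \<alpha> ?v d) k", OF walt wdalt wcl \<beta>, of "fd (\<gamma> t) u h" "fd (\<gamma> t) u k"]
        show "(t *\<^sub>R fd \<sigma> ?v ?X + \<sigma> ?v) (fd (\<gamma> t) u h) (fd (\<gamma> t) u k)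
            + (W 0 + t *\<^sub>R \<sigma> ?v) (fd f (t, u, ?v) (0, h, fd (\<gamma> t) u h)) (fd (\<gamma> t) u k)
            + (W 0 + t *\<^sub>R \<sigma> ?v) (fd (\<gamma> t) u h) (fd f (t, u, ?v) (0, k, fd (\<gamma> t) u k)) = 0"
          using d\<alpha>[OF v, of "fd (\<gamma> t) u h" "fd (\<gamma> t) u k"]
          by (simp add: fdf[OF tv[OF u t]] dX_def blinfun.add_left[of "t *\<^sub>R fd \<sigma> ?v ?X" "\<sigma> ?v"]
              blinfun.add_left[of "_ :: 'a \<Rightarrow>\<^sub>L real"] blinfun.minus_left)
      qed
      ultimately show ?thesis by (simp add: \<sigma>_def)
    qed
  qed
qed

text \<open>The map is \<open>\<psi>\<close> of the flow box after Moser's \<open>\<phi>\<close>.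
  For \<open>E\<close>, both maps transport the potential,
  \<open>z (\<psi> (\<phi> u)) = E 0 (\<phi> u) = E 0 u\<close>, and differentiation gives the
  claim. For \<open>W\<close>, Moser's argument is applied to the pullback of \<open>W\<close> along
  \<open>P\<close>, with \<open>e\<close> and \<open>\<zeta>\<close> taken as \<open>R 0\<close> and
  \<open>E 0\<close>.\<close>

theorem local_cosymplectic_normal_form:
  fixes W :: "'a::euclidean_space \<Rightarrow> 'a \<Rightarrow>\<^sub>L 'a \<Rightarrow>\<^sub>L real" and E :: "'a \<Rightarrow> 'a \<Rightarrow>\<^sub>L real"
  assumes V: "open V" "0 \<in> V" and W: "smooth_on V W" and E: "smooth_on V E"
    and alt: "\<And>u h. u \<in> V \<Longrightarrow> W u h h = 0"
    and clW: "\<And>u h k l. u \<in> V \<Longrightarrow> fd W u h k l - fd W u k h l + fd W u l h k = 0"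
    and clE: "\<And>u h k. u \<in> V \<Longrightarrow> fd E u h k = fd E u k h"
    and nondeg: "\<And>u h. u \<in> V \<Longrightarrow> (\<And>k. W u h k + E u h * E u k = 0) \<Longrightarrow> h = 0"
    and dim: "DIM('a) = 2 * n + 1"
  obtains U \<Theta> where "open U" "0 \<in> U" "smooth_on U \<Theta>" "\<Theta> 0 = 0" "\<Theta> ` U \<subseteq> V"
    "\<And>u h. u \<in> U \<Longrightarrow> E (\<Theta> u) (fd \<Theta> u h) = E 0 h"
    "\<And>u h k. u \<in> U \<Longrightarrow> W (\<Theta> u) (fd \<Theta> u h) (fd \<Theta> u k) = W 0 h k"
proof -
  obtain V1 R where V1: "open V1" "0 \<in> V1" "V1 \<subseteq> V" and R: "smooth_on V1 R"
    and WR: "\<And>u. u \<in> V1 \<Longrightarrow> W u (R u) = 0" and ER: "\<And>u. u \<in> V1 \<Longrightarrow> E u (R u) = 1"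
    by (rule reeb_field[OF V W E _ _ dim]) (erule alt, erule nondeg, simp, (rule that; assumption))
  obtain r where r: "r > 0" "ball 0 r \<subseteq> V1" using V1 open_contains_ball by blast
  have r0: "(0::'a) \<in> ball 0 r" using r by simp
  have rV: "ball 0 r \<subseteq> V" using r V1 by blast
  obtain z where z: "smooth_on (ball 0 r) z" "z 0 = 0" and dz: "\<And>u h. u \<in> ball 0 r \<Longrightarrow> fd z u h = E u h"
    by (rule poincare_one_form[OF smooth_on_subset[OF E rV] clE[OF subsetD[OF rV]]]) (assumption, (rule that; assumption))
  \<comment> \<open>The projection onto the kernel of \<open>E 0\<close> along \<open>R 0\<close>.
    Since \<open>W 0\<close> annihilates \<open>R 0\<close>, pulling back along \<open>P\<close>
    does not change \<open>W 0\<close>.\<close>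
  define P where "P = (\<lambda>u. u - E 0 u *\<^sub>R R 0)"
  have blP: "bounded_linear P" unfolding P_def
    by (intro bounded_linear_sub bounded_linear_ident bounded_linear_scaleR_const blinfun.bounded_linear_right)
  have P0: "P 0 = 0" by (simp add: P_def blinfun.zero_right)
  obtain U1 \<psi> where U1: "open U1" "0 \<in> U1" and \<psi>: "smooth_on U1 \<psi>" "\<psi> 0 = 0" "\<psi> ` U1 \<subseteq> ball 0 r"
    and PU1: "P ` U1 \<subseteq> ball 0 r" and z\<psi>: "\<And>u. u \<in> U1 \<Longrightarrow> z (\<psi> u) = E 0 u"
    and W\<psi>: "\<And>u h k. u \<in> U1 \<Longrightarrow> W (\<psi> u) (fd \<psi> u h) (fd \<psi> u k) = W (P u) (P h) (P k)"
  proof (rule flow_box[where W=W and E=E and R=R and z=z, OF open_ball r0 smooth_on_subset[OF W rV] smooth_on_subset[OF R r(2)] z(1)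
          alt[OF subsetD[OF rV]] clW[OF subsetD[OF rV]] WR[OF subsetD[OF r(2)]] ER[OF subsetD[OF r(2)]] dz z(2) P_def], assumption, assumption, assumption, assumption, assumption)
    fix U1 \<psi>
    assume "open U1" "0 \<in> U1" "smooth_on U1 \<psi>" "\<psi> 0 = 0" "\<psi> ` U1 \<subseteq> ball 0 r" "P ` U1 \<subseteq> ball 0 r"
      "\<And>u. u \<in> U1 \<Longrightarrow> z (\<psi> u) = E 0 u"
      "\<And>u h k. u \<in> U1 \<Longrightarrow> W (\<psi> u) (fd \<psi> u h) (fd \<psi> u k) = W (P u) (P h) (P k)"
    then show thesis by (rule that[of U1 \<psi>])
  qed
  define pull where "pull w = Blinfun (\<lambda>\<phi>. \<phi> o\<^sub>L Blinfun P) o\<^sub>L (w o\<^sub>L Blinfun P)" for w :: "'a \<Rightarrow>\<^sub>L 'a \<Rightarrow>\<^sub>L real"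
  have aP: "blinfun_apply (Blinfun P) = P" by (rule bounded_linear_Blinfun_apply[OF blP])
  have aC: "blinfun_apply (Blinfun (\<lambda>\<phi>::'a \<Rightarrow>\<^sub>L real. \<phi> o\<^sub>L Blinfun P)) = (\<lambda>\<phi>. \<phi> o\<^sub>L Blinfun P)"
    by (rule bounded_linear_Blinfun_apply[OF bounded_bilinear.bounded_linear_left[OF bounded_bilinear_blinfun_compose]])
  have pull: "pull w h k = w (P h) (P k)" for w h k by (simp add: pull_def aP aC)
  have blpull: "bounded_linear pull" unfolding pull_def[abs_def]
    by (intro bounded_linear_compose[OF bounded_bilinear.bounded_linear_right[OF bounded_bilinear_blinfun_compose]]
        bounded_bilinear.bounded_linear_left[OF bounded_bilinear_blinfun_compose])
  define W' where "W' u = pull (W (P u))" for u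
  have sP: "smooth_on U1 P" by (rule smooth_on_linear[OF blP U1(1)])
  have W': "smooth_on U1 W'" unfolding W'_def[abs_def]
    by (rule smooth_on_bounded_linear[OF blpull U1(1) smooth_on_compose[OF U1(1) open_ball PU1 smooth_on_subset[OF W rV] sP]])
  have fdW': "fd W' u d = pull (fd W (P u) (P d))" if u: "u \<in> U1" for u d
  proof -
    have "P u \<in> V" using u PU1 rV by blast
    then have "(W' has_derivative (\<lambda>d. pull (fd W (P u) (P d)))) (at u)"
      unfolding W'_def[abs_def]
      by (intro bounded_linear.has_derivative[OF blpull] has_derivative_compose[OF bounded_linear_imp_has_derivative[OF blP]]
          smooth_on_has_derivative[OF W])
    then show ?thesis by (simp add: fd_eqI)
  qed
  have PV: "P u \<in> V" if "u \<in> U1" for u using that PU1 rV by blast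
  have E0R: "E 0 (R 0) = 1" using ER V1(2) by blast
  have PR: "P (R 0) = 0" by (simp add: P_def E0R)
  have W0P: "W 0 (P h) (P k) = W 0 h k" for h k
    using WR[OF V1(2)] blinfun_alternating[OF alt[OF V(2)], of h "R 0"]
    by (simp add: P_def blinfun.bilinear_simps)
  obtain U \<phi> where U: "open U" "0 \<in> U" and \<phi>: "smooth_on U \<phi>" "\<phi> 0 = 0" "\<phi> ` U \<subseteq> U1"
    and E\<phi>: "\<And>u. u \<in> U \<Longrightarrow> E 0 (\<phi> u) = E 0 u"
    and W\<phi>: "\<And>u h k. u \<in> U \<Longrightarrow> W' (\<phi> u) (fd \<phi> u h) (fd \<phi> u k) = W' 0 h k"
  proof (rule moser[OF U1 W'])
    show "W' u h h = 0" if "u \<in> U1" for u h by (simp add: W'_def pull alt[OF PV[OF that]])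
    show "fd W' u h k l - fd W' u k h l + fd W' u l h k = 0" if "u \<in> U1" for u h k l
      by (simp add: fdW'[OF that] pull clW[OF PV[OF that]])
    show "W' u (R 0) = 0" for u by (rule blinfun_eqI) (simp add: W'_def pull PR blinfun.zero_left blinfun.zero_right)
    show "E 0 (R 0) = 1" by (rule E0R)
    show "h = 0" if "\<And>k. W' 0 h k + E 0 h * E 0 k = 0" for h
      using that by (intro nondeg[OF V(2)]) (simp add: W'_def pull P0 W0P)
  qed (rule that; assumption)
  have fd\<Theta>: "fd (\<lambda>u. \<psi> (\<phi> u)) u h = fd \<psi> (\<phi> u) (fd \<phi> u h)" if u: "u \<in> U" for u h
  proof -
    have "\<phi> u \<in> U1" using u \<phi>(3) by blast
    from has_derivative_compose[OF smooth_on_has_derivative[OF \<phi>(1) u] smooth_on_has_derivative[OF \<psi>(1) this]]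
    show ?thesis by (simp add: fd_eqI)
  qed
  have \<Theta>: "smooth_on U (\<lambda>u. \<psi> (\<phi> u))" by (rule smooth_on_compose[OF U(1) U1(1) \<phi>(3) \<psi>(1) \<phi>(1)])
  show thesis
  proof (rule that[OF U \<Theta>])
    show "\<psi> (\<phi> 0) = 0" by (simp add: \<phi>(2) \<psi>(2))
    have im: "\<phi> u \<in> U1" "\<psi> (\<phi> u) \<in> ball 0 r" if "u \<in> U" for u using that \<phi>(3) \<psi>(3) by blast+
    then show "(\<lambda>u. \<psi> (\<phi> u)) ` U \<subseteq> V" using rV by blast
    show "E (\<psi> (\<phi> u)) (fd (\<lambda>u. \<psi> (\<phi> u)) u h) = E 0 h" if u: "u \<in> U" for u h
    proof -
      have "((\<lambda>u. z (\<psi> (\<phi> u))) has_derivative (\<lambda>h. fd z (\<psi> (\<phi> u)) (fd (\<lambda>u. \<psi> (\<phi> u)) u h))) (at u)"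
        by (rule has_derivative_compose[OF smooth_on_has_derivative[OF \<Theta> u] smooth_on_has_derivative[OF z(1) im(2)[OF u]]])
      moreover have "((\<lambda>u. z (\<psi> (\<phi> u))) has_derivative blinfun_apply (E 0)) (at u)"
        by (rule has_derivative_transform_within_open[OF bounded_linear_imp_has_derivative[OF blinfun.bounded_linear_right] U(1) u])
          (simp add: z\<psi>[OF im(1)] E\<phi>)
      ultimately show ?thesis using has_derivative_unique dz[OF im(2)[OF u]] by metis
    qed
    show "W (\<psi> (\<phi> u)) (fd (\<lambda>u. \<psi> (\<phi> u)) u h) (fd (\<lambda>u. \<psi> (\<phi> u)) u k) = W 0 h k" if u: "u \<in> U" for u h k
      using W\<psi>[OF im(1)[OF u], of "fd \<phi> u h" "fd \<phi> u k"] W\<phi>[OF u, of h k]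
      by (simp add: fd\<Theta>[OF u] W'_def pull P0 W0P)
  qed
qed

section \<open>The inverse function theorem for smooth maps\<close>

text \<open>The inverse function theorem yields a differentiable local inverse with derivative
  \<open>inv (fdL f (g y))\<close>. Applied to a fixed vector, this derivative solves a linear
  system whose coefficients are as regular as \<open>g\<close>, which raises the order of
  \<open>g\<close> step by step.\<close>

theorem smooth_inverse_function:
  fixes f :: "'a::euclidean_space \<Rightarrow> 'a"
  assumes U: "open U" "u0 \<in> U" and f: "smooth_on U f"
    and inj: "\<And>h. fd f u0 h = 0 \<Longrightarrow> h = 0"
  obtains U' V g where "open U'" "U' \<subseteq> U" "u0 \<in> U'" "open V" "homeomorphism U' V f g" "smooth_on V g"
proof -
  have L: "blinfun_apply (fdL f u) = fd f u" if "u \<in> U" for u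
    using blinfun_apply_fdL[OF smooth_on_linear_fd[OF f that]] by blast
  have sL: "smooth_on U (fdL f)" by (rule smooth_on_fdL[OF f U(1)])
  obtain C where C: "C o\<^sub>L fdL f u0 = id_blinfun"
    using injective_blinfun_inverse[of "fdL f u0"] inj L[OF U(2)] by metis
  obtain U' V g g' where U': "open U'" "U' \<subseteq> U" "u0 \<in> U'" and V: "open V" and hom: "homeomorphism U' V f g"
    and g': "\<And>y. y \<in> V \<Longrightarrow> (g has_derivative (g' y)) (at y)"
    and g'_eq: "\<And>y. y \<in> V \<Longrightarrow> g' y = inv (blinfun_apply (fdL f (g y)))"
    and bij: "\<And>y. y \<in> V \<Longrightarrow> bij (blinfun_apply (fdL f (g y)))"
  proof (rule inverse_function_theorem[OF U(1) _ smooth_on_continuous[OF sL] U(2) C])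
    show "(f has_derivative blinfun_apply (fdL f x)) (at x)" if "x \<in> U" for x
      unfolding L[OF that] by (rule smooth_on_has_derivative[OF f that])
  qed (rule that; assumption)
  have gU: "g ` V \<subseteq> U" using hom U'(2) by (auto simp: homeomorphism_def)
  have "Ck_on k V g" for k
  proof (induction k)
    case 0
    show ?case using hom by (simp add: homeomorphism_def)
  next
    case (Suc k)
    show ?case
    proof (rule Ck_on_SucI'[OF V g'])
      fix h
      define B where "B y = fdL f (g y)" for y
      have B: "Ck_on k V B" unfolding B_def[abs_def]
        by (rule Ck_on_compose[OF V U(1) gU smooth_onD[OF sL] Suc])
      show "Ck_on k V (\<lambda>y. g' y h)"
      proof (rule Ck_on_open_cover)
        fix y0 assume y0: "y0 \<in> V"
        obtain C where C: "C o\<^sub>L B y0 = id_blinfun"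
          using injective_blinfun_inverse[of "B y0"] bij[OF y0] blinfun.zero_right
          unfolding B_def by (metis bij_def injD)
        \<comment> \<open>\<open>C\<close> is an exact inverse at \<open>y0\<close> and
          preconditions the system only near \<open>y0\<close>, hence the passage to an open
          cover.\<close>
        define T where "T = {y \<in> V. norm (id_blinfun - (C o\<^sub>L B y)) < 1/2}"
        have T: "open T" "T \<subseteq> V" "y0 \<in> T"
          unfolding T_def
          by (rule open_less_on[OF V], intro continuous_intros bounded_bilinear.continuous_on[OF bounded_bilinear_blinfun_compose]
              Ck_on_continuous[OF B]) (use y0 C in auto)
        have "Ck_on k T (\<lambda>y. g' y h)"
        proof (rule linear_solve_Ck[where b="\<lambda>y. C h" and M="\<lambda>y. id_blinfun - (C o\<^sub>L B y)", OF T(1)])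
          fix y assume y: "y \<in> T"
          then have "B y (g' y h) = h"
            using bij[of y] g'_eq[of y] T(2) by (auto simp: B_def bij_is_surj surj_f_inv_f)
          then show "g' y h = C h + (id_blinfun - (C o\<^sub>L B y)) (g' y h)"
            by (simp add: blinfun.diff_left)
          show "norm (id_blinfun - (C o\<^sub>L B y)) \<le> 1/2" using y by (simp add: T_def)
        next
          have "Ck_on k T (\<lambda>y. id_blinfun + - (C o\<^sub>L B y))"
            by (intro Ck_on_add T(1) Ck_on_const Ck_on_bounded_linear[OF bounded_linear_minus[OF bounded_linear_ident]]
                Ck_on_bilinear[OF bounded_bilinear_blinfun_compose] Ck_on_subset[OF B T(2)])
          then show "Ck_on k T (\<lambda>y. id_blinfun - (C o\<^sub>L B y))" by simp
        qed simp
        with T show "\<exists>T. open T \<and> y0 \<in> T \<and> Ck_on k T (\<lambda>y. g' y h)" by blast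
      qed
    qed
  qed
  then have "smooth_on V g" by (simp add: smooth_on_def)
  then show ?thesis by (rule that[OF U' V hom])
qed

section \<open>Darboux coordinates on open subsets of coordinate spaces\<close>

text \<open>Forms given by real values become operator valued maps through their values on a basis,
  so smoothness has to be known for constant arguments only. The same device serves
  \<open>form2_of\<close>.\<close>

definition form1_of :: "('a::euclidean_space \<Rightarrow> real) \<Rightarrow> 'a \<Rightarrow>\<^sub>L real" where
  "form1_of e = (\<Sum>c\<in>Basis. e c *\<^sub>R blinfun_inner_left c)"

definition form2_of :: "('a::euclidean_space \<Rightarrow> 'a \<Rightarrow> real) \<Rightarrow> 'a \<Rightarrow>\<^sub>L 'a \<Rightarrow>\<^sub>L real" where
  "form2_of w = (\<Sum>b\<in>Basis. blinfun_scaleR_left (form1_of (w b)) o\<^sub>L blinfun_inner_left b)"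

lemma form1_of_apply: "linear e \<Longrightarrow> form1_of e h = e h"
  using vector_Basis_expansion[of e h]
  by (simp add: form1_of_def blinfun.sum_left blinfun.scaleR_left mult.commute)

lemma form2_of_apply:
  assumes "bilinear w" shows "form2_of w h k = w h k"
proof -
  have "form2_of w h k = (\<Sum>b\<in>Basis. (h \<bullet> b) *\<^sub>R w b k)"
    by (simp add: form2_of_def blinfun.sum_left blinfun_scaleR_left.rep_eq blinfun.scaleR_left
        form1_of_apply[OF bilinearD_linear(1)[OF assms]])
  then show ?thesis using vector_Basis_expansion[OF bilinearD_linear(2)[OF assms], of h k] by simp
qed

lemma smooth_on_form1_of:
  "open S \<Longrightarrow> (\<And>h. smooth_on S (\<lambda>u. e u h)) \<Longrightarrow> smooth_on S (\<lambda>u. form1_of (e u))"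
  unfolding form1_of_def by (intro smooth_on_sum smooth_on_scaleR) auto

lemma smooth_on_form2_of:
  "open S \<Longrightarrow> (\<And>h k. smooth_on S (\<lambda>u. w u h k)) \<Longrightarrow> smooth_on S (\<lambda>u. form2_of (w u))"
  unfolding form2_of_def
  by (intro smooth_on_sum smooth_on_bounded_linear[OF bounded_linear_rank_one] smooth_on_form1_of)

lemma fd_translate:
  fixes F :: "'a::real_normed_vector \<Rightarrow> 'b::real_normed_vector"
  assumes "smooth_on S F" "a + v \<in> S"
  shows "((\<lambda>v. F (a + v)) has_derivative fd F (a + v)) (at v)"
proof -
  have "((\<lambda>v. a + v) has_derivative (\<lambda>d. d)) (at v)"
    by (rule has_derivative_eq_rhs[OF has_derivative_add[OF has_derivative_const has_derivative_ident]]) simp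
  from has_derivative_compose[OF this smooth_on_has_derivative[OF assms]] show ?thesis .
qed

lemma smooth_on_translate:
  fixes F :: "'a::euclidean_space \<Rightarrow> 'b::real_normed_vector"
  assumes "open S" "smooth_on S F"
  shows "open ((\<lambda>v. a + v) -` S)" "smooth_on ((\<lambda>v. a + v) -` S) (\<lambda>v. F (a + v))"
proof -
  show o: "open ((\<lambda>v. a + v) -` S)" by (intro open_vimage assms(1) continuous_intros)
  show "smooth_on ((\<lambda>v. a + v) -` S) (\<lambda>v. F (a + v))"
    by (rule smooth_on_compose[OF o assms(1) _ assms(2)]) (auto intro!: smooth_on_add o smooth_on_id)
qed

text \<open>Since \<open>\<Theta>\<close> makes both forms constant, its inverse followed by a
  linear map adapted to the constant forms is the coordinate map \<open>\<Psi>\<close>. The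
  enumeration \<open>e\<close> puts \<open>z\<close> at 0, the \<open>x\<close> coordinates at
  \<open>1..n\<close> and the \<open>y\<close> coordinates at \<open>n + 1..2 * n\<close>.\<close>

theorem local_darboux:
  fixes w :: "real ^ 'm::finite \<Rightarrow> real ^ 'm \<Rightarrow> real ^ 'm \<Rightarrow> real" and \<epsilon> :: "real ^ 'm \<Rightarrow> real ^ 'm \<Rightarrow> real"
  assumes S: "open S" "u0 \<in> S" and dim: "CARD('m) = 2 * n + 1"
    and bil: "\<And>u. u \<in> S \<Longrightarrow> bilinear (w u)" and alt: "\<And>u h. u \<in> S \<Longrightarrow> w u h h = 0"
    and lin: "\<And>u. u \<in> S \<Longrightarrow> linear (\<epsilon> u)"
    and sw: "\<And>h k. smooth_on S (\<lambda>u. w u h k)" and s\<epsilon>: "\<And>h. smooth_on S (\<lambda>u. \<epsilon> u h)"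
    and clw: "\<And>u h k l. u \<in> S \<Longrightarrow>
      fd (\<lambda>u. w u k l) u h - fd (\<lambda>u. w u h l) u k + fd (\<lambda>u. w u h k) u l = 0"
    and cl\<epsilon>: "\<And>u h k. u \<in> S \<Longrightarrow> fd (\<lambda>u. \<epsilon> u k) u h - fd (\<lambda>u. \<epsilon> u h) u k = 0"
    and nondeg: "\<And>u h. u \<in> S \<Longrightarrow> (\<And>k. w u h k + \<epsilon> u h * \<epsilon> u k = 0) \<Longrightarrow> h = 0"
  obtains S' \<Psi> \<Xi> and e :: "nat \<Rightarrow> 'm" where "open S'" "u0 \<in> S'" "S' \<subseteq> S" "open (\<Psi> ` S')"
    "homeomorphism S' (\<Psi> ` S') \<Psi> \<Xi>" "smooth_on S' \<Psi>" "smooth_on (\<Psi> ` S') \<Xi>"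
    "bij_betw e {..<2 * n + 1} UNIV"
    "\<And>u h. u \<in> S' \<Longrightarrow> \<epsilon> u h = fd \<Psi> u h $ e 0"
    "\<And>u h k. u \<in> S' \<Longrightarrow> w u h k =
      (\<Sum>i=1..n. fd \<Psi> u h $ e i * fd \<Psi> u k $ e (n + i) - fd \<Psi> u k $ e i * fd \<Psi> u h $ e (n + i))"
proof -
  define V where "V = (\<lambda>v. u0 + v) -` S"
  define W0 where "W0 u = form2_of (w u)" for u
  define E0 where "E0 u = form1_of (\<epsilon> u)" for u
  have sW0: "smooth_on S W0" unfolding W0_def[abs_def] by (rule smooth_on_form2_of[OF S(1) sw])
  have sE0: "smooth_on S E0" unfolding E0_def[abs_def] by (rule smooth_on_form1_of[OF S(1) s\<epsilon>])
  define W where "W v = W0 (u0 + v)" for v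
  define E where "E v = E0 (u0 + v)" for v
  have V: "open V" "0 \<in> V" using smooth_on_translate(1)[OF S(1) sW0] S(2) by (auto simp: V_def)
  have sW: "smooth_on V W" unfolding V_def W_def[abs_def] by (rule smooth_on_translate(2)[OF S(1) sW0])
  have sE: "smooth_on V E" unfolding V_def E_def[abs_def] by (rule smooth_on_translate(2)[OF S(1) sE0])
  have W: "W v h k = w (u0 + v) h k" if "v \<in> V" for v h k
    using form2_of_apply[OF bil] that by (simp add: W_def W0_def V_def)
  have E: "E v h = \<epsilon> (u0 + v) h" if "v \<in> V" for v h
    using form1_of_apply[OF lin] that by (simp add: E_def E0_def V_def)
  have fdW: "fd W v d h k = fd (\<lambda>u. w u h k) (u0 + v) d" if v: "v \<in> V" for v d h k
  proof -
    have u: "u0 + v \<in> S" using v by (simp add: V_def)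
    have "fd W v = fd W0 (u0 + v)" unfolding W_def[abs_def] by (rule fd_eqI[OF fd_translate[OF sW0 u]])
    moreover have "((\<lambda>u. W0 u h k) has_derivative (\<lambda>d. fd W0 (u0 + v) d h k)) (at (u0 + v))"
      by (intro bounded_linear.has_derivative[OF blinfun.bounded_linear_left] smooth_on_has_derivative[OF sW0 u])
    moreover have "fd (\<lambda>u. w u h k) (u0 + v) = fd (\<lambda>u. W0 u h k) (u0 + v)"
      by (rule fd_cong_open[OF S(1) u]) (simp add: W0_def form2_of_apply[OF bil])
    ultimately show ?thesis by (simp add: fd_eqI)
  qed
  have fdE: "fd E v d h = fd (\<lambda>u. \<epsilon> u h) (u0 + v) d" if v: "v \<in> V" for v d h
  proof -
    have u: "u0 + v \<in> S" using v by (simp add: V_def)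
    have "fd E v = fd E0 (u0 + v)" unfolding E_def[abs_def] by (rule fd_eqI[OF fd_translate[OF sE0 u]])
    moreover have "((\<lambda>u. E0 u h) has_derivative (\<lambda>d. fd E0 (u0 + v) d h)) (at (u0 + v))"
      by (intro bounded_linear.has_derivative[OF blinfun.bounded_linear_left] smooth_on_has_derivative[OF sE0 u])
    moreover have "fd (\<lambda>u. \<epsilon> u h) (u0 + v) = fd (\<lambda>u. E0 u h) (u0 + v)"
      by (rule fd_cong_open[OF S(1) u]) (simp add: E0_def form1_of_apply[OF lin])
    ultimately show ?thesis by (simp add: fd_eqI)
  qed
  have VS: "u0 + v \<in> S" if "v \<in> V" for v using that by (simp add: V_def)
  have DIM: "DIM(real ^ 'm) = 2 * n + 1" using dim by simp
  have ndW: "h = 0" if "v \<in> V" "\<And>k. W v h k + E v h * E v k = 0" for v h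
    using nondeg[OF VS[OF that(1)], of h] that(2) W[OF that(1)] E[OF that(1)] by simp
  obtain U \<Theta> where U: "open U" "0 \<in> U" and \<Theta>: "smooth_on U \<Theta>" "\<Theta> 0 = 0" "\<Theta> ` U \<subseteq> V"
    and E\<Theta>: "\<And>u h. u \<in> U \<Longrightarrow> E (\<Theta> u) (fd \<Theta> u h) = E 0 h"
    and W\<Theta>: "\<And>u h k. u \<in> U \<Longrightarrow> W (\<Theta> u) (fd \<Theta> u h) (fd \<Theta> u k) = W 0 h k"
  proof (rule local_cosymplectic_normal_form[OF V sW sE _ _ _ _ DIM])
    show "W v h h = 0" if "v \<in> V" for v h by (simp add: W[OF that] alt[OF VS[OF that]])
    show "fd W v h k l - fd W v k h l + fd W v l h k = 0" if "v \<in> V" for v h k l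
      unfolding fdW[OF that] by (rule clw[OF VS[OF that]])
    show "fd E v h k = fd E v k h" if "v \<in> V" for v h k
      unfolding fdE[OF that] using cl\<epsilon>[OF VS[OF that], of k h] by simp
    show "h = 0" if "v \<in> V" "\<And>k. W v h k + E v h * E v k = 0" for v h using ndW[OF that] .
  qed (rule that; assumption)
  \<comment> \<open>The constant forms are pullbacks along \<open>\<Theta>\<close>, so a vector
    killed by its differential is annihilated by both, against nondegeneracy unless it is 0.\<close>
  have "h = 0" if h: "fd \<Theta> 0 h = 0" for h
  proof (rule ndW[OF V(2)])
    show "W 0 h k + E 0 h * E 0 k = 0" for k
      using E\<Theta>[OF U(2), of h] W\<Theta>[OF U(2), of h k] h by (simp add: blinfun.zero_right blinfun.zero_left)
  qed
  then obtain U' V' g where U': "open U'" "U' \<subseteq> U" "0 \<in> U'" and V': "open V'" and hom: "homeomorphism U' V' \<Theta> g"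
    and g: "smooth_on V' g"
    by (rule smooth_inverse_function[OF U \<Theta>(1)]) (assumption, (rule that; assumption))
  have \<Theta>g: "\<Theta> (g v) = v" "g v \<in> U'" if "v \<in> V'" for v using hom that by (auto simp: homeomorphism_def)
  have g\<Theta>: "g (\<Theta> u) = u" "\<Theta> u \<in> V'" if "u \<in> U'" for u using hom that by (auto simp: homeomorphism_def)
  have V'V: "V' \<subseteq> V" using \<Theta>g U'(2) \<Theta>(3) by (metis image_subset_iff subsetD subsetI)
  have inv: "fd \<Theta> (g v) (fd g v h) = h" if v: "v \<in> V'" for v h
  proof -
    have "g v \<in> U" using \<Theta>g(2)[OF v] U'(2) by blast
    from has_derivative_compose[OF smooth_on_has_derivative[OF g v] smooth_on_has_derivative[OF \<Theta>(1) this]]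
    have "((\<lambda>v. v) has_derivative (\<lambda>h. fd \<Theta> (g v) (fd g v h))) (at v)"
      by (rule has_derivative_transform_within_open[OF _ V' v \<Theta>g(1)])
    from fun_cong[OF has_derivative_unique[OF this has_derivative_ident]] show ?thesis .
  qed
  \<comment> \<open>Any radical satisfies this bound, as the dimension is \<open>2 * n + 1\<close>.
    It allows exactly \<open>n\<close> pairs of covectors, just enough to complete
    \<open>E 0\<close> to a coordinate system.\<close>
  have "DIM(real ^ 'm) \<le> dim {x. \<forall>y. W 0 x y = 0} + 2 * n + 1" using DIM by simp
  moreover have "W 0 h h = 0" for h using W[OF V(2), of h h] alt[OF S(2), of h] by simp
  ultimately obtain x y :: "nat \<Rightarrow> real ^ 'm \<Rightarrow> real" where xy: "\<And>i. linear (x i)" "\<And>i. linear (y i)"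
    and W0xy: "\<And>h l. W 0 h l = (\<Sum>i=1..n. x i h * y i l - x i l * y i h)"
    using alternating_normal_form[OF bilinear_blinfun2, of "W 0" n] by blast
  obtain e :: "nat \<Rightarrow> 'm" where e: "bij_betw e {..<2 * n + 1} UNIV"
    using ex_bij_betw_nat_finite[of "UNIV :: 'm set"] dim by (auto simp: atLeast0LessThan)
  define F where "F k = (if k = 0 then blinfun_apply (E 0) else if k \<le> n then x k else y (k - n))" for k
  have linF: "linear (F k)" for k
    using xy bounded_linear.linear[OF blinfun.bounded_linear_right] by (auto simp: F_def)
  define \<Lambda> where "\<Lambda> h = (\<chi> j. F (the_inv_into {..<2 * n + 1} e j) h)" for h
  have \<Lambda>e: "\<Lambda> h $ e k = F k h" if "k < 2 * n + 1" for h k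
    using the_inv_into_f_f[of e "{..<2 * n + 1}" k] e that by (simp add: \<Lambda>_def bij_betw_def)
  have lin\<Lambda>: "linear \<Lambda>"
    by (rule linearI) (simp_all add: \<Lambda>_def vec_eq_iff linear_add[OF linF] linear_scale[OF linF])
  have \<Lambda>E: "\<Lambda> h $ e 0 = E 0 h" for h using \<Lambda>e[of 0] by (simp add: F_def)
  have \<Lambda>x: "\<Lambda> h $ e i = x i h" and \<Lambda>y: "\<Lambda> h $ e (n + i) = y i h" if "i \<in> {1..n}" for h i
    using \<Lambda>e[of i h] \<Lambda>e[of "n + i" h] that by (auto simp: F_def)
  \<comment> \<open>If all these covectors vanish at \<open>h\<close>, then so do
    \<open>E 0 h\<close> and \<open>W 0 h\<close>, and nondegeneracy gives
    \<open>h = 0\<close>.\<close>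
  have "inj \<Lambda>" unfolding linear_injective_0[OF lin\<Lambda>]
  proof (intro allI impI)
    fix h assume h: "\<Lambda> h = 0"
    show "h = 0"
    proof (rule ndW[OF V(2)])
      have "E 0 h = 0" using \<Lambda>E[of h] h by simp
      moreover have "W 0 h k = 0" for k
        unfolding W0xy using \<Lambda>x[of _ h] \<Lambda>y[of _ h] h by (intro sum.neutral) simp
      ultimately show "W 0 h k + E 0 h * E 0 k = 0" for k by simp
    qed
  qed
  from linear_injective_isomorphism[OF lin\<Lambda> this] obtain M where M: "linear M" "\<And>x. M (\<Lambda> x) = x" "\<And>x. \<Lambda> (M x) = x"
    by blast
  have bl: "bounded_linear \<Lambda>" "bounded_linear M" using lin\<Lambda> M(1) by (simp_all add: linear_conv_bounded_linear)
  define \<Psi> where "\<Psi> u = \<Lambda> (g (- u0 + u))" for u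
  define \<Xi> where "\<Xi> a = u0 + \<Theta> (M a)" for a
  define S' where "S' = (\<lambda>u. - u0 + u) -` V'"
  have S'V': "- u0 + u \<in> V'" if "u \<in> S'" for u using that by (simp add: S'_def)
  have S': "open S'" unfolding S'_def by (rule smooth_on_translate(1)[OF V' g])
  have s\<Psi>: "smooth_on S' \<Psi>"
    unfolding S'_def \<Psi>_def[abs_def] by (intro smooth_on_bounded_linear[OF bl(1)] smooth_on_translate[OF V' g])
  have im: "\<Psi> ` S' = M -` U'"
  proof safe
    fix u assume "u \<in> S'"
    then show "\<Psi> u \<in> M -` U'" using \<Theta>g(2)[OF S'V'] by (simp add: \<Psi>_def M(2))
  next
    fix a assume a: "M a \<in> U'"
    then have "u0 + \<Theta> (M a) \<in> S'" using g\<Theta>(2) by (simp add: S'_def)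
    moreover have "\<Psi> (u0 + \<Theta> (M a)) = a" by (simp add: \<Psi>_def g\<Theta>(1)[OF a] M(3))
    ultimately show "a \<in> \<Psi> ` S'" by (metis image_eqI)
  qed
  have oi: "open (\<Psi> ` S')" unfolding im by (rule open_vimage[OF U'(1) linear_continuous_on[OF bl(2)]])
  have s\<Xi>: "smooth_on (\<Psi> ` S') \<Xi>" unfolding \<Xi>_def[abs_def]
    by (intro smooth_on_add oi smooth_on_const smooth_on_compose[OF oi U'(1) _ smooth_on_subset[OF \<Theta>(1) U'(2)] smooth_on_linear[OF bl(2) oi]])
      (simp add: im)
  have \<Xi>\<Psi>: "\<Xi> (\<Psi> u) = u" if "u \<in> S'" for u
    by (simp add: \<Xi>_def \<Psi>_def M(2) \<Theta>g(1)[OF S'V'[OF that, simplified]])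
  have fd\<Psi>: "fd \<Psi> u h = \<Lambda> (fd g (- u0 + u) h)" if "u \<in> S'" for u h
    unfolding \<Psi>_def[abs_def]
    using bounded_linear.has_derivative[OF bl(1) fd_translate[OF g S'V'[OF that]]] by (simp add: fd_eqI)
  have S'S: "S' \<subseteq> S" using S'V' V'V VS by fastforce
  show thesis
  proof (rule that[OF S' _ S'S oi _ s\<Psi> s\<Xi> e])
    show "u0 \<in> S'" using g\<Theta>(2)[OF U'(3)] \<Theta>(2) by (simp add: S'_def)
    show "homeomorphism S' (\<Psi> ` S') \<Psi> \<Xi>"
      using \<Xi>\<Psi> smooth_on_continuous[OF s\<Psi>] smooth_on_continuous[OF s\<Xi>] by (intro homeomorphismI) auto
    fix u assume u: "u \<in> S'"
    let ?v = "- u0 + u"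
    have v: "?v \<in> V" using S'V'[OF u] V'V by blast
    have gU: "g ?v \<in> U" using \<Theta>g(2)[OF S'V'[OF u]] U'(2) by blast
    show "\<epsilon> u h = fd \<Psi> u h $ e 0" for h
      using E\<Theta>[OF gU, of "fd g ?v h"] E[OF v] by (simp add: \<Theta>g[OF S'V'[OF u, simplified]] inv[OF S'V'[OF u, simplified]] fd\<Psi>[OF u] \<Lambda>E)
    show "w u h k = (\<Sum>i=1..n. fd \<Psi> u h $ e i * fd \<Psi> u k $ e (n + i) - fd \<Psi> u k $ e i * fd \<Psi> u h $ e (n + i))" for h k
    proof -
      have "w u h k = W 0 (fd g ?v h) (fd g ?v k)"
        using W\<Theta>[OF gU, of "fd g ?v h" "fd g ?v k"] W[OF v] by (simp add: \<Theta>g[OF S'V'[OF u, simplified]] inv[OF S'V'[OF u, simplified]])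
      then show ?thesis unfolding W0xy by (simp add: fd\<Psi>[OF u] \<Lambda>x \<Lambda>y)
    qed
  qed
qed

section \<open>Transfer to manifolds\<close>

locale smooth_atlas =
  fixes X :: "'a topology" and A :: "('a, 'm::finite) chart set"
  assumes manifold: "smooth_manifold X A"
begin

section \<open>Charts and transition maps\<close>

lemma chart: "c \<in> A \<Longrightarrow> is_chart X c"
  using manifold by (simp add: smooth_manifold_def)

lemma openin_cdom: "c \<in> A \<Longrightarrow> openin X (cdom c)"
  using chart by (simp add: is_chart_def)

lemma cdom_subset: "c \<in> A \<Longrightarrow> cdom c \<subseteq> topspace X"
  using openin_cdom openin_subset by blast

lemma topspace_cdom: "c \<in> A \<Longrightarrow> topspace (subtopology X (cdom c)) = cdom c"
  using cdom_subset by (simp add: inf_absorb2)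

lemma chart_homeomorphic:
  "c \<in> A \<Longrightarrow> homeomorphic_map (subtopology X (cdom c)) (top_of_set (cmap c ` cdom c)) (cmap c)"
  using chart by (simp add: is_chart_def)

lemma cinv_cmap: "c \<in> A \<Longrightarrow> q \<in> cdom c \<Longrightarrow> cinv c (cmap c q) = q"
  using homeomorphic_imp_injective_map[OF chart_homeomorphic] topspace_cdom
  by (simp add: cinv_def inv_into_f_f)

lemma open_cmap_image:
  assumes c: "c \<in> A" and D: "openin X D" "D \<subseteq> cdom c"
  shows "open (cmap c ` D)"
proof -
  have "openin (subtopology X (cdom c)) D"
    using D by (metis inf.absorb1 openin_subtopology)
  then have "openin (top_of_set (cmap c ` cdom c)) (cmap c ` D)"
    using homeomorphic_map_openness[OF chart_homeomorphic[OF c], of D] D(2) unfolding topspace_cdom[OF c] by blast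
  moreover have "open (cmap c ` cdom c)" using chart[OF c] by (simp add: is_chart_def)
  ultimately show ?thesis using openin_open_trans by blast
qed

lemma transition_cmap: "c \<in> A \<Longrightarrow> q \<in> cdom c \<Longrightarrow> transition c d (cmap c q) = cmap d q"
  by (simp add: transition_def cinv_cmap)

lemma smooth_transition:
  "c \<in> A \<Longrightarrow> d \<in> A \<Longrightarrow> smooth_on (cmap c ` (cdom c \<inter> cdom d)) (transition c d)"
  using manifold by (simp add: smooth_manifold_def smooth_compatible_def)

lemma transition_has_derivative:
  assumes "c \<in> A" "d \<in> A" "q \<in> cdom c" "q \<in> cdom d"
  shows "(transition c d has_derivative fd (transition c d) (cmap c q)) (at (cmap c q))"
  by (rule smooth_on_has_derivative[OF smooth_transition[OF assms(1,2)]]) (use assms in auto)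

lemma linear_fd_transition:
  assumes "c \<in> A" "d \<in> A" "q \<in> cdom c" "q \<in> cdom d"
  shows "linear (fd (transition c d) (cmap c q))"
  using has_derivative_linear[OF transition_has_derivative[OF assms]] .

text \<open>Chain rule on the triple overlap; this cocycle identity is what makes
  \<open>tvec\<close> obey the transformation law.\<close>

lemma fd_transition_compose:
  assumes c: "c \<in> A" "q \<in> cdom c" and d: "d \<in> A" "q \<in> cdom d" and c': "c' \<in> A" "q \<in> cdom c'"
  shows "fd (transition c d) (cmap c q) h = fd (transition c' d) (cmap c' q) (fd (transition c c') (cmap c q) h)"
proof -
  let ?D = "cdom c \<inter> (cdom c' \<inter> cdom d)"
  have o: "open (cmap c ` ?D)"
    by (rule open_cmap_image[OF c(1)]) (intro openin_Int openin_cdom c(1) c'(1) d(1), blast)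
  have "((\<lambda>x. transition c' d (transition c c' x)) has_derivative
      (\<lambda>h. fd (transition c' d) (cmap c' q) (fd (transition c c') (cmap c q) h))) (at (cmap c q))"
    using transition_has_derivative[OF c'(1) d(1) c'(2) d(2)]
    by (intro has_derivative_compose[OF transition_has_derivative[OF c(1) c'(1) c(2) c'(2)]])
      (simp add: transition_cmap[OF c])
  then have "(transition c d has_derivative
      (\<lambda>h. fd (transition c' d) (cmap c' q) (fd (transition c c') (cmap c q) h))) (at (cmap c q))"
    by (rule has_derivative_transform_within_open[OF _ o])
      (use c d c' in \<open>auto simp: transition_cmap\<close>)
  then show ?thesis by (simp add: fd_eqI)
qed

lemma fd_transition_self:
  assumes "c \<in> A" "q \<in> cdom c"
  shows "fd (transition c c) (cmap c q) h = h"
proof -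
  have "open (cmap c ` cdom c)" by (rule open_cmap_image[OF assms(1) openin_cdom[OF assms(1)]]) simp
  then have "(transition c c has_derivative (\<lambda>h. h)) (at (cmap c q))"
    by (rule has_derivative_transform_within_open[OF has_derivative_ident])
      (use assms in \<open>auto simp: transition_cmap\<close>)
  then show ?thesis by (simp add: fd_eqI)
qed

section \<open>Tangent vectors and covectors in a chart\<close>

lemma tangent_transition:
  assumes "v \<in> tangent_space A q" "c \<in> A" "q \<in> cdom c" "d \<in> A" "q \<in> cdom d"
  shows "fd (transition c d) (cmap c q) (v c) = v d"
proof -
  have "\<forall>c\<in>A. \<forall>d\<in>A. q \<in> cdom c \<and> q \<in> cdom d \<longrightarrow> v d = fd (transition c d) (cmap c q) (v c)"
    using assms(1) unfolding tangent_space_def by blast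
  from this[rule_format, OF assms(2,4) conjI[OF assms(3,5)]] show ?thesis by (rule sym)
qed

lemma tvec_self: "c \<in> A \<Longrightarrow> q \<in> cdom c \<Longrightarrow> tvec A c q h c = h"
  by (simp add: tvec_def fd_transition_self)

lemma tvec_mem:
  assumes c: "c \<in> A" "q \<in> cdom c" shows "tvec A c q h \<in> tangent_space A q"
proof -
  have "tvec A c q h d = fd (transition c' d) (cmap c' q) (tvec A c q h c')"
    if "c' \<in> A" "d \<in> A" "q \<in> cdom c'" "q \<in> cdom d" for c' d
    unfolding tvec_def using that fd_transition_compose[OF c that(2,4,1,3)] by (simp only: simp_thms if_True)
  moreover have "tvec A c q h d = 0" if "d \<notin> A \<or> q \<notin> cdom d" for d
    using that unfolding tvec_def by presburger
  ultimately show ?thesis unfolding tangent_space_def mem_Collect_eq by blast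
qed

lemma tvec_tangent:
  assumes "c \<in> A" "q \<in> cdom c" "v \<in> tangent_space A q"
  shows "tvec A c q (v c) = v"
proof
  fix d
  have "d \<notin> A \<or> q \<notin> cdom d \<Longrightarrow> v d = 0" using assms(3) unfolding tangent_space_def by blast
  then show "tvec A c q (v c) d = v d"
    using tangent_transition[OF assms(3,1,2), of d] unfolding tvec_def by presburger
qed

lemma tvec_add:
  "c \<in> A \<Longrightarrow> q \<in> cdom c \<Longrightarrow> tvec A c q (h + k) = (\<lambda>d. tvec A c q h d + tvec A c q k d)"
  by (auto simp: tvec_def fun_eq_iff linear_add[OF linear_fd_transition])

lemma tvec_scaleR:
  "c \<in> A \<Longrightarrow> q \<in> cdom c \<Longrightarrow> tvec A c q (r *\<^sub>R h) = (\<lambda>d. r *\<^sub>R tvec A c q h d)"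
  by (auto simp: tvec_def fun_eq_iff linear_scale[OF linear_fd_transition])

lemma tangent_linear_tvec:
  assumes "tangent_linear A q \<alpha>" "c \<in> A" "q \<in> cdom c"
  shows "linear (\<lambda>h. \<alpha> (tvec A c q h))"
proof (rule linearI)
  note tv = tvec_mem[OF assms(2,3)]
  show "\<alpha> (tvec A c q (h + k)) = \<alpha> (tvec A c q h) + \<alpha> (tvec A c q k)" for h k
    unfolding tvec_add[OF assms(2,3)] using assms(1) tv unfolding tangent_linear_def by blast
  show "\<alpha> (tvec A c q (r *\<^sub>R h)) = r *\<^sub>R \<alpha> (tvec A c q h)" for r h
    unfolding tvec_scaleR[OF assms(2,3)] real_scaleR_def using assms(1) tv unfolding tangent_linear_def by blast
qed

lemma zero_tangent: "(\<lambda>c. 0) \<in> tangent_space A q"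
  by (simp only: tangent_space_def mem_Collect_eq) (simp add: linear_0[OF linear_fd_transition])

lemma tangent_linear_0:
  assumes "tangent_linear A q \<alpha>" shows "\<alpha> (\<lambda>c. 0) = 0"
proof -
  have "\<forall>v\<in>tangent_space A q. \<alpha> (\<lambda>c. 0 *\<^sub>R v c) = 0 * \<alpha> v"
    using assms unfolding tangent_linear_def by blast
  from bspec[OF this zero_tangent] show ?thesis by simp
qed

text \<open>\<open>differential\<close> computes in an arbitrarily chosen chart. The transformation
  law of tangent vectors moves the result to \<open>d\<close>, where the coordinate is a linear
  function.\<close>

lemma differential_coordinate:
  assumes "d \<in> A" "q \<in> cdom d" "v \<in> tangent_space A q"
  shows "differential A (\<lambda>p. cmap d p $ j) q v = v d $ j"
proof -
  define c where "c = (SOME c. c \<in> A \<and> q \<in> cdom c)"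
  have "c \<in> A \<and> q \<in> cdom c" unfolding c_def by (rule someI[of _ d]) (use assms in blast)
  then have c: "c \<in> A" "q \<in> cdom c" by blast+
  have "((\<lambda>p. cmap d p $ j) \<circ> cinv c has_derivative (\<lambda>h. fd (transition c d) (cmap c q) h $ j)) (at (cmap c q))"
    using bounded_linear.has_derivative[OF bounded_linear_vec_nth transition_has_derivative[OF c(1) assms(1) c(2) assms(2)], of j]
    by (simp add: transition_def comp_def)
  then have "differential A (\<lambda>p. cmap d p $ j) q v = fd (transition c d) (cmap c q) (v c) $ j"
    by (simp add: differential_def Let_def c_def[symmetric] fd_eqI)
  also have "fd (transition c d) (cmap c q) (v c) = v d"
    by (rule tangent_transition[OF assms(3) c assms(1,2)])
  finally show ?thesis .
qed

text \<open>Maximality of the atlas: the new chart is compatible with every old one, since its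
  transition maps are old transition maps composed with \<open>\<Psi>\<close> or
  \<open>\<Xi>\<close>.\<close>

lemma restricted_chart_mem:
  assumes c: "c \<in> A" and S: "open S" "S \<subseteq> cmap c ` cdom c" and im: "open (\<Psi> ` S)"
    and hom: "homeomorphism S (\<Psi> ` S) \<Psi> \<Xi>" and \<Psi>: "smooth_on S \<Psi>" and \<Xi>: "smooth_on (\<Psi> ` S) \<Xi>"
  shows "({q \<in> cdom c. cmap c q \<in> S}, \<lambda>q. \<Psi> (cmap c q)) \<in> A"
proof -
  define D where "D = {q \<in> cdom c. cmap c q \<in> S}"
  define d where "d = (D, \<lambda>q. \<Psi> (cmap c q))"
  have dd: "cdom d = D" "\<And>q. cmap d q = \<Psi> (cmap c q)" by (simp_all add: d_def)
  have D: "openin X D" "D \<subseteq> cdom c"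
  proof -
    have "openin (subtopology X (cdom c)) {q \<in> topspace (subtopology X (cdom c)). cmap c q \<in> S}"
      by (rule openin_continuous_map_preimage[OF homeomorphic_imp_continuous_map[OF chart_homeomorphic[OF c]]])
        (use S in \<open>auto simp: openin_open\<close>)
    then show "openin X D"
      unfolding topspace_cdom[OF c] D_def by (rule openin_trans_full[OF _ openin_cdom[OF c]])
  qed (auto simp: D_def)
  have cD: "cmap c ` D = S" using S(2) unfolding D_def by blast
  have \<Xi>\<Psi>: "\<Xi> (\<Psi> x) = x" if "x \<in> S" for x using hom that by (auto simp: homeomorphism_def)
  have dim: "cmap d ` B = \<Psi> ` (cmap c ` B)" for B by (simp add: dd image_image)
  have cinv_d: "cinv d (\<Psi> (cmap c q)) = q" if "q \<in> D" for q
  proof -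
    have "inj_on (cmap d) (cdom d)"
    proof (rule inj_onI, unfold dd)
      fix q r assume "q \<in> D" "r \<in> D" "\<Psi> (cmap c q) = \<Psi> (cmap c r)"
      moreover from calculation have "cmap c q \<in> S" "cmap c r \<in> S" "q \<in> cdom c" "r \<in> cdom c"
        unfolding D_def by blast+
      ultimately show "q = r" using \<Xi>\<Psi> cinv_cmap[OF c] by metis
    qed
    from inv_into_f_f[OF this, of q] show ?thesis using that unfolding cinv_def dd by blast
  qed
  have "is_chart X d"
  proof -
    have 1: "homeomorphic_map (subtopology X D) (top_of_set S) (cmap c)"
    proof -
      have "cmap c ` (topspace (subtopology X (cdom c)) \<inter> D) = topspace (top_of_set (cmap c ` cdom c)) \<inter> S"
        unfolding topspace_cdom[OF c] Int_absorb1[OF D(2)] cD using S(2) by auto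
      from homeomorphic_map_subtopologies[OF chart_homeomorphic[OF c] this]
      show ?thesis using D(2) S(2) by (simp add: subtopology_subtopology Int_absorb1)
    qed
    have 2: "homeomorphic_map (top_of_set S) (top_of_set (\<Psi> ` S)) \<Psi>"
      unfolding homeomorphic_map_maps homeomorphic_maps_def continuous_map_subtopology_eu
      using hom by (intro exI[of _ \<Xi>]) (auto simp: homeomorphism_def)
    have cm: "cmap d = \<Psi> \<circ> cmap c" by (rule ext) (simp add: dd)
    have "homeomorphic_map (subtopology X (cdom d)) (top_of_set (cmap d ` cdom d)) (cmap d)"
      unfolding dd(1) dim cD unfolding cm by (rule homeomorphic_map_compose[OF 1 2])
    moreover have "open (cmap d ` cdom d)" unfolding dd(1) dim cD by (rule im)
    ultimately show ?thesis using D(1) unfolding is_chart_def dd(1) by blast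
  qed
  moreover have "smooth_compatible d c'" if c': "c' \<in> A" for c'
    unfolding smooth_compatible_def
  proof
    let ?B = "cdom d \<inter> cdom c'"
    have B: "openin X ?B" "?B \<subseteq> cdom c" using D openin_cdom[OF c'] by (auto simp: dd)
    have BS: "cmap c ` ?B \<subseteq> S" using cD by (auto simp: dd)
    have oc: "open (cmap c ` ?B)" by (rule open_cmap_image[OF c B])
    have oc': "open (cmap c' ` ?B)" by (rule open_cmap_image[OF c' B(1)]) simp
    have st: "smooth_on (cmap c ` ?B) (transition c c')"
      by (rule smooth_on_subset[OF smooth_transition[OF c c']]) (use B in auto)
    have st': "smooth_on (cmap c' ` ?B) (transition c' c)"
      by (rule smooth_on_subset[OF smooth_transition[OF c' c]]) (use B in auto)
    \<comment> \<open>The image is written as a preimage under the continuous map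
      \<open>\<Xi>\<close>, which gives its openness before \<open>d\<close> is known to belong to
      \<open>A\<close>.\<close>
    have "cmap d ` ?B = \<Psi> ` S \<inter> \<Xi> -` (cmap c ` ?B)"
      unfolding dim using BS \<Xi>\<Psi> by (auto simp: image_iff)
    then have od: "open (cmap d ` ?B)"
      using continuous_open_preimage[OF smooth_on_continuous[OF \<Xi>] im oc] by simp
    show "smooth_on (cmap d ` ?B) (transition d c')"
    proof (rule smooth_on_cong[OF od])
      show "smooth_on (cmap d ` ?B) (\<lambda>a. transition c c' (\<Xi> a))"
      proof (rule smooth_on_compose[OF od oc _ st])
        show "\<Xi> ` cmap d ` ?B \<subseteq> cmap c ` ?B"
        proof
          fix a assume "a \<in> \<Xi> ` cmap d ` ?B"
          then obtain q where q: "q \<in> ?B" "a = \<Xi> (\<Psi> (cmap c q))" unfolding dim by blast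
          then have "a = cmap c q" using BS \<Xi>\<Psi> by blast
          with q(1) show "a \<in> cmap c ` ?B" by blast
        qed
        show "smooth_on (cmap d ` ?B) \<Xi>" by (rule smooth_on_subset[OF \<Xi>]) (unfold dim, rule image_mono[OF BS])
      qed
      show "transition c c' (\<Xi> a) = transition d c' a" if "a \<in> cmap d ` ?B" for a
      proof -
        obtain q where q: "q \<in> D" "a = \<Psi> (cmap c q)" using \<open>a \<in> cmap d ` ?B\<close> unfolding dd by blast
        have "cmap c q \<in> S" "q \<in> cdom c" using q(1) unfolding D_def by blast+
        then show ?thesis by (simp add: q(2) \<Xi>\<Psi> transition_cmap[OF c] transition_def[of d c'] cinv_d[OF q(1)])
      qed
    qed
    show "smooth_on (cmap c' ` ?B) (transition c' d)"
    proof (rule smooth_on_cong[OF oc'])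
      show "smooth_on (cmap c' ` ?B) (\<lambda>x. \<Psi> (transition c' c x))"
      proof (rule smooth_on_compose[OF oc' S(1) _ \<Psi> st'])
        show "transition c' c ` cmap c' ` ?B \<subseteq> S" using BS by (auto simp: transition_cmap[OF c'])
      qed
      show "\<Psi> (transition c' c x) = transition c' d x" if "x \<in> cmap c' ` ?B" for x
        using that by (auto simp: transition_cmap[OF c'] dd)
    qed
  qed
  ultimately have "d \<in> A" using manifold unfolding smooth_manifold_def by blast
  then show ?thesis by (simp add: d_def D_def)
qed

end

theorem theorem2p10:
  fixes X :: "'a topology" and A :: "('a, 'm::finite) chart set"
    and \<omega> :: "('a, 'm) form2" and \<eta> :: "('a, 'm) form1" and n :: nat and p :: 'a
  assumes "cosymplectic_manifold X A \<omega> \<eta>"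
    and "CARD('m) = 2 * n + 1"
    and "p \<in> topspace X"
  shows "\<exists>(U :: 'a set) (z :: 'a \<Rightarrow> real) (x :: nat \<Rightarrow> 'a \<Rightarrow> real) (y :: nat \<Rightarrow> 'a \<Rightarrow> real).
           p \<in> U \<and>
           local_coordinates A U (z # map x [1..<n+1] @ map y [1..<n+1]) \<and>
           (\<forall>q\<in>U. \<forall>v\<in>tangent_space A q. \<eta> q v = differential A z q v) \<and>
           (\<forall>q\<in>U. \<forall>v\<in>tangent_space A q. \<forall>w\<in>tangent_space A q.
              \<omega> q v w = (\<Sum>i=1..n. wedge (differential A (x i)) (differential A (y i)) q v w))"
proof -
  have man: "smooth_manifold X A" and cl\<omega>: "closed_two_form X A \<omega>" and cl\<eta>: "closed_one_form X A \<eta>"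
    and nd: "\<And>q. q \<in> topspace X \<Longrightarrow>
        bij_betw (\<lambda>v. restrict (\<lambda>w. \<omega> q v w + \<eta> q v * \<eta> q w) (tangent_space A q)) (tangent_space A q) (cotangent_space A q)"
    using assms(1) by (auto simp: cosymplectic_manifold_def)
  interpret smooth_atlas X A using man by unfold_locales
  have "p \<in> (\<Union>c\<in>A. cdom c)" using man assms(3) unfolding smooth_manifold_def by simp
  then obtain c where c: "c \<in> A" "p \<in> cdom c" by blast
  define S where "S = cmap c ` cdom c"
  define \<epsilon> where "\<epsilon> = local_form1 A c \<eta>"
  define w where "w = local_form2 A c \<omega>"
  have \<epsilon>: "\<epsilon> (cmap c q) h = \<eta> q (tvec A c q h)" if "q \<in> cdom c" for q h
    by (simp add: \<epsilon>_def local_form1_def cinv_cmap[OF c(1) that])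
  have w: "w (cmap c q) h k = \<omega> q (tvec A c q h) (tvec A c q k)" if "q \<in> cdom c" for q h k
    by (simp add: w_def local_form2_def cinv_cmap[OF c(1) that])
  have top: "q \<in> topspace X" if "q \<in> cdom c" for q using that cdom_subset[OF c(1)] by blast
  have lin\<eta>: "tangent_linear A q (\<eta> q)" if "q \<in> cdom c" for q
    using cl\<eta> top[OF that] unfolding closed_one_form_def one_form_def by blast
  have lin\<omega>: "tangent_linear A q (\<lambda>w. \<omega> q v w)" "tangent_linear A q (\<lambda>w. \<omega> q w v)" "\<omega> q v v = 0"
    if "q \<in> cdom c" "v \<in> tangent_space A q" for q v
    using cl\<omega> top[OF that(1)] that(2) unfolding closed_two_form_def two_form_def by blast+
  have S: "open S" "cmap c p \<in> S"
    unfolding S_def using open_cmap_image[OF c(1) openin_cdom[OF c(1)]] c(2) by auto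
  obtain S' \<Psi> \<Xi> and e :: "nat \<Rightarrow> 'm" where S': "open S'" "cmap c p \<in> S'" "S' \<subseteq> S" and im: "open (\<Psi> ` S')"
    and hom: "homeomorphism S' (\<Psi> ` S') \<Psi> \<Xi>" and s\<Psi>: "smooth_on S' \<Psi>" and s\<Xi>: "smooth_on (\<Psi> ` S') \<Xi>"
    and e: "bij_betw e {..<2 * n + 1} UNIV"
    and \<epsilon>\<Psi>: "\<And>u h. u \<in> S' \<Longrightarrow> \<epsilon> u h = fd \<Psi> u h $ e 0"
    and w\<Psi>: "\<And>u h k. u \<in> S' \<Longrightarrow> w u h k =
      (\<Sum>i=1..n. fd \<Psi> u h $ e i * fd \<Psi> u k $ e (n + i) - fd \<Psi> u k $ e i * fd \<Psi> u h $ e (n + i))"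
  proof (rule local_darboux[OF S assms(2), of w \<epsilon>])
    show "smooth_on S (\<lambda>u. w u h k)" for h k
      using cl\<omega> c(1) unfolding closed_two_form_def two_form_def w_def S_def by blast
    show "smooth_on S (\<lambda>u. \<epsilon> u h)" for h
      using cl\<eta> c(1) unfolding closed_one_form_def one_form_def \<epsilon>_def S_def by blast
    fix u assume "u \<in> S"
    then obtain q where q: "q \<in> cdom c" "u = cmap c q" by (auto simp: S_def)
    note tv = tvec_mem[OF c(1) q(1)]
    show "linear (\<epsilon> u)"
      using tangent_linear_tvec[OF lin\<eta>[OF q(1)] c(1) q(1)] unfolding q(2) \<epsilon>[OF q(1), abs_def] .
    show "bilinear (w u)"
      unfolding bilinear_def q(2) w[OF q(1)]
      using tangent_linear_tvec[OF lin\<omega>(1)[OF q(1) tv] c(1) q(1)] tangent_linear_tvec[OF lin\<omega>(2)[OF q(1) tv] c(1) q(1)]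
      by blast
    show "w u h h = 0" for h unfolding q(2) w[OF q(1)] by (rule lin\<omega>(3)[OF q(1) tv])
    show "fd (\<lambda>u. w u k l) u h - fd (\<lambda>u. w u h l) u k + fd (\<lambda>u. w u h k) u l = 0" for h k l
      using cl\<omega> c(1) \<open>u \<in> S\<close> unfolding closed_two_form_def ext_deriv2_def w_def S_def by blast
    show "fd (\<lambda>u. \<epsilon> u k) u h - fd (\<lambda>u. \<epsilon> u h) u k = 0" for h k
      using cl\<eta> c(1) \<open>u \<in> S\<close> unfolding closed_one_form_def ext_deriv1_def \<epsilon>_def S_def by blast
    show "h = 0" if h: "\<And>k. w u h k + \<epsilon> u h * \<epsilon> u k = 0" for h
    proof -
      let ?F = "\<lambda>v. restrict (\<lambda>w. \<omega> q v w + \<eta> q v * \<eta> q w) (tangent_space A q)"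
      \<comment> \<open>Nondegeneracy in the chart is injectivity of the cosymplectic map:
        \<open>tvec A c q h\<close> and the zero vector have equal images.\<close>
      have "?F (tvec A c q h) = ?F (\<lambda>c. 0)"
      proof (rule restrict_ext)
        fix v assume v: "v \<in> tangent_space A q"
        have "\<omega> q (tvec A c q h) v + \<eta> q (tvec A c q h) * \<eta> q v = 0"
          using h[of "v c"] unfolding q(2) w[OF q(1)] \<epsilon>[OF q(1)] tvec_tangent[OF c(1) q(1) v] .
        then show "\<omega> q (tvec A c q h) v + \<eta> q (tvec A c q h) * \<eta> q v = \<omega> q (\<lambda>c. 0) v + \<eta> q (\<lambda>c. 0) * \<eta> q v"
          using tangent_linear_0[OF lin\<omega>(2)[OF q(1) v]] tangent_linear_0[OF lin\<eta>[OF q(1)]] by simp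
      qed
      then have "tvec A c q h = (\<lambda>c. 0)"
        using nd[OF top[OF q(1)]] tv zero_tangent by (auto simp: bij_betw_def dest: inj_onD)
      then show "h = 0" using tvec_self[OF c(1) q(1), of h] by simp
    qed
  qed (rule that; assumption)
  define D where "D = {q \<in> cdom c. cmap c q \<in> S'}"
  define d where "d = (D, \<lambda>q. \<Psi> (cmap c q))"
  have d: "d \<in> A"
    unfolding d_def D_def
    by (rule restricted_chart_mem[OF c(1) S'(1) S'(3)[unfolded S_def] im hom s\<Psi> s\<Xi>])
  have dd: "cdom d = D" by (simp add: d_def)
  have Dc: "q \<in> cdom c" "cmap c q \<in> S'" if "q \<in> D" for q using that by (auto simp: D_def)
  define f where "f k = (\<lambda>q. cmap d q $ e k)" for k
  have df: "differential A (f k) q v = fd \<Psi> (cmap c q) (v c) $ e k"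
    if q: "q \<in> D" and v: "v \<in> tangent_space A q" for k q v
  proof -
    \<comment> \<open>Seen from \<open>c\<close>, the new chart is \<open>\<Psi>\<close> itself, so
      the differentials of the new coordinates are the components of
      \<open>fd \<Psi>\<close>.\<close>
    have "fd (transition c d) (cmap c q) = fd \<Psi> (cmap c q)"
      by (rule fd_cong_open[OF S'(1) Dc(2)[OF q]])
        (use S'(3) in \<open>auto simp: S_def d_def transition_def cinv_cmap[OF c(1)]\<close>)
    moreover have "fd (transition c d) (cmap c q) (v c) = v d"
      by (rule tangent_transition[OF v c(1) Dc(1)[OF q] d]) (simp add: dd q)
    ultimately show ?thesis
      using differential_coordinate[OF d _ v, of "e k"] q by (simp add: f_def dd)
  qed
  \<comment> \<open>The ordering matches \<open>e\<close>: the entry at position \<open>k\<close> is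
    \<open>f k\<close>, with \<open>z\<close> at 0, \<open>x i\<close> at \<open>i\<close> and
    \<open>y i\<close> at \<open>n + i\<close>.\<close>
  let ?fs = "f 0 # map f [1..<n+1] @ map (\<lambda>i. f (n + i)) [1..<n+1]"
  have nth: "?fs ! k = f k" if "k < 2 * n + 1" for k
  proof -
    consider "k = 0" | "1 \<le> k" "k \<le> n" | "n < k" by linarith
    then show ?thesis using that by cases (auto simp: nth_Cons' nth_append simp del: upt_Suc)
  qed
  have lc: "local_coordinates A D ?fs"
    unfolding local_coordinates_def
  proof (intro exI conjI ballI allI impI)
    have len: "length ?fs = 2 * n + 1" by (simp del: upt_Suc)
    show "(D, cmap d) \<in> A" using d by (simp add: d_def)
    show "bij_betw e {..<length ?fs} UNIV" unfolding len by (rule e)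
    fix q k
    assume "k < length ?fs"
    then show "(?fs ! k) q = cmap d q $ e k" unfolding len by (simp only: nth) (simp only: f_def)
  qed
  have \<eta>_eq: "\<eta> q v = differential A (f 0) q v" if q: "q \<in> D" and v: "v \<in> tangent_space A q" for q v
    using \<epsilon>\<Psi>[OF Dc(2)[OF q], of "v c"]
    unfolding \<epsilon>[OF Dc(1)[OF q]] tvec_tangent[OF c(1) Dc(1)[OF q] v] df[OF q v] .
  have \<omega>_eq: "\<omega> q v u = (\<Sum>i=1..n. wedge (differential A (f i)) (differential A (f (n + i))) q v u)"
    if q: "q \<in> D" and v: "v \<in> tangent_space A q" and u: "u \<in> tangent_space A q" for q v u
    using w\<Psi>[OF Dc(2)[OF q], of "v c" "u c"]
    unfolding w[OF Dc(1)[OF q]] tvec_tangent[OF c(1) Dc(1)[OF q] v] tvec_tangent[OF c(1) Dc(1)[OF q] u]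
      wedge_def df[OF q v] df[OF q u] .
  have "p \<in> D" using c(2) S'(2) by (simp add: D_def)
  show ?thesis
    by (rule exI[of _ D], rule exI[of _ "f 0"], rule exI[of _ f], rule exI[of _ "\<lambda>i. f (n + i)"],
        intro conjI ballI; (fact \<open>p \<in> D\<close> lc | (rule \<eta>_eq \<omega>_eq; assumption)))
qed

end
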